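(* Let $I$ be a compact real interval and let $f:I\to I$ be continuous. Suppose $f$ has a periodic orbit of minimal period $s=2^k(2n+1)$, where $n\ge1$ and $k\ge0$ are integers, and has no periodic orbit of minimal period $r$ for any $r$ with $r\prec s$ in the Sharkovskii ordering. Then for every positive integer $t$ with $s\prec t$ in the Sharkovskii ordering and $2^k\mid t$, $f$ has at least $\Phi_n(t/2^k)/(t/2^k)$ distinct periodic orbits of minimal period $t$. Moreover, this lower bound is sharp: it is attained by some such $f$.
   Context: The Sharkovskii ordering of the positive integers is $3\prec5\prec7\prec\cdots\prec2\cdot3\prec2\cdot5\prec\cdots\prec2^2\cdot3\prec2^2\cdot5\prec\cdots\prec\cdots\prec2^3\prec2^2\prec2\prec1$ (odd numbers $>1$ in increasing order, then twice those, then four times those, etc., and finally the powers of $2$ in decreasing order). For an integer-valued $\phi$ on the positive integers, $\Phi(m,\phi)=\sum_{d\mid m}\mu(m/d)\phi(d)$ ($\mu$ the Möbius function). $\Phi_1(m)=\Phi(m,\phi)$ where $\phi$ is the Lucas sequence ($\phi(1)=1,\phi(2)=3,\phi(m+2)=\phi(m+1)+\phi(m)$). For $n>1$: let $Q_n=\{(1,n+1)\}\cup\{(m,2n+2-m):2\le m\le n\}\cup\{(m,2n+1-m):n+1\le m\le 2n\}$; for $1\le i,j\le 2n$, $k\ge1$, let $b_{1,i,j,n}=1$ if $(i,j)\in Q_n$ and $0$ otherwise, and $b_{k+1,i,j,n}=b_{k,i,2n+1-j,n}+b_{k,i,n+1,n}$ ($1\le j\le n-1$), $b_{k+1,i,n,n}=b_{k,i,n,n}+b_{k,i,n+1,n}$,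 $b_{k+1,i,n+1,n}=b_{k,i,1,n}$, $b_{k+1,i,j,n}=b_{k,i,2n+2-j,n}$ ($n+2\le j\le 2n$); let $c_{k,n}=\sum_{i=1}^{2n}b_{k,i,i,n}+b_{k,n+1,n,n}+\sum_{i=n+2}^{2n}b_{k,i,n+1,n}$, and $\Phi_n(m)=\Phi(m,\phi_n)$ with $\phi_n(k)=c_{k,n}$. *)

theory Defs
  imports "HOL-Analysis.Analysis" "HOL-Computational_Algebra.Computational_Algebra"
begin

definition two_exp :: "nat \<Rightarrow> nat" where
  "two_exp m = multiplicity (2::nat) m"

definition odd_part :: "nat \<Rightarrow> nat" where
  "odd_part m = m div 2 ^ two_exp m"

text \<open>sh_prec a b means a precedes b in the Sharkovskii ordering
  3, 5, 7, ..., 2*3, 2*5, ..., 4*3, ..., ..., 8, 4, 2, 1 (on positive integers).\<close>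
definition sh_prec :: "nat \<Rightarrow> nat \<Rightarrow> bool" where
  "sh_prec a b \<longleftrightarrow> 0 < a \<and> 0 < b \<and>
     (if odd_part a > 1 then
        (odd_part b = 1 \<or>
         two_exp a < two_exp b \<or>
         (two_exp a = two_exp b \<and> odd_part a < odd_part b))
      else (odd_part b = 1 \<and> a > b))"

definition moebius_mu :: "nat \<Rightarrow> int" where
  "moebius_mu m = (if m = 0 then 0 else if squarefree m then (-1) ^ card (prime_factors m) else 0)"

definition PhiSum :: "nat \<Rightarrow> (nat \<Rightarrow> int) \<Rightarrow> int" where
  "PhiSum m phi = (\<Sum>d \<in> {d. d dvd m}. moebius_mu (m div d) * phi d)"

fun lucas :: "nat \<Rightarrow> int" where
  "lucas 0 = 2"
| "lucas (Suc 0) = 1"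
| "lucas (Suc (Suc m)) = lucas (Suc m) + lucas m"

definition Qset :: "nat \<Rightarrow> (nat \<times> nat) set" where
  "Qset n = {(1, n + 1)} \<union> {(m, 2*n + 2 - m) | m. 2 \<le> m \<and> m \<le> n}
            \<union> {(m, 2*n + 1 - m) | m. n + 1 \<le> m \<and> m \<le> 2*n}"

text \<open>bmat n k i j = b_{k+1,i,j,n} (shifted index so that k starts at 0).\<close>
fun bmat :: "nat \<Rightarrow> nat \<Rightarrow> nat \<Rightarrow> nat \<Rightarrow> int" where
  "bmat n 0 i j = (if (i, j) \<in> Qset n then 1 else 0)"
| "bmat n (Suc k) i j =
     (if 1 \<le> j \<and> j \<le> n - 1 then bmat n k i (2*n + 1 - j) + bmat n k i (n + 1)
      else if j = n then bmat n k i n + bmat n k i (n + 1)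
      else if j = n + 1 then bmat n k i 1
      else if n + 2 \<le> j \<and> j \<le> 2*n then bmat n k i (2*n + 2 - j)
      else 0)"

text \<open>c_{k,n} for k \<ge> 1.\<close>
definition cseq :: "nat \<Rightarrow> nat \<Rightarrow> int" where
  "cseq n k = (\<Sum>i = 1..2*n. bmat n (k - 1) i i) + bmat n (k - 1) (n + 1) n
              + (\<Sum>i = n + 2..2*n. bmat n (k - 1) i (n + 1))"

definition phi_seq :: "nat \<Rightarrow> nat \<Rightarrow> int" where
  "phi_seq n k = (if n = 1 then lucas k else cseq n k)"

definition PhiN :: "nat \<Rightarrow> nat \<Rightarrow> int" where
  "PhiN n m = PhiSum m (phi_seq n)"

definition min_period_pt :: "(real \<Rightarrow> real) \<Rightarrow> real set \<Rightarrow> nat \<Rightarrow> real \<Rightarrow> bool" where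
  "min_period_pt f I t x \<longleftrightarrow> x \<in> I \<and> 0 < t \<and> (f ^^ t) x = x \<and>
     (\<forall>j. 0 < j \<and> j < t \<longrightarrow> (f ^^ j) x \<noteq> x)"

definition orbit_of :: "(real \<Rightarrow> real) \<Rightarrow> nat \<Rightarrow> real \<Rightarrow> real set" where
  "orbit_of f t x = {(f ^^ j) x | j. j < t}"

definition orbits_of_period :: "(real \<Rightarrow> real) \<Rightarrow> real set \<Rightarrow> nat \<Rightarrow> real set set" where
  "orbits_of_period f I t = orbit_of f t ` {x. min_period_pt f I t x}"

definition sh_hyp :: "(real \<Rightarrow> real) \<Rightarrow> real \<Rightarrow> real \<Rightarrow> nat \<Rightarrow> bool" where
  "sh_hyp f a b s \<longleftrightarrow> a \<le> b \<and> continuous_on {a..b} f \<and> f ` {a..b} \<subseteq> {a..b} \<and>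
     (\<exists>x. min_period_pt f {a..b} s x) \<and>
     (\<forall>r. sh_prec r s \<longrightarrow> \<not> (\<exists>x. min_period_pt f {a..b} r x))"

end

theory Submission
  imports Defs
begin

text \<open>
  Order the cycle of least odd period \<open>2 n + 1\<close> as \<open>x\<^sub>1 < \<dots> < x\<^sub>2\<^sub>n\<^sub>+\<^sub>1\<close> and draw an edge from the
  interval \<open>J\<^sub>i\<close> between neighbours to \<open>J\<^sub>j\<close> when the images of the endpoints of \<open>J\<^sub>i\<close> enclose \<open>J\<^sub>j\<close>.
  A closed walk of odd length below \<open>2 n + 1\<close> that is not constant would produce a smaller odd
  period; this forces the cycle to be a Stefan cycle (up to reflection), and the trace of the
  \<open>j\<close>-th power of its adjacency matrix is \<open>\<phi>\<^sub>n(j)\<close>. By Moebius inversion \<open>\<Phi>\<^sub>n(m)\<close> counts the closed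
  walks of least period \<open>m\<close>, and distinct ones are followed by distinct periodic points. For
  \<open>k > 0\<close> the absence of odd periods makes \<open>f\<close> swap the two halves of the cycle, so \<open>f\<^sup>2\<close> contributes
  the points of each half separately. The piecewise linear Stefan map is expanding along closed
  walks and hence has no other periodic points; period doubling transports it to \<open>k > 0\<close>.
\<close>

section \<open>Minimal periods\<close>

text \<open>Counting is done with points: \<open>2 ^ k * PhiN n m\<close> points of period
  \<open>2 ^ k * m\<close>, each orbit using up \<open>2 ^ k * m\<close> of them, give the stated
  quotient, with \<open>m = t div 2 ^ k\<close>. Two obstacles shape the argument. Neighbouring
  intervals share an endpoint, so a point may follow more than one walk. This can happen only on the
  cycle itself, and since \<open>t\<close> differs from \<open>s\<close>, \<open>m\<close> is never
  the length \<open>2 * n + 1\<close> of that cycle. Secondly, the period \<open>r\<close> under the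
  square of \<open>f\<close> leaves the period under \<open>f\<close> open when \<open>r\<close> is
  odd: it is \<open>r\<close> or \<open>2 * r\<close>. Odd periods above 1 are absent for
  \<open>k > 0\<close>, but 1 is not, so \<open>m = 1\<close> is treated apart; there a single orbit
  suffices, because \<open>PhiN n 1 = 1\<close>. For sharpness the walks only bound the number of
  points from above; equality comes from applying the lower bound to the Stefan map itself.\<close>

definition minper :: "('a \<Rightarrow> 'a) \<Rightarrow> nat \<Rightarrow> 'a \<Rightarrow> bool" where
  "minper T t x \<longleftrightarrow> 0 < t \<and> (\<forall>m. (T ^^ m) x = x \<longleftrightarrow> t dvd m)"

lemma funpow_mult_fix: "(T ^^ t) x = x \<Longrightarrow> (T ^^ (t * q)) x = x"
  by (induction q) (auto simp: funpow_add)

text \<open>\<open>minper\<close> is phrased through divisibility so that periods of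
  \<open>f\<close>, of its square, of index permutations and of walks under \<open>shift\<close> can
  be compared by \<open>dvd\<close> alone. The reverse implication is division with remainder: the
  remainder of a return time is again a return time.\<close>

lemma minper_iff:
  "minper T t x \<longleftrightarrow> 0 < t \<and> (T ^^ t) x = x \<and> (\<forall>j. 0 < j \<and> j < t \<longrightarrow> (T ^^ j) x \<noteq> x)"
proof
  assume "minper T t x"
  then show "0 < t \<and> (T ^^ t) x = x \<and> (\<forall>j. 0 < j \<and> j < t \<longrightarrow> (T ^^ j) x \<noteq> x)"
    unfolding minper_def by (auto dest: dvd_imp_le)
next
  assume *: "0 < t \<and> (T ^^ t) x = x \<and> (\<forall>j. 0 < j \<and> j < t \<longrightarrow> (T ^^ j) x \<noteq> x)"
  have "(T ^^ m) x = x \<longleftrightarrow> t dvd m" for m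
  proof
    assume m: "(T ^^ m) x = x"
    have "(T ^^ m) x = (T ^^ (m mod t + t * (m div t))) x" by simp
    also have "\<dots> = (T ^^ (m mod t)) x"
      unfolding funpow_add using funpow_mult_fix[of t T x "m div t"] * by simp
    finally have fx: "(T ^^ (m mod t)) x = x" using m by simp
    have "\<not> 0 < m mod t"
    proof
      assume "0 < m mod t"
      moreover have "m mod t < t" using * by simp
      ultimately have "(T ^^ (m mod t)) x \<noteq> x" using * by blast
      then show False using fx by contradiction
    qed
    then show "t dvd m" by auto
  next
    assume "t dvd m"
    then show "(T ^^ m) x = x" using * funpow_mult_fix[of t T x] by auto
  qed
  with * show "minper T t x" by (simp add: minper_def)
qed

lemma min_period_pt_iff: "min_period_pt f I t x \<longleftrightarrow> x \<in> I \<and> minper f t x"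
  by (auto simp: min_period_pt_def minper_iff)

lemma minper_pos: "minper T t x \<Longrightarrow> 0 < t"
  by (simp add: minper_def)

lemma minper_fix: "minper T t x \<Longrightarrow> (T ^^ m) x = x \<longleftrightarrow> t dvd m"
  by (simp add: minper_def)

lemma minper_unique: "minper T t x \<Longrightarrow> minper T s x \<Longrightarrow> t = s"
  unfolding minper_def by (meson dvd_antisym dvd_refl)

lemma minper_exists:
  assumes "(T ^^ m) x = x" "0 < m"
  obtains d where "d dvd m" "minper T d x"
proof -
  define d where "d = (LEAST d. 0 < d \<and> (T ^^ d) x = x)"
  have d: "0 < d \<and> (T ^^ d) x = x"
    unfolding d_def by (rule LeastI[where k = m]) (use assms in auto)
  have "\<forall>j. 0 < j \<and> j < d \<longrightarrow> (T ^^ j) x \<noteq> x"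
    unfolding d_def using not_less_Least by blast
  with d have "minper T d x" by (simp add: minper_iff)
  with assms that show ?thesis by (auto simp: minper_def)
qed

lemma minper_funpow:
  assumes "minper T t x"
  shows "minper T t ((T ^^ j) x)"
proof -
  \<comment> \<open>Running on to time \<open>j * t\<close> undoes the first \<open>j\<close> steps;
    as \<open>t\<close> is positive, the natural subtraction does not truncate.\<close>
  have ret: "(T ^^ (j * t - j)) ((T ^^ j) x) = x"
  proof -
    have "j * t - j + j = t * j" using minper_pos[OF assms] by (cases t) auto
    then have "(T ^^ (j * t - j)) ((T ^^ j) x) = (T ^^ (t * j)) x"
      by (metis comp_apply funpow_add)
    then show ?thesis using assms by (simp add: minper_def)
  qed
  have comm: "(T ^^ m) ((T ^^ i) y) = (T ^^ i) ((T ^^ m) y)" for m i y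
    using fun_cong[OF funpow_add[of m i T], of y] fun_cong[OF funpow_add[of i m T], of y]
    by (simp add: add.commute)
  have "(T ^^ m) ((T ^^ j) x) = (T ^^ j) x \<longleftrightarrow> (T ^^ m) x = x" for m
  proof
    assume "(T ^^ m) x = x"
    then show "(T ^^ m) ((T ^^ j) x) = (T ^^ j) x" by (simp only: comm[of m j])
  next
    assume "(T ^^ m) ((T ^^ j) x) = (T ^^ j) x"
    then have "(T ^^ (j * t - j)) ((T ^^ m) ((T ^^ j) x)) = x" using ret by simp
    then show "(T ^^ m) x = x" unfolding comm[of "j * t - j" m] ret .
  qed
  with assms show ?thesis by (simp add: minper_def)
qed

lemma minper_inj_on:
  assumes "minper T t x"
  shows "inj_on (\<lambda>j. (T ^^ j) x) {..<t}"
proof -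
  have "i = j" if "i \<le> j" "j < t" "(T ^^ i) x = (T ^^ j) x" for i j
  proof -
    have "(T ^^ (j - i)) ((T ^^ i) x) = (T ^^ i) x"
      using that by (metis comp_apply funpow_add le_add_diff_inverse2)
    then have "t dvd j - i" using minper_fix[OF minper_funpow[OF assms]] by blast
    with that show ?thesis using dvd_imp_le[of t "j - i"] by (cases "i = j") auto
  qed
  then show ?thesis unfolding inj_on_def by (metis lessThan_iff linear)
qed

lemma funpow_square: fixes T :: "'a \<Rightarrow> 'a" shows "((T ^^ 2) ^^ m) x = (T ^^ (2 * m)) x"
  by (simp only: funpow_mult)

text \<open>If \<open>d\<close> is the period under \<open>T\<close>, then
  \<open>d dvd 2 * m\<close> holds exactly when \<open>r dvd m\<close>. For even \<open>d\<close>
  this gives \<open>d = 2 * r\<close>, for odd \<open>d\<close> it gives \<open>d = r\<close>. The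
  second outcome has to be ruled out whenever a result on \<open>f ^^ 2\<close> is carried back to
  \<open>f\<close>.\<close>

lemma minper_square:
  assumes "minper (T ^^ 2) r x"
  shows "minper T (2 * r) x \<or> (odd r \<and> minper T r x)"
proof -
  have r: "0 < r" and *: "(T ^^ (2 * m)) x = x \<longleftrightarrow> r dvd m" for m
    using assms by (auto simp: minper_def funpow_square)
  obtain d where d: "d dvd 2 * r" "minper T d x"
    using minper_exists[of "2 * r" T x] * r by auto
  have dd: "d dvd 2 * m \<longleftrightarrow> r dvd m" for m
    using * d(2) by (simp add: minper_def)
  show ?thesis
  proof (cases "even d")
    case True
    then obtain e where e: "d = 2 * e" by auto
    have "e dvd m \<longleftrightarrow> r dvd m" for m using dd[of m] e by simp
    then have "e = r" by (meson dvd_antisym dvd_refl)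
    with e d show ?thesis by simp
  next
    case False
    then have "d dvd m \<longleftrightarrow> r dvd m" for m
      using dd[of m] coprime_dvd_mult_right_iff[of d 2 m] by (simp add: coprime_commute)
    then have "d = r" by (meson dvd_antisym dvd_refl)
    with False d show ?thesis by simp
  qed
qed

lemma minper_square_half:
  assumes "minper T (2 * r) x"
  shows "minper (T ^^ 2) r x"
  using assms by (auto simp: minper_def funpow_square)

text \<open>Each point fixed by \<open>T ^^ m\<close> is filed under its minimal period, a divisor
  of \<open>m\<close>; Moebius inversion will undo this divisor sum.\<close>

lemma card_fix_eq_sum_minper:
  assumes fin: "finite {x \<in> X. (T ^^ m) x = x}" and m: "0 < m"
  shows "card {x \<in> X. (T ^^ m) x = x} = (\<Sum>d \<in> {d. d dvd m}. card {x \<in> X. minper T d x})"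
proof -
  have eq: "{x \<in> X. (T ^^ m) x = x} = (\<Union>d \<in> {d. d dvd m}. {x \<in> X. minper T d x})"
    using minper_exists[OF _ m, of T] by (auto simp: minper_fix)
  have fd: "finite {d. d dvd m}" using m by simp
  have "\<forall>d\<in>{d. d dvd m}. finite {x \<in> X. minper T d x}"
    using fin by (auto simp: minper_def intro: finite_subset[OF _ fin])
  then show ?thesis
    unfolding eq by (intro card_UN_disjoint fd) (auto dest: minper_unique)
qed

lemma orbit_of_eq: "orbit_of f t x = (\<lambda>j. (f ^^ j) x) ` {..<t}"
  by (auto simp: orbit_of_def)

lemma orbit_of_funpow:
  assumes "minper f t x"
  shows "(f ^^ j) x \<in> orbit_of f t x"
proof -
  have "(f ^^ j) x = (f ^^ (j mod t + t * (j div t))) x" by simp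
  also have "\<dots> = (f ^^ (j mod t)) x"
    unfolding funpow_add using minper_fix[OF assms, of "t * (j div t)"] by simp
  finally show ?thesis using minper_pos[OF assms] by (auto simp: orbit_of_eq)
qed

text \<open>One inclusion suffices, since both orbits have exactly \<open>t\<close>
  elements.\<close>

lemma orbit_of_shift:
  assumes "minper f t x" "y \<in> orbit_of f t x"
  shows "orbit_of f t y = orbit_of f t x"
proof -
  obtain j where y: "y = (f ^^ j) x" using assms(2) by (auto simp: orbit_of_eq)
  have my: "minper f t y" using minper_funpow[OF assms(1)] y by simp
  have "orbit_of f t y \<subseteq> orbit_of f t x"
  proof
    fix z assume "z \<in> orbit_of f t y"
    then obtain i where "z = (f ^^ i) y" by (auto simp: orbit_of_eq)
    then have "z = (f ^^ (i + j)) x" using y by (simp add: funpow_add)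
    then show "z \<in> orbit_of f t x" using orbit_of_funpow[OF assms(1)] by simp
  qed
  moreover have "card (orbit_of f t y) = t" "card (orbit_of f t x) = t"
    using minper_inj_on[OF my] minper_inj_on[OF assms(1)]
    by (simp_all add: orbit_of_eq card_image)
  moreover have "finite (orbit_of f t x)" by (simp add: orbit_of_eq)
  ultimately show ?thesis by (metis card_subset_eq)
qed

lemma self_funpow: "f ` I \<subseteq> I \<Longrightarrow> x \<in> I \<Longrightarrow> (f ^^ j) x \<in> I"
proof (induction j)
  case (Suc j)
  then have "f ((f ^^ j) x) \<in> f ` I" by blast
  with Suc.prems show ?case by auto
qed simp

lemma continuous_on_funpow:
  assumes "continuous_on I f" "f ` I \<subseteq> I"
  shows "continuous_on I (f ^^ j)"
proof (induction j)
  case (Suc j)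
  have "continuous_on I (f \<circ> (f ^^ j))"
  proof (rule continuous_on_compose[OF Suc])
    show "continuous_on ((f ^^ j) ` I) f"
      by (rule continuous_on_subset[OF assms(1)]) (use self_funpow[OF assms(2)] in auto)
  qed
  then show ?case by simp
qed (simp add: id_def)

lemma Union_orbits:
  assumes "f ` I \<subseteq> I"
  shows "\<Union>(orbits_of_period f I t) = {x. min_period_pt f I t x}"
proof
  show "\<Union>(orbits_of_period f I t) \<subseteq> {x. min_period_pt f I t x}"
    by (auto simp: orbits_of_period_def min_period_pt_iff orbit_of_eq
        intro: minper_funpow self_funpow[OF assms])
  show "{x. min_period_pt f I t x} \<subseteq> \<Union>(orbits_of_period f I t)"
    using orbit_of_funpow[of f t _ 0]
    by (auto simp: orbits_of_period_def min_period_pt_iff)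
qed

text \<open>Orbits of the same period are equal or disjoint and have \<open>t\<close> points each.
  This turns counts of points into counts of orbits and back.\<close>

lemma card_points_eq_card_orbits:
  assumes "f ` I \<subseteq> I" "finite (orbits_of_period f I t)"
  shows "finite {x. min_period_pt f I t x}"
    and "card {x. min_period_pt f I t x} = t * card (orbits_of_period f I t)"
proof -
  have orb: "finite C \<and> card C = t" if "C \<in> orbits_of_period f I t" for C
  proof -
    obtain x where "minper f t x" "C = orbit_of f t x"
      using \<open>C \<in> _\<close> by (auto simp: orbits_of_period_def min_period_pt_iff)
    then show ?thesis using minper_inj_on[of f t x] by (simp add: orbit_of_eq card_image)
  qed
  show "finite {x. min_period_pt f I t x}"
    unfolding Union_orbits[OF assms(1), symmetric] using assms(2) orb by auto
  have "t * card (orbits_of_period f I t) = card (\<Union>(orbits_of_period f I t))"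
  proof (rule card_partition[OF assms(2)])
    show "finite (\<Union>(orbits_of_period f I t))" using assms(2) orb by auto
    show "card C = t" if "C \<in> orbits_of_period f I t" for C using orb that by blast
    fix C D assume C: "C \<in> orbits_of_period f I t" and D: "D \<in> orbits_of_period f I t" and "C \<noteq> D"
    obtain x y where x: "minper f t x" "C = orbit_of f t x" and y: "minper f t y" "D = orbit_of f t y"
      using C D by (auto simp: orbits_of_period_def min_period_pt_iff)
    show "C \<inter> D = {}"
      using orbit_of_shift[OF x(1)] orbit_of_shift[OF y(1)] x(2) y(2) \<open>C \<noteq> D\<close> by blast
  qed
  then show "card {x. min_period_pt f I t x} = t * card (orbits_of_period f I t)"
    using Union_orbits[OF assms(1)] by simp
qed

lemma finite_orbits:
  "finite {x. min_period_pt f I t x} \<Longrightarrow> finite (orbits_of_period f I t)"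
  by (simp add: orbits_of_period_def)

section \<open>Moebius inversion\<close>

lemma moebius_mu_mult_prime:
  assumes p: "prime p" "\<not> p dvd d" "0 < d"
  shows "moebius_mu (p * d) = - moebius_mu d"
proof (cases "squarefree d")
  case True
  have "coprime p d" using p by (simp add: prime_imp_coprime)
  then have sq: "squarefree (p * d)"
    using True p by (simp add: squarefree_mult_coprime squarefree_prime)
  have "prime_factors (p * d) = insert p (prime_factors d)"
    using p by (simp add: prime_factors_product prime_factorization_prime)
  moreover have "p \<notin> prime_factors d" using p by auto
  ultimately have "card (prime_factors (p * d)) = Suc (card (prime_factors d))" by simp
  with True sq p show ?thesis by (auto simp: moebius_mu_def)
next
  case False
  then have "\<not> squarefree (p * d)" using squarefree_multD(2) by blast
  with False p show ?thesis by (simp add: moebius_mu_def)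
qed

text \<open>Only squarefree divisors contribute. For a prime \<open>p\<close> dividing
  \<open>n\<close>, those not divisible by \<open>p\<close> pair off with their multiples by
  \<open>p\<close>, and the two members of a pair have opposite signs.\<close>

lemma sum_moebius_mu:
  assumes "0 < n"
  shows "(\<Sum>d \<in> {d. d dvd n}. moebius_mu d) = (if n = 1 then 1 else 0)"
proof (cases "n = 1")
  case True
  then show ?thesis by (simp add: moebius_mu_def)
next
  case False
  obtain p where p: "prime p" "p dvd n" using False prime_factor_nat by blast
  define A where "A = {d. d dvd n \<and> squarefree d \<and> \<not> p dvd d}"
  have fin: "finite {d. d dvd n}" using assms by simp
  then have finA: "finite A" by (auto simp: A_def intro: finite_subset)
  have "(\<Sum>d \<in> {d. d dvd n}. moebius_mu d) = (\<Sum>d \<in> A \<union> (\<lambda>d. p * d) ` A. moebius_mu d)"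
  proof (rule sum.mono_neutral_right[OF fin])
    show "A \<union> (\<lambda>d. p * d) ` A \<subseteq> {d. d dvd n}"
      using p by (auto simp: A_def intro!: divides_mult prime_imp_coprime)
    show "\<forall>d\<in>{d. d dvd n} - (A \<union> (\<lambda>d. p * d) ` A). moebius_mu d = 0"
    proof
      fix d assume d: "d \<in> {d. d dvd n} - (A \<union> (\<lambda>d. p * d) ` A)"
      have "\<not> squarefree d"
      proof
        assume sq: "squarefree d"
        with d have "p dvd d" by (auto simp: A_def)
        then obtain e where e: "d = p * e" by auto
        have "\<not> p dvd e"
        proof
          assume "p dvd e"
          then have "p ^ 2 dvd d" using e by (auto simp: power2_eq_square)
          then have "p dvd 1" using sq by (auto simp: squarefree_def)
          with p show False by simp
        qed
        moreover have "squarefree e" using sq e squarefree_multD(2) by blast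
        moreover have "e dvd n" using d e by (auto intro: dvd_mult_right)
        ultimately have "e \<in> A" by (simp add: A_def)
        with e d show False by auto
      qed
      then show "moebius_mu d = 0" by (simp add: moebius_mu_def)
    qed
  qed
  also have "\<dots> = (\<Sum>d \<in> A. moebius_mu d) + (\<Sum>d \<in> (\<lambda>d. p * d) ` A. moebius_mu d)"
    by (rule sum.union_disjoint) (use finA in \<open>auto simp: A_def\<close>)
  also have "(\<Sum>d \<in> (\<lambda>d. p * d) ` A. moebius_mu d) = (\<Sum>d \<in> A. moebius_mu (p * d))"
    using p by (subst sum.reindex) (auto simp: inj_on_def)
  also have "\<dots> = (\<Sum>d \<in> A. - moebius_mu d)"
    using p assms moebius_mu_mult_prime[of p]
    by (intro sum.cong) (auto simp: A_def dest: dvd_pos_nat[rotated])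
  finally show ?thesis using False by (simp add: sum_negf)
qed

lemma PhiSum_inversion:
  assumes F: "\<And>d. 0 < d \<Longrightarrow> F d = (\<Sum>e \<in> {e. e dvd d}. P e)" and m: "0 < m"
  shows "PhiSum m F = P m"
proof -
  have fin: "finite {e. e dvd k}" if "k dvd m" for k
    using m that by (cases "k = 0") auto
  have "PhiSum m F = (\<Sum>d \<in> {d. d dvd m}. \<Sum>e \<in> {e. e dvd d}. moebius_mu (m div d) * P e)"
    unfolding PhiSum_def using m
    by (intro sum.cong) (auto simp: F sum_distrib_left dest: dvd_pos_nat[rotated])
  also have "\<dots> = (\<Sum>d \<in> {d. d dvd m}. \<Sum>e \<in> {e \<in> {e. e dvd m}. e dvd d}. moebius_mu (m div d) * P e)"
    by (intro sum.cong) (auto intro: dvd_trans)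
  also have "\<dots> = (\<Sum>e \<in> {e. e dvd m}. \<Sum>d \<in> {d \<in> {d. d dvd m}. e dvd d}. moebius_mu (m div d) * P e)"
    by (rule sum.swap_restrict) (use fin in auto)
  also have "\<dots> = (\<Sum>e \<in> {e. e dvd m}. if e = m then P e else 0)"
  proof (rule sum.cong)
    fix e assume "e \<in> {e. e dvd m}"
    then have e: "e dvd m" "0 < e" using m dvd_pos_nat by auto
    have q: "0 < m div e" using e m by (auto elim!: dvdE)
    \<comment> \<open>The substitution \<open>c = m div d\<close> turns the divisors of
      \<open>m\<close> that are multiples of \<open>e\<close> into the divisors of
      \<open>m div e\<close>.\<close>
    have "(\<Sum>d \<in> {d \<in> {d. d dvd m}. e dvd d}. moebius_mu (m div d) * P e)
        = (\<Sum>c \<in> {c. c dvd m div e}. moebius_mu c * P e)"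
    proof (rule sum.reindex_bij_witness[of _ "\<lambda>c. m div c" "\<lambda>d. m div d"])
      fix d assume "d \<in> {d \<in> {d. d dvd m}. e dvd d}"
      then obtain u v where d: "m = d * u" "d = e * v" by (auto elim!: dvdE)
      then show "m div (m div d) = d" "m div d \<in> {c. c dvd m div e}"
        using m e by auto
    next
      fix c assume "c \<in> {c. c dvd m div e}"
      then obtain u where "m div e = c * u" by auto
      moreover obtain v where "m = e * v" using e by auto
      ultimately have c: "m div e = c * u" "m = e * v" .
      then have "v = c * u" using e by simp
      then show "m div (m div c) = c" "m div c \<in> {d \<in> {d. d dvd m}. e dvd d}"
        using c m e by auto
    qed auto
    also have "\<dots> = (\<Sum>c \<in> {c. c dvd m div e}. moebius_mu c) * P e"
      by (simp add: sum_distrib_right)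
    also have "\<dots> = (if e = m then P e else 0)"
      using sum_moebius_mu[OF q] e m by (auto elim!: dvdE)
    finally show "(\<Sum>d \<in> {d \<in> {d. d dvd m}. e dvd d}. moebius_mu (m div d) * P e)
        = (if e = m then P e else 0)" .
  qed auto
  also have "\<dots> = P m" using fin[of m] by simp
  finally show ?thesis .
qed

section \<open>Periodic points from loops of intervals\<close>

text \<open>Take for \<open>u\<close> the last point where \<open>g\<close> equals \<open>c\<close>,
  and for \<open>v\<close> the first point from \<open>u\<close> on where it equals
  \<open>d\<close>. A value outside \<open>{c..d}\<close> between them would, by the intermediate
  value theorem, force a later \<open>c\<close> or an earlier \<open>d\<close>.\<close>

lemma exact_subinterval_aux:
  fixes g :: "real \<Rightarrow> real"
  assumes g: "continuous_on {p..r} g" "p \<le> r" "g p = c" "g r = d" "c \<le> d"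
  obtains u v where "p \<le> u" "u \<le> v" "v \<le> r" "g u = c" "g v = d" "g ` {u..v} \<subseteq> {c..d}"
proof -
  define A where "A = {x \<in> {p..r}. g x = c}"
  have "closed A" unfolding A_def
    by (rule continuous_closed_preimage_constant) (use g in auto)
  then have "compact ({p..r} \<inter> A)" by (intro compact_Int_closed compact_Icc)
  moreover have "{p..r} \<inter> A = A" by (auto simp: A_def)
  ultimately have "compact A" by simp
  moreover have "A \<noteq> {}" using g by (auto simp: A_def)
  ultimately obtain u where u: "u \<in> A" "\<And>x. x \<in> A \<Longrightarrow> x \<le> u"
    using compact_attains_sup[of A] by blast
  define B where "B = {x \<in> {u..r}. g x = d}"
  have uB: "u \<in> {p..r}" "g u = c" using u by (auto simp: A_def)
  have cu: "continuous_on {u..r} g" by (rule continuous_on_subset[OF g(1)]) (use uB in auto)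
  have "closed B" unfolding B_def
    by (rule continuous_closed_preimage_constant) (use cu in auto)
  then have "compact ({u..r} \<inter> B)" by (intro compact_Int_closed compact_Icc)
  moreover have "{u..r} \<inter> B = B" by (auto simp: B_def)
  ultimately have "compact B" by simp
  moreover have "B \<noteq> {}" using g uB by (auto simp: B_def)
  ultimately obtain v where v: "v \<in> B" "\<And>x. x \<in> B \<Longrightarrow> v \<le> x"
    using compact_attains_inf[of B] by blast
  have vB: "v \<in> {u..r}" "g v = d" using v by (auto simp: B_def)
  have "g x \<in> {c..d}" if x: "x \<in> {u..v}" for x
  proof (rule ccontr)
    assume "g x \<notin> {c..d}"
    then consider "g x < c" | "g x > d" by fastforce
    then show False
    proof cases
      case 1
      have "continuous_on {x..v} g" by (rule continuous_on_subset[OF cu]) (use x vB in auto)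
      then obtain y where y: "x \<le> y" "y \<le> v" "g y = c"
        using IVT'[of g x c v] 1 g vB x by auto
      then have "y \<in> A" using x vB uB by (auto simp: A_def)
      then have "y \<le> u" using u by blast
      then have "x = u" using x y by auto
      then show False using 1 uB by simp
    next
      case 2
      have "continuous_on {u..x} g" by (rule continuous_on_subset[OF cu]) (use x vB in auto)
      then obtain y where y: "u \<le> y" "y \<le> x" "g y = d"
        using IVT'[of g u d x] 2 g uB x by auto
      then have "y \<in> B" using x vB by (auto simp: B_def)
      then have "v \<le> y" using v by blast
      then have "x = v" using x y by auto
      then show False using 2 vB by simp
    qed
  qed
  then have "g ` {u..v} \<subseteq> {c..d}" by blast
  then show ?thesis using that[of u v] uB vB by auto
qed

text \<open>The endpoint values form an unordered pair because either order may occur; if the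
  preimage of \<open>d\<close> lies to the left of that of \<open>c\<close>, the increasing case is
  applied to the negated function.\<close>

lemma exact_subinterval:
  fixes g :: "real \<Rightarrow> real"
  assumes g: "continuous_on {p..q} g" "c \<in> g ` {p..q}" "d \<in> g ` {p..q}" "c \<le> d"
  obtains u v where "p \<le> u" "u \<le> v" "v \<le> q" "{g u, g v} = {c, d}" "g ` {u..v} \<subseteq> {c..d}"
proof -
  obtain y z where yz: "y \<in> {p..q}" "g y = c" "z \<in> {p..q}" "g z = d" using g by auto
  show ?thesis
  proof (cases "y \<le> z")
    case True
    have "continuous_on {y..z} g" by (rule continuous_on_subset[OF g(1)]) (use yz in auto)
    from exact_subinterval_aux[OF this True yz(2) yz(4) g(4)] obtain u v
      where uv: "y \<le> u" "u \<le> v" "v \<le> z" "g u = c" "g v = d" "g ` {u..v} \<subseteq> {c..d}" by blast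
    then show ?thesis using that[of u v] yz by auto
  next
    case False
    have "continuous_on {z..y} g" by (rule continuous_on_subset[OF g(1)]) (use yz in auto)
    then have "continuous_on {z..y} (\<lambda>x. - g x)" by (rule continuous_on_minus)
    from exact_subinterval_aux[OF this, of "-d" "-c"] False yz g(4) obtain u v
      where uv: "z \<le> u" "u \<le> v" "v \<le> y" "- g u = - d" "- g v = - c" "(\<lambda>x. - g x) ` {u..v} \<subseteq> {-d..-c}"
      by auto
    have "g ` {u..v} \<subseteq> {c..d}" using uv(6) by force
    with uv show ?thesis using that[of u v] yz by auto
  qed
qed

text \<open>Preimages are taken from the end of the chain backwards: the interval found for the tail
  lies in the second link, which the first link covers, so \<open>exact_subinterval\<close> pulls it
  back into the first. The images of the two endpoints are recorded because they later yield a fixed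
  point.\<close>

lemma interval_path:
  fixes f :: "real \<Rightarrow> real"
  assumes cont: "continuous_on I f"
  shows "(\<And>l. l \<le> q \<Longrightarrow> K l \<le> L l \<and> {K l..L l} \<subseteq> I) \<Longrightarrow>
    (\<And>l. l < q \<Longrightarrow> {K (Suc l)..L (Suc l)} \<subseteq> f ` {K l..L l}) \<Longrightarrow>
    \<exists>u v. u \<le> v \<and> (\<forall>x\<in>{u..v}. \<forall>l\<le>q. (f ^^ l) x \<in> {K l..L l}) \<and>
      {(f ^^ q) u, (f ^^ q) v} = {K q, L q}"
proof (induction q arbitrary: K L)
  case 0
  then show ?case by (intro exI[of _ "K 0"] exI[of _ "L 0"]) auto
next
  case (Suc q)
  have "\<exists>u v. u \<le> v \<and> (\<forall>x\<in>{u..v}. \<forall>l\<le>q. (f ^^ l) x \<in> {K (Suc l)..L (Suc l)}) \<and>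
      {(f ^^ q) u, (f ^^ q) v} = {K (Suc q), L (Suc q)}"
    by (rule Suc.IH[of "\<lambda>l. K (Suc l)" "\<lambda>l. L (Suc l)"]) (use Suc.prems in auto)
  then obtain u v where uv: "u \<le> v" "\<And>x l. x \<in> {u..v} \<Longrightarrow> l \<le> q \<Longrightarrow> (f ^^ l) x \<in> {K (Suc l)..L (Suc l)}"
      "{(f ^^ q) u, (f ^^ q) v} = {K (Suc q), L (Suc q)}" by blast
  have "u \<in> {K (Suc 0)..L (Suc 0)}" "v \<in> {K (Suc 0)..L (Suc 0)}"
    using uv(2)[of u 0] uv(2)[of v 0] uv(1) by auto
  then have im: "u \<in> f ` {K 0..L 0}" "v \<in> f ` {K 0..L 0}" using Suc.prems(2)[of 0] by auto
  have "continuous_on {K 0..L 0} f" using continuous_on_subset[OF cont] Suc.prems(1)[of 0] by auto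
  from exact_subinterval[OF this im uv(1)] obtain u' v' where
    uv': "K 0 \<le> u'" "u' \<le> v'" "v' \<le> L 0" "{f u', f v'} = {u, v}" "f ` {u'..v'} \<subseteq> {u..v}" .
  have "(f ^^ l) x \<in> {K l..L l}" if "x \<in> {u'..v'}" "l \<le> Suc q" for x l
  proof (cases l)
    case 0
    then show ?thesis using that uv' by auto
  next
    case (Suc l')
    have "f x \<in> {u..v}" using uv'(5) that(1) by blast
    then have "(f ^^ l') (f x) \<in> {K (Suc l')..L (Suc l')}" using uv(2) that Suc by auto
    then show ?thesis using Suc by (simp add: funpow_swap1)
  qed
  moreover have "{(f ^^ Suc q) u', (f ^^ Suc q) v'} = (f ^^ q) ` {f u', f v'}"
    by (simp add: funpow_swap1)
  then have "{(f ^^ Suc q) u', (f ^^ Suc q) v'} = {K (Suc q), L (Suc q)}"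
    unfolding uv'(4) using uv(3) by simp
  ultimately show ?case using uv'(2) by blast
qed

text \<open>\<open>f ^^ q\<close> carries the endpoints of the interval from
  \<open>interval_path\<close> to the endpoints of a larger interval containing it, so
  \<open>f ^^ q\<close> minus the identity changes sign there, in one direction or the
  other.\<close>

lemma interval_loop:
  fixes f :: "real \<Rightarrow> real"
  assumes cont: "continuous_on I f" and self: "f ` I \<subseteq> I"
    and K: "\<And>l. l \<le> q \<Longrightarrow> K l \<le> L l \<and> {K l..L l} \<subseteq> I"
    and cov: "\<And>l. l < q \<Longrightarrow> {K (Suc l)..L (Suc l)} \<subseteq> f ` {K l..L l}"
    and loop: "K q = K 0" "L q = L 0"
  obtains x where "(f ^^ q) x = x" "\<And>l. l \<le> q \<Longrightarrow> (f ^^ l) x \<in> {K l..L l}"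
proof -
  obtain u v where uv: "u \<le> v" "\<And>x l. x \<in> {u..v} \<Longrightarrow> l \<le> q \<Longrightarrow> (f ^^ l) x \<in> {K l..L l}"
      "{(f ^^ q) u, (f ^^ q) v} = {K q, L q}"
    using interval_path[OF cont, of q K L] K cov by blast
  define h where "h x = (f ^^ q) x - x" for x
  have bnd: "x \<in> {K q..L q}" if "x \<in> {u..v}" for x using uv(2)[OF that, of 0] loop by simp
  have "{u..v} \<subseteq> I" using bnd K by blast
  then have ch: "continuous_on {u..v} h" unfolding h_def
    by (intro continuous_intros continuous_on_subset[OF continuous_on_funpow[OF cont self]])
  have bu: "u \<in> {K q..L q}" and bv: "v \<in> {K q..L q}" using bnd uv(1) by auto
  have "\<exists>x\<in>{u..v}. h x = 0"
  proof (cases "(f ^^ q) u = K q")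
    case True
    then have "(f ^^ q) v = L q" using uv(3) by (auto simp: doubleton_eq_iff)
    then show ?thesis
      using IVT'[OF _ _ uv(1) ch, of 0] True bu bv by (auto simp: h_def)
  next
    case False
    then have "(f ^^ q) u = L q" "(f ^^ q) v = K q" using uv(3) by (auto simp: doubleton_eq_iff)
    then show ?thesis
      using IVT2'[OF _ _ uv(1) ch, of 0] bu bv by (auto simp: h_def)
  qed
  then obtain x where "x \<in> {u..v}" "(f ^^ q) x = x" by (auto simp: h_def)
  then show ?thesis using that uv(2) by blast
qed

section \<open>Closed walks in the Markov graph of a Stefan cycle\<close>

definition covers :: "(nat \<Rightarrow> nat) \<Rightarrow> nat \<Rightarrow> nat \<Rightarrow> bool" where
  "covers \<sigma> i j \<longleftrightarrow> min (\<sigma> i) (\<sigma> (Suc i)) \<le> j \<and> j < max (\<sigma> i) (\<sigma> (Suc i))"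

text \<open>Starting at 1 the images are \<open>n + 1\<close>, \<open>n + 2\<close>,
  \<open>n\<close>, \<open>n + 3\<close>, \<open>n - 1\<close>, ..., \<open>2 * n + 1\<close>, 1:
  after a jump into the middle the points spiral outwards.\<close>

definition stefan :: "nat \<Rightarrow> nat \<Rightarrow> nat" where
  "stefan n m = (if m = 1 then n + 1 else if m \<le> n + 1 then 2 * n + 3 - m else 2 * n + 2 - m)"

text \<open>The walks are infinite, so that a closed walk of length \<open>m\<close> is a fixed
  point of \<open>shift ^^ m\<close> and the results on minimal periods apply to it.\<close>

definition walks :: "nat \<Rightarrow> (nat \<Rightarrow> nat) set" where
  "walks n = {w. \<forall>l. w l \<in> {1..2 * n} \<and> covers (stefan n) (w l) (w (Suc l))}"

definition shift :: "(nat \<Rightarrow> 'a) \<Rightarrow> nat \<Rightarrow> 'a" where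
  "shift w = (\<lambda>l. w (Suc l))"

lemma shift_funpow: "(shift ^^ j) w = (\<lambda>l. w (l + j))"
  by (induction j) (auto simp: shift_def)

text \<open>Vertex lists with \<open>m\<close> edges, extended at the far end: counting them by
  their last vertex gives a recursion in \<open>j\<close>, the index on which the recursion of
  \<open>bmat\<close> acts.\<close>

primrec paths :: "nat \<Rightarrow> nat \<Rightarrow> nat \<Rightarrow> nat \<Rightarrow> nat list set" where
  "paths n 0 i j = (if i = j then {[i]} else {})"
| "paths n (Suc m) i j =
     (\<Union>l \<in> {l \<in> {1..2 * n}. covers (stefan n) l j}. (\<lambda>xs. xs @ [j]) ` paths n m i l)"

lemma paths_iff:
  assumes "i \<in> {1..2 * n}" "j \<in> {1..2 * n}"
  shows "xs \<in> paths n m i j \<longleftrightarrow> length xs = Suc m \<and> xs ! 0 = i \<and> xs ! m = j \<and>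
    set xs \<subseteq> {1..2 * n} \<and> (\<forall>l<m. covers (stefan n) (xs ! l) (xs ! Suc l))"
  using assms(2)
proof (induction m arbitrary: j xs)
  case 0
  then show ?case by (auto simp: length_Suc_conv)
next
  case (Suc m)
  show ?case
  proof
    assume "xs \<in> paths n (Suc m) i j"
    then obtain l ys where l: "l \<in> {1..2 * n}" "covers (stefan n) l j"
      and ys: "ys \<in> paths n m i l" "xs = ys @ [j]" by auto
    have "length ys = Suc m" "ys ! 0 = i" "ys ! m = l" "set ys \<subseteq> {1..2 * n}"
      "\<forall>l<m. covers (stefan n) (ys ! l) (ys ! Suc l)"
      using ys(1) Suc.IH[OF l(1), of ys] by auto
    then show "length xs = Suc (Suc m) \<and> xs ! 0 = i \<and> xs ! Suc m = j \<and>
      set xs \<subseteq> {1..2 * n} \<and> (\<forall>l<Suc m. covers (stefan n) (xs ! l) (xs ! Suc l))"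
      using ys(2) l Suc.prems by (auto simp: nth_append less_Suc_eq)
  next
    assume *: "length xs = Suc (Suc m) \<and> xs ! 0 = i \<and> xs ! Suc m = j \<and>
      set xs \<subseteq> {1..2 * n} \<and> (\<forall>l<Suc m. covers (stefan n) (xs ! l) (xs ! Suc l))"
    define ys where "ys = take (Suc m) xs"
    have xs: "xs = ys @ [j]"
      using * unfolding ys_def by (metis lessI order_refl take_Suc_conv_app_nth take_all)
    have l: "xs ! m \<in> {1..2 * n}" using * nth_mem[of m xs] by (metis lessI less_SucI subsetD)
    have "set ys \<subseteq> set xs" unfolding ys_def by (rule set_take_subset)
    then have "ys \<in> paths n m i (xs ! m)"
      using Suc.IH[OF l, of ys] * unfolding ys_def by auto
    moreover have "covers (stefan n) (xs ! m) j" using * by auto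
    ultimately show "xs \<in> paths n (Suc m) i j"
      unfolding paths.simps using l xs by blast
  qed
qed

lemma finite_paths: "finite (paths n m i j)"
  by (induction m arbitrary: j) auto

lemma paths_last: "xs \<in> paths n m i j \<Longrightarrow> xs \<noteq> [] \<and> last xs = j"
  by (cases m) (auto split: if_splits)

lemma card_paths_Suc:
  "card (paths n (Suc m) i j) = (\<Sum>l \<in> {l \<in> {1..2 * n}. covers (stefan n) l j}. card (paths n m i l))"
proof -
  have "card (paths n (Suc m) i j)
      = (\<Sum>l \<in> {l \<in> {1..2 * n}. covers (stefan n) l j}. card ((\<lambda>xs. xs @ [j]) ` paths n m i l))"
    unfolding paths.simps
  proof (rule card_UN_disjoint)
    show "\<forall>l\<in>{l \<in> {1..2 * n}. covers (stefan n) l j}. \<forall>l'\<in>{l \<in> {1..2 * n}. covers (stefan n) l j}.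
        l \<noteq> l' \<longrightarrow> (\<lambda>xs. xs @ [j]) ` paths n m i l \<inter> (\<lambda>xs. xs @ [j]) ` paths n m i l' = {}"
      by (auto dest!: paths_last)
  qed (auto simp: finite_paths)
  then show ?thesis by (simp add: card_image inj_on_def)
qed

text \<open>The columns of the adjacency matrix, as needed when paths grow at their end. Read
  forwards, interval 1 covers \<open>n + 1\<close> up to \<open>2 * n\<close>, interval
  \<open>n + 1\<close> covers \<open>n\<close> and itself, and every other interval covers a single
  one.\<close>

lemma predecessors:
  assumes "1 \<le> n" "j \<in> {1..2 * n}"
  shows "{l \<in> {1..2 * n}. covers (stefan n) l j} =
    (if j < n then {2 * n + 1 - j} else if j = n then {n + 1}
     else if j = n + 1 then {1, n + 1} else {1, 2 * n + 2 - j})"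
proof -
  have s1: "stefan n 1 = n + 1" "stefan n (Suc 1) = 2 * n + 1"
    using assms by (auto simp: stefan_def)
  have s2: "stefan n l = 2 * n + 3 - l" "stefan n (Suc l) = 2 * n + 2 - l" if "2 \<le> l" "l \<le> n" for l
    using that by (auto simp: stefan_def)
  have s3: "stefan n (n + 1) = n + 2" "stefan n (Suc (n + 1)) = n"
    using assms by (auto simp: stefan_def)
  have s4: "stefan n l = 2 * n + 2 - l" "stefan n (Suc l) = 2 * n + 1 - l" if "n + 2 \<le> l" "l \<le> 2 * n" for l
    using that by (auto simp: stefan_def)
  have c1: "covers (stefan n) 1 j \<longleftrightarrow> n + 1 \<le> j"
    unfolding covers_def s1 using assms by auto
  have c2: "covers (stefan n) l j \<longleftrightarrow> j = 2 * n + 2 - l" if "2 \<le> l" "l \<le> n" for l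
    unfolding covers_def s2[OF that] using that by auto
  have c3: "covers (stefan n) (n + 1) j \<longleftrightarrow> j = n \<or> j = n + 1"
    unfolding covers_def s3 by auto
  have c4: "covers (stefan n) l j \<longleftrightarrow> j = 2 * n + 1 - l" if "n + 2 \<le> l" "l \<le> 2 * n" for l
    unfolding covers_def s4[OF that] using that by auto
  have "covers (stefan n) l j \<longleftrightarrow> l \<in> (if j < n then {2 * n + 1 - j} else if j = n then {n + 1}
     else if j = n + 1 then {1, n + 1} else {1, 2 * n + 2 - j})" if "l \<in> {1..2 * n}" for l
  proof -
    from that consider "l = 1" | "2 \<le> l" "l \<le> n" | "l = n + 1" | "n + 2 \<le> l" "l \<le> 2 * n"
      by fastforce
    then show ?thesis
    proof cases
      case 1
      then show ?thesis unfolding 1 c1 using assms by auto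
    next
      case 2
      then show ?thesis unfolding c2[OF 2] using assms by auto
    next
      case 3
      then show ?thesis unfolding 3 c3 using assms by auto
    next
      case 4
      then show ?thesis unfolding c4[OF 4] using assms by auto
    qed
  qed
  moreover have "(if j < n then {2 * n + 1 - j} else if j = n then {n + 1}
     else if j = n + 1 then {1, n + 1} else {1, 2 * n + 2 - j}) \<subseteq> {1..2 * n}"
    using assms by auto
  ultimately show ?thesis by blast
qed

text \<open>Du's index \<open>j\<close> stands for the interval \<open>[j, j + 1]\<close>, except that \<open>n\<close> stands for
  \<open>[n, n + 2]\<close> and \<open>n + 1\<close> for \<open>[n + 1, 2 n + 1]\<close>; these are the images of monotone pieces.\<close>

lemma card_paths_eq_bmat:
  assumes n: "2 \<le> n" and i: "i \<in> {1..2 * n}" and j: "j \<in> {1..2 * n}"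
  shows "int (card (paths n (Suc k) i j)) = bmat n k i j
    + (if j = n + 1 then bmat n k i n else if n + 2 \<le> j then bmat n k i (n + 1) else 0)"
  using j
proof (induction k arbitrary: j)
  case 0
  have q: "(i, j) \<in> Qset n \<longleftrightarrow> (i = 1 \<and> j = n + 1) \<or> (2 \<le> i \<and> i \<le> n \<and> j = 2 * n + 2 - i)
      \<or> (n + 1 \<le> i \<and> i \<le> 2 * n \<and> j = 2 * n + 1 - i)" for j
    by (auto simp: Qset_def)
  have "card (paths n (Suc 0) i j)
      = (\<Sum>l \<in> {l \<in> {1..2 * n}. covers (stefan n) l j}. if l = i then 1 else 0)"
    unfolding card_paths_Suc by (intro sum.cong) auto
  also have "\<dots> = (if i \<in> {l \<in> {1..2 * n}. covers (stefan n) l j} then 1 else 0)"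
    by simp
  finally have *: "card (paths n (Suc 0) i j)
      = (if i \<in> {l \<in> {1..2 * n}. covers (stefan n) l j} then 1 else 0)" .
  have pr: "1 \<le> n" using n by simp
  have i': "1 \<le> i" "i \<le> 2 * n" and j': "1 \<le> j" "j \<le> 2 * n" using i 0 by auto
  have P: "i \<in> (if j < n then {2 * n + 1 - j} else if j = n then {n + 1}
       else if j = n + 1 then {1, n + 1} else {1, 2 * n + 2 - j}) \<longleftrightarrow>
     (j < n \<and> i = 2 * n + 1 - j) \<or> (j = n \<and> i = n + 1) \<or> (j = n + 1 \<and> (i = 1 \<or> i = n + 1)) \<or>
     (n + 2 \<le> j \<and> (i = 1 \<or> i = 2 * n + 2 - j))"
    by auto
  have A: "(i, j) \<in> Qset n \<longleftrightarrow> (j < n \<and> i = 2 * n + 1 - j) \<or> (j = n \<and> i = n + 1) \<or> (j = n + 1 \<and> i = 1) \<or>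
     (n + 2 \<le> j \<and> i = 2 * n + 2 - j)"
    unfolding q using n i' j' by (cases "i = 1"; cases "i \<le> n"; auto)
  have B: "(i, n) \<in> Qset n \<longleftrightarrow> i = n + 1" "(i, n + 1) \<in> Qset n \<longleftrightarrow> i = 1"
    unfolding q using n i' by (cases "i = 1"; cases "i \<le> n"; auto)+
  show ?case
    unfolding * predecessors[OF pr \<open>j \<in> _\<close>] P bmat.simps A B using n j'
    by (cases "j < n"; cases "j = n"; cases "j = n + 1"; auto)
next
  case (Suc k)
  note pr = predecessors[OF _ Suc.prems]
  have IH: "int (card (paths n (Suc k) i j)) = bmat n k i j
    + (if j = n + 1 then bmat n k i n else if n + 2 \<le> j then bmat n k i (n + 1) else 0)"
    if "j \<in> {1..2 * n}" for j using Suc.IH that .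
  have j: "1 \<le> j" "j \<le> 2 * n" using Suc.prems by auto
  consider "j < n" | "j = n" | "j = n + 1" | "n + 2 \<le> j" by linarith
  then show ?case
  proof cases
    case 1
    then have "card (paths n (Suc (Suc k)) i j) = card (paths n (Suc k) i (2 * n + 1 - j))"
      unfolding card_paths_Suc[of _ "Suc k"] using pr n by simp
    \<comment> \<open>The only predecessor lies beyond \<open>n + 1\<close>, so the correction term
      in its induction hypothesis is exactly the second summand of the recurrence.\<close>
    moreover have "2 * n + 1 - j \<in> {1..2 * n}" "n + 2 \<le> 2 * n + 1 - j" using 1 j by auto
    ultimately show ?thesis using 1 j n IH[of "2 * n + 1 - j"] by (simp del: paths.simps)
  next
    case 2
    then have "card (paths n (Suc (Suc k)) i j) = card (paths n (Suc k) i (n + 1))"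
      unfolding card_paths_Suc[of _ "Suc k"] using pr n by simp
    then show ?thesis using 2 j n IH[of "n + 1"] by (auto simp del: paths.simps)
  next
    case 3
    then have "card (paths n (Suc (Suc k)) i j)
        = card (paths n (Suc k) i 1) + card (paths n (Suc k) i (n + 1))"
      unfolding card_paths_Suc[of _ "Suc k"] using pr n by simp
    then show ?thesis using 3 j n IH[of "n + 1"] IH[of 1] by (auto simp del: paths.simps)
  next
    case 4
    then have "card (paths n (Suc (Suc k)) i j)
        = card (paths n (Suc k) i 1) + card (paths n (Suc k) i (2 * n + 2 - j))"
      unfolding card_paths_Suc[of _ "Suc k"] using pr n j by simp
    moreover have "2 * n + 2 - j \<in> {1..2 * n}" "2 * n + 2 - j \<le> n" using 4 j by auto
    ultimately show ?thesis using 4 j n IH[of "2 * n + 2 - j"] IH[of 1] by (auto simp del: paths.simps)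
  qed
qed

text \<open>For \<open>n = 1\<close> the graph has a loop at 2 and edges both ways between 1 and 2.
  Its matrix satisfies the Fibonacci recurrence, and the traces of its powers start with 2 and
  1.\<close>

lemma sum_card_paths_lucas:
  "(\<Sum>i \<in> {1..2}. int (card (paths 1 m i i))) = lucas m"
proof -
  let ?c = "\<lambda>m i j. int (card (paths 1 m i j))"
  have pr: "{l \<in> {1..2 * 1}. covers (stefan 1) l 1} = {2}"
    "{l \<in> {1..2 * 1}. covers (stefan 1) l 2} = {1, 2}"
    using predecessors[of 1 1] predecessors[of 1 2] by (simp_all add: numeral_2_eq_2)
  have r: "?c (Suc m) i 1 = ?c m i 2" "?c (Suc m) i 2 = ?c m i 1 + ?c m i 2" for m i
    unfolding card_paths_Suc pr by auto
  have "?c m 1 1 + ?c m 2 2 = lucas m"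
  proof (induction m rule: lucas.induct)
    case 1
    then show ?case by simp
  next
    case 2
    then show ?case using r[of 0 1] r[of 0 2] by simp
  next
    case (3 m)
    then show ?case using r[of "Suc m" 1] r[of "Suc m" 2] r[of m 1] r[of m 2] by simp
  qed
  moreover have "{1..2::nat} = {1, 2}" by auto
  ultimately show ?thesis by simp
qed

text \<open>On the diagonal, the correction terms of \<open>card_paths_eq_bmat\<close> become the
  two extra summands of \<open>cseq\<close>, which is therefore a trace.\<close>

lemma sum_card_paths_eq_phi_seq:
  assumes n: "1 \<le> n" and m: "0 < m"
  shows "(\<Sum>i \<in> {1..2 * n}. int (card (paths n m i i))) = phi_seq n m"
proof (cases "n = 1")
  case True
  then show ?thesis using sum_card_paths_lucas[of m] by (simp add: phi_seq_def)
next
  case False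
  then have n2: "2 \<le> n" using n by simp
  obtain k where k: "m = Suc k" using m by (cases m) auto
  have "(\<Sum>i \<in> {1..2 * n}. int (card (paths n m i i)))
      = (\<Sum>i \<in> {1..2 * n}. bmat n k i i
        + ((if i = n + 1 then bmat n k i n else 0) + (if n + 2 \<le> i then bmat n k i (n + 1) else 0)))"
    unfolding k by (intro sum.cong refl) (subst card_paths_eq_bmat[OF n2], auto)
  also have "\<dots> = (\<Sum>i \<in> {1..2 * n}. bmat n k i i)
      + ((\<Sum>i \<in> {1..2 * n}. if i = n + 1 then bmat n k i n else 0)
      + (\<Sum>i \<in> {1..2 * n}. if n + 2 \<le> i then bmat n k i (n + 1) else 0))"
    by (simp only: sum.distrib)
  also have "(\<Sum>i \<in> {1..2 * n}. if i = n + 1 then bmat n k i n else 0) = bmat n k (n + 1) n"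
    using n2 by (simp add: sum.delta)
  also have "(\<Sum>i \<in> {1..2 * n}. if n + 2 \<le> i then bmat n k i (n + 1) else 0)
      = (\<Sum>i = n + 2..2 * n. bmat n k i (n + 1))"
    by (rule sum.mono_neutral_cong_right) auto
  finally show ?thesis using False k by (simp add: phi_seq_def cseq_def)
qed

text \<open>A walk of period \<open>m\<close> is recorded by its first \<open>m + 1\<close>
  vertices, the last repeating the first; conversely, such a list is continued periodically by
  reading it modulo \<open>m\<close>.\<close>

lemma closed_walks_card:
  assumes n: "1 \<le> n" and m: "0 < m"
  shows "finite {w \<in> walks n. (shift ^^ m) w = w}"
    and "int (card {w \<in> walks n. (shift ^^ m) w = w}) = phi_seq n m"
proof -
  let ?X = "{w \<in> walks n. (shift ^^ m) w = w}"
  let ?Y = "\<Union>i \<in> {1..2 * n}. paths n m i i"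
  let ?h = "\<lambda>w. map w [0..<Suc m]"
  let ?g = "\<lambda>xs. \<lambda>l. xs ! (l mod m)"
  have bij: "bij_betw ?h ?X ?Y"
  proof (rule bij_betw_byWitness[where f' = ?g])
    show "\<forall>w\<in>?X. ?g (?h w) = w"
    proof
      fix w assume "w \<in> ?X"
      then have per: "w (l + m) = w l" for l by (auto simp: shift_funpow dest: fun_cong)
      have *: "w (r + m * q) = w r" for r q
      proof (induction q)
        case (Suc q)
        then show ?case using per[of "r + m * q"] by (simp add: algebra_simps)
      qed simp
      have "w (l mod m) = w l" for l
        using *[of "l mod m" "l div m"] by simp
      moreover have "l mod m < Suc m" for l using m by (simp add: less_SucI)
      ultimately show "?g (?h w) = w" by (simp add: fun_eq_iff del: upt_Suc)
    qed
    show "\<forall>xs\<in>?Y. ?h (?g xs) = xs"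
    proof
      fix xs assume "xs \<in> ?Y"
      then obtain i where i: "i \<in> {1..2 * n}" "xs \<in> paths n m i i" by blast
      then have xs: "length xs = Suc m" "xs ! 0 = i" "xs ! m = i" using paths_iff[OF i(1) i(1)] by auto
      show "?h (?g xs) = xs"
      proof (rule nth_equalityI)
        fix l assume "l < length (?h (?g xs))"
        then have "l < Suc m" by simp
        then show "?h (?g xs) ! l = xs ! l"
          using xs by (cases "l = m") (auto simp del: upt_Suc)
      qed (use xs in simp)
    qed
    show "?h ` ?X \<subseteq> ?Y"
    proof
      fix xs assume "xs \<in> ?h ` ?X"
      then obtain w where w: "w \<in> walks n" "(shift ^^ m) w = w" "xs = ?h w" by auto
      have wm: "w m = w 0" using w(2) by (auto simp: shift_funpow dest: fun_cong[of _ _ 0])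
      have w0: "w l \<in> {1..2 * n}" "covers (stefan n) (w l) (w (Suc l))" for l
        using w(1) unfolding walks_def by blast+
      have "xs \<in> paths n m (w 0) (w 0)"
        unfolding paths_iff[OF w0(1) w0(1)] using w(3) wm w0 by (auto simp del: upt_Suc simp: image_subset_iff)
      then show "xs \<in> ?Y" using w0(1)[of 0] by blast
    qed
    show "?g ` ?Y \<subseteq> ?X"
    proof
      fix w assume "w \<in> ?g ` ?Y"
      then obtain i xs where i: "i \<in> {1..2 * n}" "xs \<in> paths n m i i" "w = ?g xs" by blast
      then have xs: "length xs = Suc m" "xs ! 0 = i" "xs ! m = i" "set xs \<subseteq> {1..2 * n}"
        "\<And>l. l < m \<Longrightarrow> covers (stefan n) (xs ! l) (xs ! Suc l)"
        using paths_iff[OF i(1) i(1)] by auto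
      have lm: "l mod m < m" for l using m by simp
      have "xs ! (l mod m) \<in> {1..2 * n}" for l
        using xs(1,4) nth_mem[of "l mod m" xs] lm[of l] by (metis less_SucI subsetD)
      \<comment> \<open>At the seam the left index is 0 and the right one is \<open>m\<close>; both
        entries are \<open>i\<close>.\<close>
      moreover have "xs ! (Suc l mod m) = xs ! Suc (l mod m)" for l
        using xs(2,3) by (simp add: mod_Suc)
      then have "covers (stefan n) (xs ! (l mod m)) (xs ! (Suc l mod m))" for l
        using xs(5)[OF lm] by simp
      ultimately show "w \<in> ?X" by (auto simp: i(3) walks_def shift_funpow)
    qed
  qed
  have "finite ?Y" by (simp add: finite_paths)
  then show fin: "finite ?X" using bij_betw_finite[OF bij] by simp
  have "card ?X = card ?Y" by (rule bij_betw_same_card[OF bij])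
  also have "\<dots> = (\<Sum>i \<in> {1..2 * n}. card (paths n m i i))"
  proof (rule card_UN_disjoint)
    show "\<forall>i\<in>{1..2 * n}. \<forall>j\<in>{1..2 * n}. i \<noteq> j \<longrightarrow> paths n m i i \<inter> paths n m j j = {}"
      using paths_last by blast
  qed (auto simp: finite_paths)
  finally show "int (card ?X) = phi_seq n m"
    using sum_card_paths_eq_phi_seq[OF n m] by simp
qed

lemma card_primitive_walks:
  assumes n: "1 \<le> n" and m: "0 < m"
  shows "finite {w \<in> walks n. minper shift m w}"
    and "int (card {w \<in> walks n. minper shift m w}) = PhiN n m"
proof -
  show "finite {w \<in> walks n. minper shift m w}"
    by (rule finite_subset[OF _ closed_walks_card(1)[OF n m]]) (auto simp: minper_fix)
  have "phi_seq n d = (\<Sum>e \<in> {e. e dvd d}. int (card {w \<in> walks n. minper shift e w}))" if "0 < d" for d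
    unfolding closed_walks_card(2)[OF n that, symmetric]
      card_fix_eq_sum_minper[OF closed_walks_card(1)[OF n that] that] by simp
  then show "int (card {w \<in> walks n. minper shift m w}) = PhiN n m"
    unfolding PhiN_def by (rule PhiSum_inversion[OF _ m, symmetric])
qed

section \<open>Periodic orbits and their Markov graphs\<close>

lemma discrete_ivt:
  fixes g :: "nat \<Rightarrow> nat"
  assumes "p \<le> q" "(g p \<le> t \<and> t < g q) \<or> (g q \<le> t \<and> t < g p)"
  obtains i where "p \<le> i" "i < q" "covers g i t"
proof -
  have "\<exists>i. p \<le> i \<and> i < q \<and> covers g i t"
    using assms
  proof (induction q rule: dec_induct)
    case base
    then show ?case by linarith
  next
    case (step r)
    show ?case
    proof (cases "covers g r t")
      case True
      then show ?thesis using step.hyps by auto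
    next
      case False
      then have "(g p \<le> t \<and> t < g r) \<or> (g r \<le> t \<and> t < g p)"
        using step.prems by (auto simp: covers_def)
      then show ?thesis using step.IH less_Suc_eq by blast
    qed
  qed
  then show ?thesis using that by blast
qed

locale cycle =
  fixes f :: "real \<Rightarrow> real" and a b :: real and N :: nat
    and x :: "nat \<Rightarrow> real" and \<sigma> :: "nat \<Rightarrow> nat"
  assumes cont: "continuous_on {a..b} f" and self: "f ` {a..b} \<subseteq> {a..b}"
    and N: "2 \<le> N"
    and mono: "\<And>i j. 1 \<le> i \<Longrightarrow> i < j \<Longrightarrow> j \<le> N \<Longrightarrow> x i < x j"
    and xI: "\<And>i. i \<in> {1..N} \<Longrightarrow> x i \<in> {a..b}"
    and sig: "\<And>i. i \<in> {1..N} \<Longrightarrow> \<sigma> i \<in> {1..N}"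
    and fx: "\<And>i. i \<in> {1..N} \<Longrightarrow> f (x i) = x (\<sigma> i)"
    and per: "\<And>i. i \<in> {1..N} \<Longrightarrow> minper f N (x i)"
    and orb: "\<And>i j. i \<in> {1..N} \<Longrightarrow> j \<in> {1..N} \<Longrightarrow> \<exists>l. (f ^^ l) (x i) = x j"
begin

lemma x_le: "1 \<le> i \<Longrightarrow> i \<le> j \<Longrightarrow> j \<le> N \<Longrightarrow> x i \<le> x j"
  using mono[of i j] by (cases "i = j") auto

lemma x_eq: "i \<in> {1..N} \<Longrightarrow> j \<in> {1..N} \<Longrightarrow> x i = x j \<Longrightarrow> i = j"
  using mono[of i j] mono[of j i] by (cases i j rule: linorder_cases) auto

lemma iter: "i \<in> {1..N} \<Longrightarrow> (\<sigma> ^^ l) i \<in> {1..N} \<and> (f ^^ l) (x i) = x ((\<sigma> ^^ l) i)"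
proof (induction l)
  case (Suc l)
  then show ?case using sig[of "(\<sigma> ^^ l) i"] fx[of "(\<sigma> ^^ l) i"] by simp
qed simp

lemma minper_sig:
  assumes "i \<in> {1..N}"
  shows "minper \<sigma> N i"
proof -
  have "(\<sigma> ^^ m) i = i \<longleftrightarrow> (f ^^ m) (x i) = x i" for m
    using iter[OF assms, of m] x_eq[of "(\<sigma> ^^ m) i" i] assms by auto
  then show ?thesis using per[OF assms] by (simp add: minper_def)
qed

lemma not_fixed: "i \<in> {1..N} \<Longrightarrow> f (x i) \<noteq> x i"
  using minper_fix[OF per, of i 1] N by simp

lemma sig_neq: "i \<in> {1..N} \<Longrightarrow> \<sigma> i \<noteq> i"
  using not_fixed[of i] fx[of i] by auto

lemma sig_eq:
  assumes "i \<in> {1..N}" "j \<in> {1..N}" "\<sigma> i = \<sigma> j"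
  shows "i = j"
proof -
  obtain M where M: "N = Suc M" using N by (cases N) auto
  have "(\<sigma> ^^ N) k = (\<sigma> ^^ M) (\<sigma> k)" for k by (simp add: M funpow_swap1)
  moreover have "(\<sigma> ^^ N) i = i" "(\<sigma> ^^ N) j = j"
    using minper_fix[OF minper_sig] assms by auto
  ultimately show ?thesis using assms(3) by metis
qed

lemma invariant_full:
  assumes "A \<subseteq> {1..N}" "A \<noteq> {}" "\<sigma> ` A \<subseteq> A"
  shows "A = {1..N}"
proof
  obtain i where i: "i \<in> A" using assms by blast
  have "(\<sigma> ^^ l) i \<in> A" for l by (rule self_funpow[OF assms(3) i])
  moreover have "\<exists>l. (\<sigma> ^^ l) i = j" if j: "j \<in> {1..N}" for j
  proof -
    have i': "i \<in> {1..N}" using i assms(1) by blast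
    obtain l where "(f ^^ l) (x i) = x j" using orb[OF i' j] by blast
    then have "(\<sigma> ^^ l) i = j" using iter[OF i', of l] x_eq[of "(\<sigma> ^^ l) i" j] j by auto
    then show ?thesis by blast
  qed
  ultimately show "{1..N} \<subseteq> A" by blast
qed (rule assms(1))

definition G :: "nat \<Rightarrow> nat \<Rightarrow> bool" where
  "G i j \<longleftrightarrow> i \<in> {1..<N} \<and> j \<in> {1..<N} \<and> covers \<sigma> i j"

lemma interval_cover:
  assumes "G i j"
  shows "{x j..x (Suc j)} \<subseteq> f ` {x i..x (Suc i)}"
proof
  fix y assume y: "y \<in> {x j..x (Suc j)}"
  have i: "i \<in> {1..N}" "Suc i \<in> {1..N}" and j: "1 \<le> j" "Suc j \<le> N"
    and c: "min (\<sigma> i) (\<sigma> (Suc i)) \<le> j" "Suc j \<le> max (\<sigma> i) (\<sigma> (Suc i))"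
    using assms by (auto simp: G_def covers_def)
  have si: "\<sigma> i \<in> {1..N}" "\<sigma> (Suc i) \<in> {1..N}" using sig i by auto
  have le: "x i \<le> x (Suc i)" using x_le i by auto
  have "{x i..x (Suc i)} \<subseteq> {a..b}" using xI[OF i(1)] xI[OF i(2)] by auto
  then have ct: "continuous_on {x i..x (Suc i)} f" using continuous_on_subset[OF cont] by blast
  show "y \<in> f ` {x i..x (Suc i)}"
  proof (cases "\<sigma> i \<le> \<sigma> (Suc i)")
    case True
    then have "x (\<sigma> i) \<le> x j" "x (Suc j) \<le> x (\<sigma> (Suc i))" using x_le c si j by auto
    then have "f (x i) \<le> y" "y \<le> f (x (Suc i))" using y fx[OF i(1)] fx[OF i(2)] by auto
    from IVT'[OF this le ct] show ?thesis by auto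
  next
    case False
    then have "x (\<sigma> (Suc i)) \<le> x j" "x (Suc j) \<le> x (\<sigma> i)" using x_le c si j by auto
    then have "f (x (Suc i)) \<le> y" "y \<le> f (x i)" using y fx[OF i(1)] fx[OF i(2)] by auto
    from IVT2'[OF this le ct] show ?thesis by auto
  qed
qed

lemma loop_point:
  assumes q: "0 < q" and G: "\<And>l. l < q \<Longrightarrow> G (u l) (u (Suc l))" and loop: "u q = u 0"
  obtains z where "z \<in> {a..b}" "(f ^^ q) z = z" "\<And>l. l \<le> q \<Longrightarrow> (f ^^ l) z \<in> {x (u l)..x (Suc (u l))}"
proof -
  have u: "u l \<in> {1..<N}" if "l \<le> q" for l
    using G[of l] G[of 0] that q loop by (cases "l = q") (auto simp: G_def)
  have sub: "{x (u l)..x (Suc (u l))} \<subseteq> {a..b}" if "l \<le> q" for l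
    using u[OF that] xI[of "u l"] xI[of "Suc (u l)"] by auto
  have le: "x (u l) \<le> x (Suc (u l))" if "l \<le> q" for l
    using u[OF that] x_le[of "u l" "Suc (u l)"] by auto
  obtain z where z: "(f ^^ q) z = z" "\<And>l. l \<le> q \<Longrightarrow> (f ^^ l) z \<in> {x (u l)..x (Suc (u l))}"
    by (rule interval_loop[OF cont self, of q "\<lambda>l. x (u l)" "\<lambda>l. x (Suc (u l))"])
      (use sub le interval_cover[OF G] loop in auto)
  moreover have "z \<in> {a..b}" using z(2)[of 0] sub[of 0] by auto
  ultimately show ?thesis using that by blast
qed

text \<open>The walk from \<open>i\<close> to \<open>j\<close> and back has odd length, so the point
  following it has an odd period, which can only be 1. A fixed point in two different intervals
  would be a common endpoint, but no point of the cycle is fixed.\<close>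

lemma odd_loop_trivial:
  assumes path: "(G ^^ p) i j" and G: "G j i" and odd: "even p"
    and nop: "\<And>d z. odd d \<Longrightarrow> 1 < d \<Longrightarrow> d \<le> Suc p \<Longrightarrow> \<not> min_period_pt f {a..b} d z"
  shows "j = i"
proof -
  obtain v where v: "v 0 = i" "v p = j" "\<And>l. l < p \<Longrightarrow> G (v l) (v (Suc l))"
    using path unfolding relpowp_fun_conv by blast
  define u where "u l = (if l \<le> p then v l else i)" for l
  have "G (u l) (u (Suc l))" if "l < Suc p" for l
    using that v G by (cases "l = p") (auto simp: u_def)
  then obtain z where z: "z \<in> {a..b}" "(f ^^ Suc p) z = z"
      "\<And>l. l \<le> Suc p \<Longrightarrow> (f ^^ l) z \<in> {x (u l)..x (Suc (u l))}"
    using loop_point[of "Suc p" u] v(1) by (auto simp: u_def)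
  obtain d where d: "d dvd Suc p" "minper f d z" using minper_exists[OF z(2)] by auto
  have "odd d" using d(1) odd by (meson dvd_trans even_Suc)
  moreover have "d \<le> Suc p" using d(1) by (simp add: dvd_imp_le)
  ultimately have "\<not> 1 < d" using nop[of d z] d(2) z(1) by (auto simp: min_period_pt_iff)
  then have "d = 1" using minper_pos[OF d(2)] by simp
  then have fz: "(f ^^ l) z = z" for l using minper_fix[OF d(2)] by simp
  have zi: "z \<in> {x i..x (Suc i)}" using z(3)[of 0] v by (simp add: u_def)
  have zj: "z \<in> {x j..x (Suc j)}" using z(3)[of p] v fz by (simp add: u_def)
  have ij: "i \<in> {1..<N}" "j \<in> {1..<N}" using G by (auto simp: G_def)
  show ?thesis
  proof (rule ccontr)
    assume "j \<noteq> i"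
    then consider "Suc i \<le> j" | "Suc j \<le> i" by linarith
    then have "z \<in> {x i, x j}"
    proof cases
      case 1
      then have "x (Suc i) \<le> x j" using x_le ij by auto
      then show ?thesis using zi zj by auto
    next
      case 2
      then have "x (Suc j) \<le> x i" using x_le ij by auto
      then show ?thesis using zi zj by auto
    qed
    then show False using not_fixed[of i] not_fixed[of j] ij fz[of 1] by auto
  qed
qed

text \<open>\<open>c\<close> is the last index that moves to the right. The interval at
  \<open>c\<close> then covers itself, which makes it the starting point of all walks below.\<close>

lemma center_exists: "\<exists>c. c \<in> {1..<N} \<and> c < \<sigma> c \<and> \<sigma> (Suc c) \<le> c"
proof -
  define S where "S = {i \<in> {1..N}. i < \<sigma> i}"
  define c where "c = Max S"
  have "1 \<in> S" using sig[of 1] sig_neq[of 1] N by (auto simp: S_def)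
  then have cS: "c \<in> S" unfolding c_def by (intro Max_in) (auto simp: S_def)
  have max: "i \<le> c" if "i \<in> S" for i unfolding c_def using that by (simp add: S_def)
  have "N \<notin> S" using sig[of N] N by (auto simp: S_def)
  then have "c \<noteq> N" using cS by blast
  then have c: "c \<in> {1..<N}" "c < \<sigma> c" using cS by (auto simp: S_def)
  have "Suc c \<notin> S" using max[of "Suc c"] by auto
  then have "\<sigma> (Suc c) \<le> c" using sig_neq[of "Suc c"] c by (auto simp: S_def)
  with c show ?thesis by blast
qed

section \<open>Growing the hull of the central interval\<close>

primrec hulls :: "nat \<Rightarrow> nat \<Rightarrow> nat set" where
  "hulls c 0 = {c, Suc c}"
| "hulls c (Suc j) = {Min (\<sigma> ` hulls c j)..Max (\<sigma> ` hulls c j)}"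

context
  fixes c
  assumes c: "c \<in> {1..<N}" "c < \<sigma> c" "\<sigma> (Suc c) \<le> c"
begin

lemma hulls_convex: "p \<in> hulls c j \<Longrightarrow> q \<in> hulls c j \<Longrightarrow> p \<le> r \<Longrightarrow> r \<le> q \<Longrightarrow> r \<in> hulls c j"
  by (cases j) auto

text \<open>The hulls are nested because the images of \<open>c\<close> and \<open>Suc c\<close>
  already enclose this pair.\<close>

lemma hulls_basic:
  "finite (hulls c j) \<and> hulls c j \<subseteq> {1..N} \<and> {c, Suc c} \<subseteq> hulls c j \<and> hulls c j \<subseteq> hulls c (Suc j)"
proof (induction j)
  case 0
  have "Min (\<sigma> ` {c, Suc c}) \<le> c" "Suc c \<le> Max (\<sigma> ` {c, Suc c})"
    using c by auto
  then show ?case using c by auto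
next
  case (Suc j)
  let ?W = "hulls c j" and ?V = "hulls c (Suc j)"
  have fin: "finite ?V" by simp
  have img: "\<sigma> ` ?W \<subseteq> {1..N}" using Suc sig by blast
  have ne: "\<sigma> ` ?W \<noteq> {}" using Suc by auto
  have "Min (\<sigma> ` ?W) \<in> \<sigma> ` ?W" "Max (\<sigma> ` ?W) \<in> \<sigma> ` ?W"
    using Suc ne by (auto intro!: Min_in Max_in)
  then have sub: "?V \<subseteq> {1..N}" using img by fastforce
  have "\<sigma> ` ?W \<subseteq> \<sigma> ` ?V" using Suc by blast
  then have "Min (\<sigma> ` ?V) \<le> Min (\<sigma> ` ?W)" "Max (\<sigma> ` ?W) \<le> Max (\<sigma> ` ?V)"
    using ne fin by (auto intro!: Min_antimono Max_mono simp del: hulls.simps)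
  then have "?V \<subseteq> hulls c (Suc (Suc j))"
    unfolding hulls.simps(2)[of c j] hulls.simps(2)[of c "Suc j"] by auto
  then show ?case using Suc sub fin by blast
qed

lemma hulls_image: "\<sigma> ` hulls c j \<subseteq> hulls c (Suc j)"
  using hulls_basic[of j] by auto

declare hulls.simps(2) [simp del]

lemma hulls_mono: "i \<le> j \<Longrightarrow> hulls c i \<subseteq> hulls c j"
  by (rule lift_Suc_mono_le[of "hulls c"]) (use hulls_basic in blast)

text \<open>The exact length matters, since parity decides whether a loop is of use. An interval in
  the new hull lies between two images of old indices; going from one of these old indices to the
  other, some pair of neighbours has images enclosing it.\<close>

lemma hulls_reach: "t \<in> hulls c j \<Longrightarrow> Suc t \<in> hulls c j \<Longrightarrow> (G ^^ j) c t"
proof (induction j arbitrary: t)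
  case 0
  then show ?case by auto
next
  case (Suc j)
  let ?W = "hulls c j"
  have W: "finite ?W" "?W \<subseteq> {1..N}" "?W \<noteq> {}" using hulls_basic[of j] by auto
  have t: "t \<in> {1..N}" "Suc t \<in> {1..N}" using Suc.prems hulls_basic[of "Suc j"] by blast+
  have "Min (\<sigma> ` ?W) \<in> \<sigma> ` ?W" "Max (\<sigma> ` ?W) \<in> \<sigma> ` ?W"
    using W by (auto intro!: Min_in Max_in)
  then obtain p q where pq: "p \<in> ?W" "q \<in> ?W" "\<sigma> p \<le> t" "t < \<sigma> q"
    using Suc.prems unfolding hulls.simps(2) by fastforce
  have "\<exists>i. i \<in> ?W \<and> Suc i \<in> ?W \<and> covers \<sigma> i t"
  proof (cases "p \<le> q")
    case True
    obtain i where "p \<le> i" "i < q" "covers \<sigma> i t" using discrete_ivt[OF True] pq(3,4) by blast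
    then show ?thesis using hulls_convex[OF pq(1,2), of i] hulls_convex[OF pq(1,2), of "Suc i"] by auto
  next
    case False
    then have le: "q \<le> p" by simp
    obtain i where "q \<le> i" "i < p" "covers \<sigma> i t" using discrete_ivt[OF le] pq(3,4) by blast
    then show ?thesis using hulls_convex[OF pq(2,1), of i] hulls_convex[OF pq(2,1), of "Suc i"] by auto
  qed
  then obtain i where i: "i \<in> ?W" "Suc i \<in> ?W" "covers \<sigma> i t" by blast
  have "i \<in> {1..N}" "Suc i \<in> {1..N}" using i W by blast+
  then have "G i t" using i t by (auto simp: G_def)
  then show ?case using Suc.IH[OF i(1,2)] by auto
qed

text \<open>The index \<open>i\<close> stays on its side of the centre while the central index on
  that side crosses, so between them some pair of neighbours has images on both sides. This closes a
  walk of length \<open>j + 1\<close> through an interval other than the central one.\<close>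

lemma nonswap_loop:
  assumes i: "i \<in> hulls c j" "\<not> (i \<le> c \<longleftrightarrow> c < \<sigma> i)"
  shows "\<exists>p. p \<noteq> c \<and> (G ^^ j) c p \<and> G p c"
proof -
  have cW: "c \<in> hulls c j" "Suc c \<in> hulls c j" using hulls_basic[of j] by auto
  have "\<exists>p. p \<noteq> c \<and> p \<in> hulls c j \<and> Suc p \<in> hulls c j \<and> covers \<sigma> p c"
  proof (cases "i \<le> c")
    case True
    then obtain p where "i \<le> p" "p < c" "covers \<sigma> p c"
      using discrete_ivt[of i c \<sigma> c] i c by auto
    then show ?thesis
      using hulls_convex[OF i(1) cW(1), of p] hulls_convex[OF i(1) cW(1), of "Suc p"] by auto
  next
    case False
    then obtain p where "Suc c \<le> p" "p < i" "covers \<sigma> p c"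
      using discrete_ivt[of "Suc c" i \<sigma> c] i c by auto
    then show ?thesis
      using hulls_convex[OF cW(2) i(1), of p] hulls_convex[OF cW(2) i(1), of "Suc p"] by (intro exI[of _ p]) auto
  qed
  then obtain p where p: "p \<noteq> c" "p \<in> hulls c j" "Suc p \<in> hulls c j" "covers \<sigma> p c" by blast
  have "p \<in> {1..N}" "Suc p \<in> {1..N}" using p hulls_basic[of j] by blast+
  then have "G p c" using p c by (auto simp: G_def)
  then show ?thesis using p hulls_reach by blast
qed

text \<open>A hull equal to its successor would be invariant under the permutation, which is a
  single cycle.\<close>

lemma hulls_grow:
  assumes "hulls c j \<noteq> {1..N}"
  shows "card (hulls c j) < card (hulls c (Suc j))"
proof -
  have "hulls c j \<noteq> hulls c (Suc j)"
  proof
    assume "hulls c j = hulls c (Suc j)"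
    then have "hulls c j = {1..N}"
      using hulls_basic[of j] hulls_image[of j] by (intro invariant_full) auto
    with assms show False by contradiction
  qed
  then show ?thesis using hulls_basic[of j] hulls_basic[of "Suc j"] by (intro psubset_card_mono) auto
qed

lemma hulls_card_ge: "hulls c j = {1..N} \<or> j + 2 \<le> card (hulls c j)"
proof (induction j)
  case 0
  then show ?case by simp
next
  case (Suc j)
  show ?case
  proof (cases "hulls c j = {1..N}")
    case True
    then show ?thesis using hulls_basic[of "Suc j"] hulls_basic[of j] by (metis subset_antisym)
  next
    case False
    then show ?thesis using Suc hulls_grow[OF False] by linarith
  qed
qed

lemma hulls_full: "N \<le> j + 2 \<Longrightarrow> hulls c j = {1..N}"
  using hulls_card_ge[of j] hulls_basic[of j] card_seteq[of "{1..N}" "hulls c j"] by auto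

text \<open>Time \<open>2 * N\<close> is even and late enough for the hull to contain every index,
  so an index that fails to cross the centre would give a nontrivial loop of odd length.\<close>

lemma division:
  assumes nop: "\<And>d z. odd d \<Longrightarrow> 1 < d \<Longrightarrow> \<not> min_period_pt f {a..b} d z" and i: "i \<in> {1..N}"
  shows "i \<le> c \<longleftrightarrow> c < \<sigma> i"
proof (rule ccontr)
  assume "\<not> (i \<le> c \<longleftrightarrow> c < \<sigma> i)"
  moreover have "i \<in> hulls c (2 * N)" using hulls_full[of "2 * N"] i by auto
  ultimately obtain p where "p \<noteq> c" "(G ^^ (2 * N)) c p" "G p c" using nonswap_loop by blast
  then show False using odd_loop_trivial[of "2 * N" c p] nop by auto
qed

text \<open>The left side has more points than the right, so its points cannot all cross; this
  delays the index 1 to the last possible moment. The hulls therefore gain one index at a time, each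
  the image of the one before and on the opposite side, and this fixes every value of the
  permutation.\<close>

lemma stefan_structure:
  assumes n: "1 \<le> n" "N = 2 * n + 1" "n + 1 \<le> c"
    and nop: "\<And>d z. odd d \<Longrightarrow> 1 < d \<Longrightarrow> d < N \<Longrightarrow> \<not> min_period_pt f {a..b} d z"
    and i: "i \<in> {1..N}"
  shows "\<sigma> i = stefan n i"
proof -
  let ?W = "hulls c"
  \<comment> \<open>\<open>M\<close> is \<open>N - 2\<close>, the number of steps from 2 indices to
    \<open>N\<close> when one is added at a time.\<close>
  define M where "M = 2 * n - 1"
  have M: "N = M + 2" "odd M" "1 \<le> M" using n by (auto simp: M_def)
  \<comment> \<open>The loop has length \<open>M\<close>, odd and below \<open>N\<close>; this is
    where the minimality of the odd period enters.\<close>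
  have swap: "k \<le> c \<longleftrightarrow> c < \<sigma> k" if kW: "k \<in> ?W (M - 1)" for k
  proof (rule ccontr)
    assume "\<not> (k \<le> c \<longleftrightarrow> c < \<sigma> k)"
    then obtain p where p: "p \<noteq> c" "(G ^^ (M - 1)) c p" "G p c" using nonswap_loop[OF kW] by blast
    have "even (M - 1)" using M by simp
    from odd_loop_trivial[OF p(2,3) this] have "p = c" using nop M by auto
    with p(1) show False by contradiction
  qed
  \<comment> \<open>Otherwise all \<open>c\<close> left indices, at least \<open>n + 1\<close> of
    them, would be mapped injectively to the at most \<open>n\<close> right ones.\<close>
  have one: "1 \<notin> ?W (M - 1)"
  proof
    assume "1 \<in> ?W (M - 1)"
    moreover have "c \<in> ?W (M - 1)" using hulls_basic[of "M - 1"] by auto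
    ultimately have "{1..c} \<subseteq> ?W (M - 1)" using hulls_convex[of 1 "M - 1" c] by auto
    then have "\<sigma> ` {1..c} \<subseteq> {Suc c..N}" using swap sig c by fastforce
    moreover have "inj_on \<sigma> {1..c}" using sig_eq c by (auto intro!: inj_onI)
    ultimately have "card {1..c} \<le> card {Suc c..N}" by (meson card_inj_on_le finite_atLeastAtMost)
    then show False using n by auto
  qed
  have notfull: "?W j \<noteq> {1..N}" if "j < M" for j
  proof
    assume "?W j = {1..N}"
    moreover have "j \<le> M - 1" using that by simp
    ultimately have "{1..N} \<subseteq> ?W (M - 1)" using hulls_mono[of j "M - 1"] by simp
    moreover have "1 \<in> {1..N}" using N by simp
    ultimately show False using one by blast
  qed
  have lower: "j + 2 \<le> card (?W j)" if "j < M" for j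
    using hulls_card_ge[of j] notfull[OF that] by blast
  have fullM: "?W M = {1..N}" using hulls_full[of M] M by simp
  have upper: "card (?W j) + (M - j) \<le> N" if "j \<le> M" for j
    using that
  proof (induction j rule: inc_induct)
    case base
    then show ?case using fullM by simp
  next
    case (step j)
    then show ?case using hulls_grow[OF notfull[of j]] by linarith
  qed
  have card: "card (?W j) = j + 2" if "j \<le> M" for j
    using lower[of j] upper[OF that] that M fullM by (cases "j = M") auto
  have "\<exists>w. w \<notin> ?W j \<and> ?W (Suc j) = insert w (?W j)" if "j < M" for j
  proof -
    have "card (?W (Suc j) - ?W j) = 1"
      using card[of j] card[of "Suc j"] that hulls_basic[of j] by (subst card_Diff_subset) auto
    then obtain w where "?W (Suc j) - ?W j = {w}" by (auto simp: card_1_singleton_iff)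
    moreover have "?W j \<subseteq> ?W (Suc j)" using hulls_basic[of j] by simp
    ultimately show ?thesis by blast
  qed
  then obtain w' where w': "\<And>j. j < M \<Longrightarrow> w' j \<notin> ?W j \<and> ?W (Suc j) = insert (w' j) (?W j)"
    by metis
  define w where "w j = w' (j - 1)" for j
  have w: "w (Suc j) \<notin> ?W j" "?W (Suc j) = insert (w (Suc j)) (?W j)" if "j < M" for j
    using w'[OF that] by (auto simp: w_def)
  have wW: "w j \<in> ?W j" if "1 \<le> j" "j \<le> M" for j using w(2)[of "j - 1"] that by (cases j) auto
  have wM: "w M = 1"
  proof -
    have "?W M = insert (w M) (?W (M - 1))" using w(2)[of "M - 1"] M by simp
    moreover have "1 \<in> ?W M" unfolding fullM using N by simp
    ultimately show ?thesis using one by simp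
  qed
  have w_img: "w (Suc j) \<in> \<sigma> ` ?W j" if "j < M" for j
  proof (rule ccontr)
    assume "w (Suc j) \<notin> \<sigma> ` ?W j"
    moreover have "\<sigma> ` ?W j \<subseteq> insert (w (Suc j)) (?W j)"
      using hulls_image[of j] unfolding w(2)[OF that] .
    ultimately have "\<sigma> ` ?W j \<subseteq> ?W j" by (rule iffD1[OF subset_insert])
    then have "?W j = {1..N}" using hulls_basic[of j] by (intro invariant_full) auto
    then show False using notfull[OF that] by contradiction
  qed
  \<comment> \<open>All images of the preceding hull lie in the present one, so the next new index
    can only be the image of the index added last.\<close>
  have next_w: "\<sigma> (w j) = w (Suc j)" if j: "1 \<le> j" "j < M" for j
  proof -
    obtain k where k: "j = Suc k" using j by (cases j) auto
    have "w (Suc j) \<notin> \<sigma> ` ?W k" using w(1)[OF j(2)] hulls_image[of k] k by blast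
    then show ?thesis using w_img[OF j(2)] w(2)[of k] k j by auto
  qed
  \<comment> \<open>Backwards from \<open>w M = 1\<close>, which lies on the left: consecutive new
    indices are on opposite sides.\<close>
  have side: "w j \<le> c \<longleftrightarrow> odd j" if "1 \<le> j" "j \<le> M" for j
    using that(2,1)
  proof (induction j rule: inc_induct)
    case base
    then show ?case using wM c M by auto
  next
    case (step j)
    have "?W j \<subseteq> ?W (M - 1)" using step by (intro hulls_mono) auto
    then have "w j \<in> ?W (M - 1)" using wW[of j] step by auto
    then have "w j \<le> c \<longleftrightarrow> c < w (Suc j)" using swap[of "w j"] next_w[of j] step by auto
    then show ?case using step by auto
  qed
  \<comment> \<open>Hulls are segments, so the new index is adjacent to the old hull on the side
    just determined. Sums replace differences to avoid truncation.\<close>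
  have new: "if even j then w (Suc j) + (j + 1) div 2 + 1 = c else w (Suc j) = c + 2 + j div 2"
    if j: "j < M" and W: "?W j = {l. c \<le> l + (j + 1) div 2 \<and> l \<le> c + 1 + j div 2}" for j
  proof (cases "even j")
    case True
    then have le: "w (Suc j) \<le> c" using side[of "Suc j"] j by auto
    moreover have ns: "w (Suc j) \<notin> ?W j" using w(1)[OF j] .
    ultimately have lt: "w (Suc j) < c" using hulls_basic[of j] by (cases "w (Suc j) = c") auto
    have "c \<in> ?W (Suc j)" using hulls_basic[of "Suc j"] by auto
    then have "Suc (w (Suc j)) \<in> ?W (Suc j)"
      using hulls_convex[of "w (Suc j)" "Suc j" c "Suc (w (Suc j))"] wW[of "Suc j"] j lt by auto
    then have "Suc (w (Suc j)) \<in> ?W j" using w(2)[OF j] by auto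
    then show ?thesis using ns lt True unfolding W by auto
  next
    case False
    then have gt: "c < w (Suc j)" using side[of "Suc j"] j by auto
    moreover have ns: "w (Suc j) \<notin> ?W j" using w(1)[OF j] .
    ultimately have gt: "Suc c < w (Suc j)" using hulls_basic[of j] by (cases "w (Suc j) = Suc c") auto
    have "Suc c \<in> ?W (Suc j)" using hulls_basic[of "Suc j"] by auto
    then have "w (Suc j) - 1 \<in> ?W (Suc j)"
      using hulls_convex[of "Suc c" "Suc j" "w (Suc j)" "w (Suc j) - 1"] wW[of "Suc j"] j gt by auto
    then have "w (Suc j) - 1 \<in> ?W j" using w(2)[OF j] gt by auto
    then show ?thesis using ns gt False unfolding W by auto
  qed
  have W: "?W j = {l. c \<le> l + (j + 1) div 2 \<and> l \<le> c + 1 + j div 2}" if "j \<le> M" for j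
    using that
  proof (induction j)
    case 0
    then show ?case by auto
  next
    case (Suc j)
    then have IH: "?W j = {l. c \<le> l + (j + 1) div 2 \<and> l \<le> c + 1 + j div 2}" and j: "j < M" by auto
    show ?case
      unfolding w(2)[OF j] IH using new[OF j IH] by (cases "even j") (auto elim!: evenE oddE)
  qed
  have wodd: "w (2 * k + 1) + k + 1 = c" if "2 * k + 1 \<le> M" for k
    using new[OF _ W, of "2 * k"] that by auto
  have weven: "w (2 * k) = c + 1 + k" if "1 \<le> k" "2 * k \<le> M" for k
    using new[OF _ W, of "2 * k - 1"] that by (cases k) auto
  have M1: "M = 2 * (n - 1) + 1" using n(1) by (simp add: M_def)
  \<comment> \<open>The last index added is 1, and the \<open>n\<close> additions on the left locate
    the centre.\<close>
  have cn: "c = n + 1" using wodd[of "n - 1"] wM n(1) unfolding M1 by simp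
  have s_left: "\<sigma> m = 2 * n + 3 - m" if m: "2 \<le> m" "m \<le> n" for m
  proof -
    have k: "2 * (n - m) + 1 < M" using m by (auto simp: M_def)
    have "w (2 * (n - m) + 1) = m" using wodd[of "n - m"] k cn m by auto
    moreover have "w (2 * (n - m + 1)) = 2 * n + 3 - m" using weven[of "n - m + 1"] k cn m M by auto
    ultimately show ?thesis using next_w[of "2 * (n - m) + 1"] k by auto
  qed
  have s_right: "\<sigma> m = 2 * n + 2 - m" if m: "n + 3 \<le> m" "m \<le> N" for m
  proof -
    have k: "2 * (m - n - 2) < M" using m n by (auto simp: M_def)
    have "w (2 * (m - n - 2)) = m" using weven[of "m - n - 2"] k cn m by auto
    moreover have "w (2 * (m - n - 2) + 1) = 2 * n + 2 - m" using wodd[of "m - n - 2"] k cn m n by auto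
    ultimately show ?thesis using next_w[of "2 * (m - n - 2)"] k m by auto
  qed
  have "w 1 = n" using wodd[of 0] cn M by auto
  then have "n = \<sigma> c \<or> n = \<sigma> (Suc c)" using w_img[of 0] M by auto
  then have s_mid2: "\<sigma> (n + 2) = n" using c cn by auto
  have "\<sigma> c \<in> ?W 1" using hulls_image[of 0] by auto
  then have s_mid1: "\<sigma> (n + 1) = n + 2" unfolding W[OF M(3)] using c cn by auto
  \<comment> \<open>Every value except \<open>n + 1\<close> is taken by an index above 1, so
    injectivity leaves only \<open>n + 1\<close> for the index 1.\<close>
  have pre: "\<exists>m\<in>{2..N}. \<sigma> m = v" if v: "v \<in> {1..N}" "v \<noteq> n + 1" for v
  proof -
    consider "v = n" | "v = n + 2" | "v < n" | "n + 2 < v" using v by linarith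
    then show ?thesis
    proof cases
      case 1
      then show ?thesis using s_mid2 n by (intro bexI[of _ "n + 2"]) auto
    next
      case 2
      then show ?thesis using s_mid1 n by (intro bexI[of _ "n + 1"]) auto
    next
      case 3
      then show ?thesis using s_right[of "2 * n + 2 - v"] v n by (intro bexI[of _ "2 * n + 2 - v"]) auto
    next
      case 4
      then show ?thesis using s_left[of "2 * n + 3 - v"] v n by (intro bexI[of _ "2 * n + 3 - v"]) auto
    qed
  qed
  have s_one: "\<sigma> 1 = n + 1"
  proof (rule ccontr)
    assume ne: "\<sigma> 1 \<noteq> n + 1"
    have one: "1 \<in> {1..N}" using N by simp
    obtain m where "m \<in> {2..N}" "\<sigma> m = \<sigma> 1" using pre[OF sig[OF one] ne] by blast
    then show False using sig_eq[of m 1] one by auto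
  qed
  consider "i = 1" | "2 \<le> i" "i \<le> n" | "i = n + 1" | "i = n + 2" | "n + 3 \<le> i" using i by fastforce
  then show ?thesis
  proof cases
    case 1 then show ?thesis using s_one by (simp add: stefan_def)
  next
    case 2 then show ?thesis using s_left[of i] by (simp add: stefan_def)
  next
    case 3 then show ?thesis using s_mid1 n by (simp add: stefan_def)
  next
    case 4 then show ?thesis using s_mid2 by (simp add: stefan_def)
  next
    case 5 then show ?thesis using s_right[of i] i by (simp add: stefan_def)
  qed
qed

end

end

section \<open>Points following primitive walks, and the periods 1 and 2\<close>

context cycle
begin

lemma interval_index_unique:
  assumes "y \<in> {x i..x (Suc i)}" "y \<in> {x j..x (Suc j)}" "y \<notin> x ` {1..N}"
    and ij: "i \<in> {1..<N}" "j \<in> {1..<N}"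
  shows "i = j"
proof (rule ccontr)
  assume "i \<noteq> j"
  then consider "Suc i \<le> j" | "Suc j \<le> i" by linarith
  then have "y = x j \<or> y = x i"
  proof cases
    case 1
    then have "x (Suc i) \<le> x j" using x_le[of "Suc i" j] ij by auto
    then show ?thesis using assms(1,2) by auto
  next
    case 2
    then have "x (Suc j) \<le> x i" using x_le[of "Suc j" i] ij by auto
    then show ?thesis using assms(1,2) by auto
  qed
  moreover have "x i \<in> x ` {1..N}" "x j \<in> x ` {1..N}" using ij by auto
  ultimately show False using assms(3) by auto
qed

lemma endpoint_index:
  assumes "x k \<in> {x i..x (Suc i)}" "i \<in> {1..<N}" "k \<in> {1..N}"
  shows "k = i \<or> k = Suc i"
proof (rule ccontr)
  assume "\<not> (k = i \<or> k = Suc i)"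
  then consider "k < i" | "Suc i < k" by linarith
  then show False
    using mono[of k i] mono[of "Suc i" k] assms by cases auto
qed

lemma periodic_orbit_in_cycle:
  assumes "(f ^^ m) z = z" "0 < m" "(f ^^ l) z \<in> x ` {1..N}"
  shows "z \<in> x ` {1..N}"
proof -
  obtain k where k: "k \<in> {1..N}" "(f ^^ l) z = x k" using assms(3) by blast
  have "m * l - l + l = m * l" using assms(2) by (cases m) auto
  then have "(f ^^ (m * l - l)) ((f ^^ l) z) = (f ^^ (m * l)) z"
    using fun_cong[OF funpow_add[of "m * l - l" l f], of z] by simp
  also have "\<dots> = z" by (rule funpow_mult_fix[OF assms(1)])
  finally show ?thesis using iter[OF k(1), of "m * l - l"] k(2) by (metis imageI)
qed

text \<open>An endpoint of an interval is mapped to an extreme point of the image hull, so a point of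
  the cycle can follow only one walk; the extreme point \<open>x N\<close> belongs to a single interval, hence
  that walk has period \<open>N\<close>.\<close>

lemma walk_on_cycle_period:
  assumes w: "\<And>l. G (w l) (w (Suc l))" and per_w: "\<And>l. w (l + m) = w l"
    and i: "i \<in> {1..N}" and it: "\<And>l. (f ^^ l) (x i) \<in> {x (w l)..x (Suc (w l))}" and m: "0 < m"
  shows "w (l + N) = w l"
proof -
  define k where "k l = (\<sigma> ^^ l) i" for l
  have kN: "k l \<in> {1..N}" and kx: "(f ^^ l) (x i) = x (k l)" for l
    using iter[OF i, of l] by (auto simp: k_def)
  have wN: "w l \<in> {1..<N}" for l using w[of l] by (auto simp: G_def)
  have kw: "k l = w l \<or> k l = Suc (w l)" for l
    using endpoint_index[OF _ wN kN] it[of l] kx[of l] by auto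
  have kS: "k (Suc l) = \<sigma> (k l)" for l by (simp add: k_def)
  have det: "w (Suc l) = (if \<sigma> (k l) \<le> \<sigma> (w l) \<and> \<sigma> (k l) \<le> \<sigma> (Suc (w l)) then \<sigma> (k l) else \<sigma> (k l) - 1)" for l
  proof -
    have cv: "covers \<sigma> (w l) (w (Suc l))" using w[of l] by (simp add: G_def)
    have "\<sigma> (k l) = w (Suc l) \<or> \<sigma> (k l) = Suc (w (Suc l))" using kw[of "Suc l"] kS by simp
    then show ?thesis using cv kw[of l] unfolding covers_def by (elim disjE) auto
  qed
  have per_w': "w (l + m * q) = w l" for l q
  proof (induction q)
    case (Suc q)
    then show ?case using per_w[of "l + m * q"] by (simp add: algebra_simps)
  qed simp
  have NN: "N \<in> {1..N}" using N by simp
  obtain l1 where "(f ^^ l1) (x i) = x N" using orb[OF i NN] by blast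
  then have l1: "k l1 = N" using kx[of l1] x_eq[OF kN NN] by simp
  have kper: "k (l + N) = k l" for l
  proof -
    have "(\<sigma> ^^ N) i = i" using minper_fix[OF minper_sig[OF i]] by simp
    then show ?thesis by (simp add: k_def funpow_add)
  qed
  have eq: "w (l1 + d + N) = w (l1 + d)" for d
  proof (induction d)
    case 0
    have "k (l1 + N) = N" using kper l1 by simp
    then show ?case using kw[of l1] kw[of "l1 + N"] wN[of l1] wN[of "l1 + N"] l1 by auto
  next
    case (Suc d)
    have "w (Suc (l1 + d + N)) = w (Suc (l1 + d))"
      unfolding det Suc kper ..
    then show ?case by simp
  qed
  \<comment> \<open>Adding \<open>m * l1\<close> moves \<open>l\<close> past the anchoring time
    \<open>l1\<close> without changing the walk.\<close>
  have "w (l + N) = w (l + N + m * l1)" using per_w' by simp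
  also have "l + N + m * l1 = l1 + (l + m * l1 - l1) + N" using m by (cases m) auto
  also have "w \<dots> = w (l1 + (l + m * l1 - l1))" by (rule eq)
  also have "l1 + (l + m * l1 - l1) = l + m * l1" using m by (cases m) auto
  also have "w \<dots> = w l" by (rule per_w')
  finally show ?thesis .
qed

text \<open>If the point were on the cycle, \<open>N\<close> would divide \<open>m\<close>, and
  \<open>m\<close> would divide \<open>N\<close> because the walk would repeat after
  \<open>N\<close> steps; this contradicts \<open>m \<noteq> N\<close>. Off the cycle every iterate
  lies in only one interval, so each period of the point is a period of the walk.\<close>

lemma primitive_walk_point:
  assumes w: "\<And>l. G (w l) (w (Suc l))" and prim: "minper shift m w" and m: "m \<noteq> N"
  shows "\<exists>z. min_period_pt f {a..b} m z \<and>
    (\<forall>l. (f ^^ l) z \<in> {x (w l)..x (Suc (w l))} \<and> (f ^^ l) z \<notin> x ` {1..N})"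
proof -
  have m0: "0 < m" using minper_pos[OF prim] .
  have "(shift ^^ m) w = w" using minper_fix[OF prim] by simp
  then have per_w: "w (l + m) = w l" for l by (auto simp: shift_funpow dest: fun_cong)
  obtain z where z: "z \<in> {a..b}" "(f ^^ m) z = z" "\<And>l. l \<le> m \<Longrightarrow> (f ^^ l) z \<in> {x (w l)..x (Suc (w l))}"
    using loop_point[of m w] w m0 per_w[of 0] by auto
  have it: "(f ^^ l) z \<in> {x (w l)..x (Suc (w l))}" for l
  proof (induction l rule: less_induct)
    case (less l)
    show ?case
    proof (cases "l \<le> m")
      case True
      then show ?thesis by (rule z(3))
    next
      case False
      then have "(f ^^ l) z = (f ^^ (l - m)) z"
        using fun_cong[OF funpow_add[of "l - m" m f], of z] z(2) by simp
      moreover have "w l = w (l - m)" using per_w[of "l - m"] False by simp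
      ultimately show ?thesis using less[of "l - m"] False m0 by simp
    qed
  qed
  have wN: "w l \<in> {1..<N}" for l using w[of l] by (auto simp: G_def)
  have "z \<notin> x ` {1..N}"
  proof
    assume "z \<in> x ` {1..N}"
    then obtain i where i: "i \<in> {1..N}" "z = x i" by blast
    have "w (l + N) = w l" for l
      using walk_on_cycle_period[OF w per_w i(1) _ m0] it i(2) by blast
    then have "(shift ^^ N) w = w" by (simp add: shift_funpow)
    then have "m dvd N" using minper_fix[OF prim] by simp
    moreover have "N dvd m" using minper_fix[OF per[OF i(1)]] z(2) i(2) by simp
    ultimately show False using m by (simp add: dvd_antisym)
  qed
  then have nP: "(f ^^ l) z \<notin> x ` {1..N}" for l
    using periodic_orbit_in_cycle[OF z(2) m0] by blast
  obtain d where d: "d dvd m" "minper f d z" using minper_exists[OF z(2) m0] by blast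
  have fd: "(f ^^ d) z = z" using minper_fix[OF d(2)] by simp
  have "w (l + d) = w l" for l
  proof (rule interval_index_unique[OF _ it nP wN wN])
    have "(f ^^ (l + d)) z = (f ^^ l) z" by (simp add: funpow_add fd)
    then show "(f ^^ l) z \<in> {x (w (l + d))..x (Suc (w (l + d)))}" using it[of "l + d"] by simp
  qed
  then have "(shift ^^ d) w = w" by (simp add: shift_funpow)
  then have "m dvd d" using minper_fix[OF prim] by simp
  then have "d = m" using d(1) by (simp add: dvd_antisym)
  then show ?thesis using d(2) z(1) it nP by (auto simp: min_period_pt_iff)
qed

text \<open>Off the cycle a point determines its walk, hence distinct walks give distinct points.
  Their position in the hull of the cycle is recorded because it later separates the points of the
  two halves.\<close>

lemma primitive_walk_points:
  assumes n: "1 \<le> n" "N = 2 * n + 1" and st: "\<And>i. i \<in> {1..N} \<Longrightarrow> \<sigma> i = stefan n i"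
    and m: "m \<noteq> N"
  shows "\<exists>X. finite X \<and> card X = card {w \<in> walks n. minper shift m w} \<and>
    (\<forall>y\<in>X. min_period_pt f {a..b} m y \<and> y \<in> {x 1..x N})"
proof (cases "m = 0")
  case True
  then show ?thesis by (intro exI[of _ "{}"]) (auto simp: minper_def)
next
  case False
  let ?P = "{w \<in> walks n. minper shift m w}"
  have G: "G (w l) (w (Suc l))" if "w \<in> ?P" for w l
  proof -
    have "w l \<in> {1..2 * n}" "w (Suc l) \<in> {1..2 * n}" "covers (stefan n) (w l) (w (Suc l))"
      using that unfolding walks_def by blast+
    then show ?thesis unfolding G_def using st[of "w l"] st[of "Suc (w l)"] n by (auto simp: covers_def)
  qed
  define Q where "Q w z \<longleftrightarrow> min_period_pt f {a..b} m z \<and>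
    (\<forall>l. (f ^^ l) z \<in> {x (w l)..x (Suc (w l))} \<and> (f ^^ l) z \<notin> x ` {1..N})" for w z
  have "\<exists>z. Q w z" if "w \<in> ?P" for w
    unfolding Q_def using primitive_walk_point[of w m] G[OF that] that m by blast
  then obtain Z where "\<And>w. w \<in> ?P \<Longrightarrow> Q w (Z w)" by metis
  then have Z: "\<And>w. w \<in> ?P \<Longrightarrow> min_period_pt f {a..b} m (Z w)"
      "\<And>w l. w \<in> ?P \<Longrightarrow> (f ^^ l) (Z w) \<in> {x (w l)..x (Suc (w l))}"
      "\<And>w l. w \<in> ?P \<Longrightarrow> (f ^^ l) (Z w) \<notin> x ` {1..N}" unfolding Q_def by blast+
  have "inj_on Z ?P"
  proof (rule inj_onI)
    fix v w assume v: "v \<in> ?P" and w: "w \<in> ?P" and eq: "Z v = Z w"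
    have "v l = w l" for l
    proof (rule interval_index_unique[OF Z(2)[OF v] _ Z(3)[OF v]])
      show "(f ^^ l) (Z v) \<in> {x (w l)..x (Suc (w l))}" unfolding eq by (rule Z(2)[OF w])
      show "v l \<in> {1..<N}" "w l \<in> {1..<N}" using G[OF v, of l] G[OF w, of l] by (auto simp: G_def)
    qed
    then show "v = w" by blast
  qed
  moreover have "Z w \<in> {x 1..x N}" if "w \<in> ?P" for w
  proof -
    have "w 0 \<in> {1..<N}" using G[OF that, of 0] by (auto simp: G_def)
    then have "x 1 \<le> x (w 0)" "x (Suc (w 0)) \<le> x N" using x_le by auto
    then show ?thesis using Z(2)[OF that, of 0] by auto
  qed
  moreover have "finite ?P" using card_primitive_walks(1)[OF n(1), of m] False by simp
  ultimately show ?thesis using Z(1) by (intro exI[of _ "Z ` ?P"]) (auto simp: card_image)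
qed

text \<open>The hull of each half contains the preimages of the extreme points of the other half and
  so covers its hull. A point following the resulting loop of length two is not fixed, the hulls
  being disjoint.\<close>

lemma swapped_halves_period_two:
  assumes c: "c \<in> {1..<N}" and swap: "\<And>i. i \<in> {1..N} \<Longrightarrow> i \<le> c \<longleftrightarrow> c < \<sigma> i"
  shows "\<exists>y. min_period_pt f {a..b} 2 y"
proof -
  have "inj_on \<sigma> {1..N}" using sig_eq by (auto intro!: inj_onI)
  then have surj: "\<sigma> ` {1..N} = {1..N}" using sig by (intro endo_inj_surj) auto
  have cover: "{x p..x q} \<subseteq> f ` {x p'..x q'}"
    if "\<And>i. i \<in> {1..N} \<Longrightarrow> \<sigma> i = p \<or> \<sigma> i = q \<Longrightarrow> p' \<le> i \<and> i \<le> q'"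
      "p \<in> {1..N}" "q \<in> {1..N}" "p' \<in> {1..N}" "q' \<in> {1..N}" for p q p' q'
  proof -
    have "\<exists>i\<in>{1..N}. \<sigma> i = p" "\<exists>i\<in>{1..N}. \<sigma> i = q" using surj that by (metis imageE)+
    then obtain i j where ij: "i \<in> {1..N}" "\<sigma> i = p" "j \<in> {1..N}" "\<sigma> j = q" by blast
    have "{x p'..x q'} \<subseteq> {a..b}" using xI that by fastforce
    then have "continuous_on {x p'..x q'} f" using continuous_on_subset[OF cont] by blast
    then have "connected (f ` {x p'..x q'})" by (intro connected_continuous_image) auto
    moreover have "x i \<in> {x p'..x q'}" "x j \<in> {x p'..x q'}"
      using that(1)[of i] that(1)[of j] ij that(4,5) x_le[of p' i] x_le[of i q'] x_le[of p' j] x_le[of j q'] by auto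
    then have "x p \<in> f ` {x p'..x q'}" "x q \<in> f ` {x p'..x q'}"
      using fx[OF ij(1)] fx[OF ij(3)] ij by (metis imageI)+
    ultimately show ?thesis by (rule connected_contains_Icc)
  qed
  define K where "K l = (if l = 1 then x (Suc c) else x 1)" for l :: nat
  define L where "L l = (if l = 1 then x N else x c)" for l :: nat
  have c': "1 \<in> {1..N}" "c \<in> {1..N}" "Suc c \<in> {1..N}" "N \<in> {1..N}" using c by auto
  have LR: "{x (Suc c)..x N} \<subseteq> f ` {x 1..x c}"
    by (rule cover) (use swap c c' in auto)
  have RL: "{x 1..x c} \<subseteq> f ` {x (Suc c)..x N}"
  proof (rule cover)
    fix i assume "i \<in> {1..N}" "\<sigma> i = 1 \<or> \<sigma> i = c"
    then show "Suc c \<le> i \<and> i \<le> N" using swap[of i] c by auto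
  qed (use c' in auto)
  have "\<exists>y. (f ^^ 2) y = y \<and> (\<forall>l\<le>2. (f ^^ l) y \<in> {K l..L l})"
  proof -
    have "K l \<le> L l \<and> {K l..L l} \<subseteq> {a..b}" for l
      using xI[OF c'(1)] xI[OF c'(2)] xI[OF c'(3)] xI[OF c'(4)] c x_le[of 1 c] x_le[of "Suc c" N]
      by (auto simp: K_def L_def)
    moreover have "{K (Suc l)..L (Suc l)} \<subseteq> f ` {K l..L l}" if "l < 2" for l
      using that LR RL by (cases "l = 0") (auto simp: K_def L_def)
    moreover have "K 2 = K 0" "L 2 = L 0" by (auto simp: K_def L_def)
    ultimately show ?thesis
      using interval_loop[OF cont self, of 2 K L] by metis
  qed
  then obtain y where y: "(f ^^ 2) y = y" "\<And>l. l \<le> 2 \<Longrightarrow> (f ^^ l) y \<in> {K l..L l}" by blast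
  have y0: "y \<in> {x 1..x c}" and y1: "f y \<in> {x (Suc c)..x N}"
    using y(2)[of 0] y(2)[of 1] by (auto simp: K_def L_def)
  have "x c < x (Suc c)" using mono[of c "Suc c"] c by auto
  then have "f y \<noteq> y" using y0 y1 by auto
  then have "minper f 2 y" using y(1) by (auto simp: minper_iff less_2_cases_iff)
  moreover have "y \<in> {a..b}" using y0 xI[OF c'(1)] xI[OF c'(2)] by auto
  ultimately show ?thesis by (auto simp: min_period_pt_iff)
qed

lemma fixed_point_exists: "\<exists>y. min_period_pt f {a..b} 1 y"
proof -
  obtain c where c: "c \<in> {1..<N}" "c < \<sigma> c" "\<sigma> (Suc c) \<le> c" using center_exists by blast
  have "G c c" using c by (auto simp: G_def covers_def)
  then obtain z where "z \<in> {a..b}" "(f ^^ 1) z = z"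
    using loop_point[OF less_one[THEN iffD2, OF refl], of "\<lambda>_. c"] by metis
  then show ?thesis by (intro exI[of _ z]) (auto simp: min_period_pt_iff minper_iff)
qed

end

lemma cycle_of_orbit:
  assumes cont: "continuous_on {a..b} f" and self: "f ` {a..b} \<subseteq> {a..b}"
    and z: "z \<in> {a..b}" "minper f N z" and N: "2 \<le> N"
  shows "\<exists>x \<sigma>. cycle f a b N x \<sigma> \<and> x ` {1..N} = orbit_of f N z"
proof -
  define P where "P = orbit_of f N z"
  have fin: "finite P" by (simp add: P_def orbit_of_eq)
  have card: "card P = N" using minper_inj_on[OF z(2)] by (simp add: P_def orbit_of_eq card_image)
  define xs where "xs = sorted_list_of_set P"
  have xs: "length xs = N" "set xs = P" "sorted_wrt (<) xs"
    using fin card by (auto simp: xs_def)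
  define x where "x i = xs ! (i - 1)" for i
  have mono: "x i < x j" if "1 \<le> i" "i < j" "j \<le> N" for i j
    using sorted_wrt_nth_less[OF xs(3), of "i - 1" "j - 1"] that xs(1) by (auto simp: x_def)
  have im: "x ` {1..N} = P"
  proof
    show "x ` {1..N} \<subseteq> P" using xs nth_mem[of _ xs] by (auto simp: x_def)
    show "P \<subseteq> x ` {1..N}"
    proof
      fix y assume "y \<in> P"
      then obtain i where i: "i < N" "xs ! i = y" using xs by (metis in_set_conv_nth)
      then show "y \<in> x ` {1..N}" by (intro image_eqI[of _ _ "Suc i"]) (auto simp: x_def)
    qed
  qed
  define \<sigma> where "\<sigma> i = inv_into {1..N} x (f (x i))" for i
  have Pz: "\<exists>l. y = (f ^^ l) z" if "y \<in> P" for y using that by (auto simp: P_def orbit_of_eq)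
  have xP: "x i \<in> P" if "i \<in> {1..N}" for i using im that by blast
  have fP: "(f ^^ l) y \<in> P" if yP: "y \<in> P" for l y
  proof -
    obtain j where "y = (f ^^ j) z" using Pz[OF yP] by blast
    then have "(f ^^ l) y = (f ^^ (l + j)) z" by (simp add: funpow_add)
    then show ?thesis using orbit_of_funpow[OF z(2)] by (simp add: P_def)
  qed
  have PI: "y \<in> {a..b}" if "y \<in> P" for y using Pz[OF that] self_funpow[OF self z(1)] by blast
  have Pper: "minper f N y" if "y \<in> P" for y using Pz[OF that] minper_funpow[OF z(2)] by blast
  have fxi: "f (x i) \<in> x ` {1..N}" if "i \<in> {1..N}" for i using fP[OF xP[OF that], of 1] im by simp
  have "cycle f a b N x \<sigma>"
  proof
    fix i assume i: "i \<in> {1..N}"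
    show "x i \<in> {a..b}" using PI xP i by blast
    show "\<sigma> i \<in> {1..N}" unfolding \<sigma>_def by (rule inv_into_into[OF fxi[OF i]])
    show "f (x i) = x (\<sigma> i)" unfolding \<sigma>_def using f_inv_into_f[OF fxi[OF i]] by simp
    show "minper f N (x i)" using Pper xP i by blast
    fix j assume j: "j \<in> {1..N}"
    have "orbit_of f N (x i) = P" using orbit_of_shift[OF z(2)] xP[OF i] by (simp add: P_def)
    then have "x j \<in> orbit_of f N (x i)" using xP[OF j] by simp
    then show "\<exists>l. (f ^^ l) (x i) = x j" by (auto simp: orbit_of_eq)
  qed (use cont self N mono in auto)
  then show ?thesis using im P_def by blast
qed

section \<open>Reflection of a cycle\<close>

lemma funpow_reflect:
  fixes f :: "real \<Rightarrow> real"
  shows "((\<lambda>y. - f (- y)) ^^ l) y = - (f ^^ l) (- y)"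
  by (induction l) auto

lemma minper_reflect:
  fixes f :: "real \<Rightarrow> real"
  shows "minper (\<lambda>y. - f (- y)) t y \<longleftrightarrow> minper f t (- y)"
proof -
  have "- (f ^^ m) (- y) = y \<longleftrightarrow> (f ^^ m) (- y) = - y" for m by auto
  then show ?thesis by (simp add: minper_def funpow_reflect)
qed

text \<open>Conjugation by negation moves the centre from \<open>c\<close> to \<open>N - c\<close>.
  For \<open>N = 2 * n + 1\<close> one of these two positions is at least \<open>n + 1\<close>, as
  \<open>stefan_structure\<close> requires.\<close>

lemma cycle_reflect:
  assumes "cycle f a b N x \<sigma>"
  shows "cycle (\<lambda>y. - f (- y)) (- b) (- a) N (\<lambda>i. - x (N + 1 - i)) (\<lambda>i. N + 1 - \<sigma> (N + 1 - i))"
proof -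
  interpret cycle f a b N x \<sigma> by fact
  have r: "N + 1 - i \<in> {1..N}" if "i \<in> {1..N}" for i using that by auto
  show ?thesis
  proof
    have "continuous_on {- b..- a} (\<lambda>y. f (- y))"
      by (rule continuous_on_compose2[OF cont]) (auto intro!: continuous_intros)
    then show "continuous_on {- b..- a} (\<lambda>y. - f (- y))" by (rule continuous_on_minus)
    show "(\<lambda>y. - f (- y)) ` {- b..- a} \<subseteq> {- b..- a}"
    proof
      fix v assume "v \<in> (\<lambda>y. - f (- y)) ` {- b..- a}"
      then obtain y where y: "y \<in> {- b..- a}" "v = - f (- y)" by blast
      have "f (- y) \<in> {a..b}" by (rule subsetD[OF self], rule imageI) (use y(1) in auto)
      then show "v \<in> {- b..- a}" using y(2) by auto
    qed
    show "2 \<le> N" by (rule N)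
    show "- x (N + 1 - i) < - x (N + 1 - j)" if "1 \<le> i" "i < j" "j \<le> N" for i j
      using mono[of "N + 1 - j" "N + 1 - i"] that by auto
    fix i assume i: "i \<in> {1..N}"
    show "- x (N + 1 - i) \<in> {- b..- a}" using xI[OF r[OF i]] by auto
    show "N + 1 - \<sigma> (N + 1 - i) \<in> {1..N}" using sig[OF r[OF i]] by auto
    have "N + 1 - (N + 1 - \<sigma> (N + 1 - i)) = \<sigma> (N + 1 - i)" using sig[OF r[OF i]] by auto
    then show "- f (- (- x (N + 1 - i))) = - x (N + 1 - (N + 1 - \<sigma> (N + 1 - i)))"
      using fx[OF r[OF i]] by simp
    show "minper (\<lambda>y. - f (- y)) N (- x (N + 1 - i))"
      using per[OF r[OF i]] by (simp add: minper_reflect)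
    fix j assume j: "j \<in> {1..N}"
    show "\<exists>l. ((\<lambda>y. - f (- y)) ^^ l) (- x (N + 1 - i)) = - x (N + 1 - j)"
      using orb[OF r[OF i] r[OF j]] by (simp add: funpow_reflect)
  qed
qed

lemma minimal_odd_cycle_points_aux:
  assumes cyc: "cycle f a b N x \<sigma>" and n: "1 \<le> n" "N = 2 * n + 1" and m: "m \<noteq> N"
    and c: "c \<in> {1..<N}" "c < \<sigma> c" "\<sigma> (Suc c) \<le> c" "n + 1 \<le> c"
    and nop: "\<And>d z. odd d \<Longrightarrow> 1 < d \<Longrightarrow> d < N \<Longrightarrow> \<not> min_period_pt f {a..b} d z"
  shows "\<exists>X. finite X \<and> card X = card {w \<in> walks n. minper shift m w} \<and>
    (\<forall>y\<in>X. min_period_pt f {a..b} m y \<and> y \<in> {x 1..x N})"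
  using cycle.primitive_walk_points[OF cyc n cycle.stefan_structure[OF cyc c(1-3) n c(4) nop] m] .

lemma minimal_odd_cycle_points:
  assumes cyc: "cycle f a b N x \<sigma>" and n: "1 \<le> n" "N = 2 * n + 1" and m: "m \<noteq> N"
    and nop: "\<And>d z. odd d \<Longrightarrow> 1 < d \<Longrightarrow> d < N \<Longrightarrow> \<not> min_period_pt f {a..b} d z"
  shows "\<exists>X. finite X \<and> card X = card {w \<in> walks n. minper shift m w} \<and>
    (\<forall>y\<in>X. min_period_pt f {a..b} m y \<and> y \<in> {x 1..x N})"
proof -
  obtain c where c: "c \<in> {1..<N}" "c < \<sigma> c" "\<sigma> (Suc c) \<le> c" using cycle.center_exists[OF cyc] by blast
  show ?thesis
  proof (cases "n + 1 \<le> c")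
    case True
    show ?thesis by (rule minimal_odd_cycle_points_aux[OF cyc n m c True nop])
  next
    case False
    define c' where "c' = N - c"
    have e: "N + 1 - c' = Suc c" "N + 1 - Suc c' = c" using c by (auto simp: c'_def)
    have s: "\<sigma> c \<le> N" using cycle.sig[OF cyc, of c] c by auto
    have mp: "min_period_pt (\<lambda>y. - f (- y)) {- b..- a} d y \<longleftrightarrow> min_period_pt f {a..b} d (- y)" for d y
      by (auto simp: min_period_pt_iff minper_reflect)
    have "\<exists>X. finite X \<and> card X = card {w \<in> walks n. minper shift m w} \<and>
      (\<forall>y\<in>X. min_period_pt (\<lambda>y. - f (- y)) {- b..- a} m y \<and>
        y \<in> {- x (N + 1 - 1)..- x (N + 1 - N)})"
    proof (rule minimal_odd_cycle_points_aux[OF cycle_reflect[OF cyc] n m, of c'])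
      show "c' \<in> {1..<N}" "n + 1 \<le> c'" using c False n by (auto simp: c'_def)
      show "c' < N + 1 - \<sigma> (N + 1 - c')" unfolding e using c by (auto simp: c'_def)
      show "N + 1 - \<sigma> (N + 1 - Suc c') \<le> c'" unfolding e using c by (auto simp: c'_def)
      show "\<not> min_period_pt (\<lambda>y. - f (- y)) {- b..- a} d z" if "odd d" "1 < d" "d < N" for d z
        unfolding mp by (rule nop[OF that])
    qed
    then obtain X where X: "finite X" "card X = card {w \<in> walks n. minper shift m w}"
        "\<And>y. y \<in> X \<Longrightarrow> min_period_pt f {a..b} m (- y) \<and> y \<in> {- x N..- x 1}"
      unfolding mp by auto
    have "\<forall>y\<in>uminus ` X. min_period_pt f {a..b} m y \<and> y \<in> {x 1..x N}"
      using X(3) by fastforce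
    moreover have "card (uminus ` X) = card X" by (simp add: card_image)
    ultimately show ?thesis using X(1,2) by (intro exI[of _ "uminus ` X"]) simp
  qed
qed

section \<open>The lower bound\<close>

text \<open>The periods preceding \<open>2 ^ k * (2 * n + 1)\<close> spelled out as products; in
  this form passing to \<open>f ^^ 2\<close> lowers \<open>k\<close> by one.\<close>

definition no_earlier_period :: "(real \<Rightarrow> real) \<Rightarrow> real set \<Rightarrow> nat \<Rightarrow> nat \<Rightarrow> bool" where
  "no_earlier_period f I n k \<longleftrightarrow> (\<forall>j q y. odd q \<and> 1 < q \<and> (j < k \<or> j = k \<and> q < 2 * n + 1) \<longrightarrow>
     \<not> min_period_pt f I (2 ^ j * q) y)"

lemma no_earlier_period_square:
  assumes "no_earlier_period f I n (Suc k)"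
  shows "no_earlier_period (f ^^ 2) I n k"
  unfolding no_earlier_period_def
proof (intro allI impI notI)
  fix j q y
  assume q: "odd q \<and> 1 < q \<and> (j < k \<or> j = k \<and> q < 2 * n + 1)"
    and "min_period_pt (f ^^ 2) I (2 ^ j * q) y"
  then have y: "y \<in> I" "minper (f ^^ 2) (2 ^ j * q) y" by (auto simp: min_period_pt_iff)
  from minper_square[OF y(2)] show False
  proof
    assume "minper f (2 * (2 ^ j * q)) y"
    then have "min_period_pt f I (2 ^ Suc j * q) y" using y(1) by (simp add: min_period_pt_iff mult.assoc)
    then show False
      using assms[unfolded no_earlier_period_def, rule_format, of q "Suc j" y] q by auto
  next
    assume "odd (2 ^ j * q) \<and> minper f (2 ^ j * q) y"
    then have "j = 0" "min_period_pt f I (2 ^ 0 * q) y" using y(1) by (auto simp: min_period_pt_iff)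
    then show False using assms q unfolding no_earlier_period_def by blast
  qed
qed

lemma no_odd_period:
  assumes "no_earlier_period f I n (Suc k)" "odd d" "1 < d"
  shows "\<not> min_period_pt f I d y"
  using assms(1)[unfolded no_earlier_period_def, rule_format, of d 0 y] assms(2,3) by simp

lemma funpow2_self: "f ` I \<subseteq> I \<Longrightarrow> (f ^^ 2) ` I \<subseteq> I"
  using self_funpow[of f I _ 2] by blast

text \<open>Each half of the cycle is a cycle of \<open>f ^^ 2\<close> with exponent lowered by one.
  The interval \<open>{lo..hi}\<close> around the cycle is threaded through the induction so that
  the points obtained from the two halves lie on different sides of the centre. For
  \<open>m = 1\<close> a fixed point of \<open>f ^^ 2\<close> might already be fixed by
  \<open>f\<close>, hence \<open>1 < m\<close>.\<close>

lemma many_periodic_points: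
  assumes n: "1 \<le> n" and m: "1 < m" "m \<noteq> 2 * n + 1"
  shows "continuous_on {a..b} f \<Longrightarrow> f ` {a..b} \<subseteq> {a..b} \<Longrightarrow> no_earlier_period f {a..b} n k \<Longrightarrow>
    z \<in> {a..b} \<Longrightarrow> minper f (2 ^ k * (2 * n + 1)) z \<Longrightarrow> (\<And>l. (f ^^ l) z \<in> {lo..hi}) \<Longrightarrow>
    \<exists>X. finite X \<and> int (card X) = 2 ^ k * PhiN n m \<and>
      (\<forall>y\<in>X. min_period_pt f {a..b} (2 ^ k * m) y \<and> y \<in> {lo..hi})"
proof (induction k arbitrary: f z lo hi)
  case 0
  define N where "N = 2 * n + 1"
  have "minper f N z" using 0 by (simp add: N_def)
  moreover have "2 \<le> N" using n by (simp add: N_def)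
  ultimately obtain x \<sigma> where cyc: "cycle f a b N x \<sigma>" and im: "x ` {1..N} = orbit_of f N z"
    using cycle_of_orbit[OF 0(1,2,4)] by blast
  have "\<exists>X. finite X \<and> card X = card {w \<in> walks n. minper shift m w} \<and>
    (\<forall>y\<in>X. min_period_pt f {a..b} m y \<and> y \<in> {x 1..x N})"
  proof (rule minimal_odd_cycle_points[OF cyc n N_def])
    show "m \<noteq> N" using m by (simp add: N_def)
    show "\<not> min_period_pt f {a..b} d z" if "odd d" "1 < d" "d < N" for d z
      using 0(3)[unfolded no_earlier_period_def, rule_format, of d 0 z] that by (simp add: N_def)
  qed
  then obtain X where X: "finite X" "card X = card {w \<in> walks n. minper shift m w}"
    "\<And>y. y \<in> X \<Longrightarrow> min_period_pt f {a..b} m y \<and> y \<in> {x 1..x N}" by blast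
  have "x 1 \<in> x ` {1..N}" "x N \<in> x ` {1..N}" using \<open>2 \<le> N\<close> by auto
  then have "x 1 \<in> {lo..hi}" "x N \<in> {lo..hi}" unfolding im orbit_of_eq using 0(6) by auto
  then have "\<forall>y\<in>X. min_period_pt f {a..b} (2 ^ 0 * m) y \<and> y \<in> {lo..hi}" using X(3) by fastforce
  moreover have "int (card X) = PhiN n m" using X(2) card_primitive_walks(2)[OF n, of m] m by simp
  ultimately show ?case using X(1) by (intro exI[of _ X]) simp
next
  case (Suc k)
  define H where "H = 2 ^ k * (2 * n + 1)"
  define N where "N = 2 * H"
  have H: "1 \<le> H" by (simp add: H_def Suc_le_eq)
  have zN: "minper f N z" using Suc.prems(5) by (simp add: N_def H_def mult.assoc)
  have N2: "2 \<le> N" using H by (simp add: N_def)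
  obtain x \<sigma> where cyc: "cycle f a b N x \<sigma>" and im: "x ` {1..N} = orbit_of f N z"
    using cycle_of_orbit[OF Suc.prems(1,2,4) zN N2] by blast
  interpret cycle f a b N x \<sigma> by (rule cyc)
  obtain c where c: "c \<in> {1..<N}" "c < \<sigma> c" "\<sigma> (Suc c) \<le> c" using center_exists by blast
  have swap: "i \<le> c \<longleftrightarrow> c < \<sigma> i" if "i \<in> {1..N}" for i
    by (rule division[OF c no_odd_period[OF Suc.prems(3)] that])
  have hull: "x i \<in> {lo..hi}" if "i \<in> {1..N}" for i
  proof -
    have "x i \<in> orbit_of f N z" using im that by blast
    then show ?thesis using Suc.prems(6) by (auto simp: orbit_of_eq)
  qed
  have cont2: "continuous_on {a..b} (f ^^ 2)" by (rule continuous_on_funpow[OF cont self])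
  have self2: "(f ^^ 2) ` {a..b} \<subseteq> {a..b}" by (rule funpow2_self[OF self])
  have nop2: "no_earlier_period (f ^^ 2) {a..b} n k" by (rule no_earlier_period_square[OF Suc.prems(3)])
  \<comment> \<open>Crossing the centre twice leads back to the same side.\<close>
  have same_side: "((\<sigma> ^^ (2 * l)) i \<le> c \<longleftrightarrow> i \<le> c)" if "i \<in> {1..N}" for i l
  proof (induction l)
    case (Suc l)
    let ?j = "(\<sigma> ^^ (2 * l)) i"
    have j: "?j \<in> {1..N}" using iter[OF that] by blast
    have "(\<sigma> ^^ (2 * Suc l)) i = \<sigma> (\<sigma> ?j)" by simp
    then show ?case using swap[OF j] swap[OF sig[OF j]] Suc by auto
  qed simp
  have half: "\<exists>X. finite X \<and> int (card X) = 2 ^ k * PhiN n m \<and>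
      (\<forall>y\<in>X. min_period_pt (f ^^ 2) {a..b} (2 ^ k * m) y \<and> y \<in> {p..q})"
    if i: "i \<in> {1..N}" and pq: "\<And>j. j \<in> {1..N} \<Longrightarrow> (j \<le> c \<longleftrightarrow> i \<le> c) \<Longrightarrow> x j \<in> {p..q}" for i p q
  proof (rule Suc.IH[OF cont2 self2 nop2 xI[OF i]])
    show "minper (f ^^ 2) (2 ^ k * (2 * n + 1)) (x i)"
      using minper_square_half[of f H "x i"] per[OF i] by (simp add: N_def H_def)
    show "((f ^^ 2) ^^ l) (x i) \<in> {p..q}" for l
      using iter[OF i, of "2 * l"] pq[OF _ same_side[OF i, of l]] by (simp add: funpow_square)
  qed
  have one: "1 \<in> {1..N}" and NN: "N \<in> {1..N}" using N2 by auto
  have "x j \<in> {lo..x c}" if "j \<in> {1..N}" "j \<le> c \<longleftrightarrow> 1 \<le> c" for j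
    using that hull[of j] x_le[of j c] c by auto
  from half[OF one this] obtain X where X: "finite X" "int (card X) = 2 ^ k * PhiN n m"
      "\<And>y. y \<in> X \<Longrightarrow> min_period_pt (f ^^ 2) {a..b} (2 ^ k * m) y \<and> y \<in> {lo..x c}" by blast
  have "x j \<in> {x (Suc c)..hi}" if "j \<in> {1..N}" "j \<le> c \<longleftrightarrow> N \<le> c" for j
    using that hull[of j] x_le[of "Suc c" j] c by auto
  from half[OF NN this] obtain Y where Y: "finite Y" "int (card Y) = 2 ^ k * PhiN n m"
      "\<And>y. y \<in> Y \<Longrightarrow> min_period_pt (f ^^ 2) {a..b} (2 ^ k * m) y \<and> y \<in> {x (Suc c)..hi}" by blast
  have lt: "x c < x (Suc c)" using mono[of c "Suc c"] c by auto
  have disj: "X \<inter> Y = {}" using X(3) Y(3) lt by fastforce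
  have "x c \<in> {lo..hi}" "x (Suc c) \<in> {lo..hi}" using hull c by auto
  then have inh: "y \<in> {lo..hi}" if "y \<in> X \<union> Y" for y using that X(3)[of y] Y(3)[of y] by auto
  have "min_period_pt f {a..b} (2 ^ Suc k * m) y" if "y \<in> X \<union> Y" for y
  proof -
    have y: "y \<in> {a..b}" "minper (f ^^ 2) (2 ^ k * m) y"
      using that X(3)[of y] Y(3)[of y] by (auto simp: min_period_pt_iff)
    \<comment> \<open>If \<open>2 ^ k * m\<close> is odd it is an odd period above 1, which is
      excluded; hence the period under \<open>f\<close> is twice that under
      \<open>f ^^ 2\<close>.\<close>
    have "\<not> (odd (2 ^ k * m) \<and> minper f (2 ^ k * m) y)"
      using no_odd_period[OF Suc.prems(3), of "2 ^ k * m" y] y(1) m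
      by (auto simp: min_period_pt_iff)
    then have "minper f (2 * (2 ^ k * m)) y" using minper_square[OF y(2)] by blast
    then show ?thesis using y(1) by (simp add: min_period_pt_iff mult.assoc)
  qed
  moreover have "int (card (X \<union> Y)) = 2 ^ Suc k * PhiN n m"
    using X Y disj by (simp add: card_Un_disjoint)
  ultimately show ?case using X(1) Y(1) inh by (intro exI[of _ "X \<union> Y"]) auto
qed

text \<open>This is the case \<open>m = 1\<close>. For \<open>k = 1\<close> the exchanged halves
  supply a point that is not fixed; from \<open>k = 2\<close> on, an even period under the square is
  doubled under \<open>f\<close>.\<close>

lemma power_of_two_period:
  assumes n: "1 \<le> n"
  shows "continuous_on {a..b} f \<Longrightarrow> f ` {a..b} \<subseteq> {a..b} \<Longrightarrow> no_earlier_period f {a..b} n k \<Longrightarrow>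
    z \<in> {a..b} \<Longrightarrow> minper f (2 ^ k * (2 * n + 1)) z \<Longrightarrow> \<exists>y. min_period_pt f {a..b} (2 ^ k) y"
proof (induction k arbitrary: f)
  case 0
  have "2 \<le> 2 ^ 0 * (2 * n + 1)" using n by simp
  then obtain x \<sigma> where "cycle f a b (2 ^ 0 * (2 * n + 1)) x \<sigma>"
    using cycle_of_orbit[OF 0(1,2,4,5)] by blast
  then show ?case using cycle.fixed_point_exists by fastforce
next
  case (Suc k)
  show ?case
  proof (cases "k = 0")
    case True
    let ?N = "2 ^ Suc k * (2 * n + 1)"
    have "2 \<le> ?N" using True by simp
    then obtain x \<sigma> where cyc: "cycle f a b ?N x \<sigma>"
      using cycle_of_orbit[OF Suc.prems(1,2,4,5)] by blast
    interpret cycle f a b ?N x \<sigma> by (rule cyc)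
    obtain c where c: "c \<in> {1..<?N}" "c < \<sigma> c" "\<sigma> (Suc c) \<le> c" using center_exists by blast
    have "i \<le> c \<longleftrightarrow> c < \<sigma> i" if "i \<in> {1..?N}" for i
      by (rule division[OF c no_odd_period[OF Suc.prems(3)] that])
    from swapped_halves_period_two[OF c(1) this] show ?thesis using True by simp
  next
    case False
    have "minper f (2 * (2 ^ k * (2 * n + 1))) z" using Suc.prems(5) by (simp add: mult.assoc)
    from Suc.IH[OF continuous_on_funpow[OF Suc.prems(1,2)] funpow2_self[OF Suc.prems(2)]
        no_earlier_period_square[OF Suc.prems(3)] Suc.prems(4) minper_square_half[OF this]]
    obtain y where y: "y \<in> {a..b}" "minper (f ^^ 2) (2 ^ k) y" by (auto simp: min_period_pt_iff)
    then have "minper f (2 * 2 ^ k) y" using minper_square[OF y(2)] False by auto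
    then show ?thesis using y(1) by (auto simp: min_period_pt_iff)
  qed
qed

text \<open>The graph has a single loop of length one, at \<open>n + 1\<close>, so its matrix has
  trace 1.\<close>

lemma PhiN_1:
  assumes "1 \<le> n"
  shows "PhiN n 1 = 1"
proof -
  have "card (paths n (Suc 0) i i) = (if i = n + 1 then 1 else 0)" if i: "i \<in> {1..2 * n}" for i
  proof -
    have "card (paths n (Suc 0) i i)
        = (\<Sum>l \<in> {l \<in> {1..2 * n}. covers (stefan n) l i}. if l = i then 1 else 0)"
      unfolding card_paths_Suc by (intro sum.cong) auto
    also have "\<dots> = (if i \<in> {l \<in> {1..2 * n}. covers (stefan n) l i} then 1 else 0)" by simp
    also have "\<dots> = (if i = n + 1 then 1 else 0)"
      unfolding predecessors[OF assms i] using i by auto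
    finally show ?thesis .
  qed
  then have "(\<Sum>i \<in> {1..2 * n}. int (card (paths n 1 i i))) = (\<Sum>i \<in> {1..2 * n}. if i = n + 1 then 1 else 0)"
    by (intro sum.cong) auto
  also have "\<dots> = 1" using assms by simp
  finally have "phi_seq n 1 = 1" using sum_card_paths_eq_phi_seq[OF assms, of 1] by simp
  then show ?thesis by (simp add: PhiN_def PhiSum_def moebius_mu_def)
qed

lemma orbits_lower_bound:
  assumes n: "1 \<le> n" and m: "0 < m" "m \<noteq> 2 * n + 1"
    and cont: "continuous_on {a..b} f" and self: "f ` {a..b} \<subseteq> {a..b}"
    and nop: "no_earlier_period f {a..b} n k"
    and z: "min_period_pt f {a..b} (2 ^ k * (2 * n + 1)) z"
    and fin: "finite (orbits_of_period f {a..b} (2 ^ k * m))"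
  shows "PhiN n m \<le> int (m * card (orbits_of_period f {a..b} (2 ^ k * m)))"
proof -
  let ?O = "orbits_of_period f {a..b} (2 ^ k * m)"
  have z': "z \<in> {a..b}" "minper f (2 ^ k * (2 * n + 1)) z" using z by (auto simp: min_period_pt_iff)
  show ?thesis
  proof (cases "m = 1")
    case True
    obtain y where "min_period_pt f {a..b} (2 ^ k) y"
      using power_of_two_period[OF n cont self nop z'] by blast
    then have "?O \<noteq> {}" using True by (auto simp: orbits_of_period_def)
    then have "0 < card ?O" using fin by (simp add: card_gt_0_iff)
    then show ?thesis using True PhiN_1[OF n] by simp
  next
    case False
    then have "1 < m" using m by simp
    from many_periodic_points[OF n this m(2) cont self nop z' self_funpow[OF self z'(1)]]
    obtain X where X: "finite X" "int (card X) = 2 ^ k * PhiN n m"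
      "\<And>y. y \<in> X \<Longrightarrow> min_period_pt f {a..b} (2 ^ k * m) y" by blast
    have "card X \<le> card {y. min_period_pt f {a..b} (2 ^ k * m) y}"
      using X(3) card_points_eq_card_orbits(1)[OF self fin] by (intro card_mono) auto
    also have "\<dots> = 2 ^ k * m * card ?O" by (rule card_points_eq_card_orbits(2)[OF self fin])
    finally have "int (card X) \<le> int (2 ^ k * m * card ?O)" by (simp only: of_nat_le_iff)
    then have "2 ^ k * PhiN n m \<le> 2 ^ k * int (m * card ?O)" using X(2) by simp
    then show ?thesis by simp
  qed
qed

section \<open>The Sharkovskii order through powers of two and odd parts\<close>

lemma two_exp_eq: "odd q \<Longrightarrow> two_exp (2 ^ j * q) = j"
  unfolding two_exp_def by (rule multiplicity_eqI) auto

lemma odd_part_eq: "odd q \<Longrightarrow> odd_part (2 ^ j * q) = q"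
  by (simp add: odd_part_def two_exp_eq)

lemma odd_decomposition:
  fixes r :: nat
  assumes "0 < r"
  obtains j q where "odd q" "r = 2 ^ j * q"
proof -
  obtain q where "r = 2 ^ multiplicity 2 r * q" "\<not> 2 dvd q"
    using multiplicity_decompose'[of r 2] assms by auto
  then show ?thesis using that by blast
qed

lemma sh_prec_iff:
  assumes "1 \<le> n"
  shows "sh_prec r (2 ^ k * (2 * n + 1)) \<longleftrightarrow>
    (\<exists>j q. r = 2 ^ j * q \<and> odd q \<and> 1 < q \<and> (j < k \<or> j = k \<and> q < 2 * n + 1))"
proof -
  have o: "two_exp (2 ^ k * (2 * n + 1)) = k" "odd_part (2 ^ k * (2 * n + 1)) = 2 * n + 1"
    using two_exp_eq[of "2 * n + 1" k] odd_part_eq[of "2 * n + 1" k] by simp_all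
  show ?thesis
  proof
    assume *: "sh_prec r (2 ^ k * (2 * n + 1))"
    then have "0 < r" by (simp add: sh_prec_def)
    then obtain j q where jq: "odd q" "r = 2 ^ j * q" by (rule odd_decomposition)
    then have "two_exp r = j" "odd_part r = q" using two_exp_eq odd_part_eq by auto
    then show "\<exists>j q. r = 2 ^ j * q \<and> odd q \<and> 1 < q \<and> (j < k \<or> j = k \<and> q < 2 * n + 1)"
      using * jq o assms unfolding sh_prec_def by (intro exI[of _ j] exI[of _ q]) (auto split: if_splits)
  next
    assume "\<exists>j q. r = 2 ^ j * q \<and> odd q \<and> 1 < q \<and> (j < k \<or> j = k \<and> q < 2 * n + 1)"
    then obtain j q where jq: "r = 2 ^ j * q" "odd q" "1 < q" "j < k \<or> j = k \<and> q < 2 * n + 1" by blast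
    then have "two_exp r = j" "odd_part r = q" using two_exp_eq odd_part_eq by auto
    then show "sh_prec r (2 ^ k * (2 * n + 1))"
      using jq o unfolding sh_prec_def by auto
  qed
qed

lemma sh_hyp_iff:
  assumes "1 \<le> n"
  shows "sh_hyp f a b (2 ^ k * (2 * n + 1)) \<longleftrightarrow> a \<le> b \<and> continuous_on {a..b} f \<and> f ` {a..b} \<subseteq> {a..b} \<and>
    (\<exists>z. min_period_pt f {a..b} (2 ^ k * (2 * n + 1)) z) \<and> no_earlier_period f {a..b} n k"
  unfolding sh_hyp_def sh_prec_iff[OF assms] no_earlier_period_def by blast

section \<open>The piecewise linear Stefan map\<close>

lemma stefan_edge:
  assumes "1 \<le> n" "i \<in> {1..2 * n}" "j \<in> {1..2 * n}" "covers (stefan n) i j"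
  shows "i = 1 \<and> n + 1 \<le> j \<or> 2 \<le> i \<and> i \<le> n \<and> j = 2 * n + 2 - i \<or>
    i = n + 1 \<and> (j = n \<or> j = n + 1) \<or> n + 2 \<le> i \<and> j = 2 * n + 1 - i"
proof -
  have "i \<in> {l \<in> {1..2 * n}. covers (stefan n) l j}" using assms by simp
  then show ?thesis
    unfolding predecessors[OF assms(1,3)] using assms(1-3) by (auto split: if_splits)
qed

lemma walksD:
  assumes "w \<in> walks n"
  shows "w l \<in> {1..2 * n}" "covers (stefan n) (w l) (w (Suc l))"
  using assms unfolding walks_def by blast+

text \<open>A walk avoiding the named intervals runs along the sequence \<open>n\<close>,
  \<open>n + 2\<close>, \<open>n - 1\<close>, \<open>n + 3\<close>, ..., 1, and \<open>h\<close>
  drops by one at each step, which cannot go on forever. For \<open>n = 1\<close> the slope on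
  interval 1 is only 1, so that interval counts only if \<open>2 \<le> n\<close>.\<close>

lemma walk_expands:
  assumes n: "1 \<le> n" and w: "w \<in> walks n"
  shows "\<exists>l. w l = n + 1 \<or> w l = 1 \<and> 2 \<le> n"
proof (rule ccontr)
  assume no: "\<nexists>l. w l = n + 1 \<or> w l = 1 \<and> 2 \<le> n"
  note edge = stefan_edge[OF n walksD(1)[OF w] walksD(1)[OF w] walksD(2)[OF w]]
  define h where "h i = (if i \<le> n then 2 * i else 2 * (2 * n + 1 - i) + 1)" for i
  have dec: "h (w (Suc l)) + 1 = h (w l)" for l
  proof -
    have "w l \<noteq> n + 1" "w (Suc l) \<noteq> n + 1" "w l = 1 \<Longrightarrow> n = 1" using no n by force+
    then show ?thesis
      using edge[of l] walksD(1)[OF w, of l] walksD(1)[OF w, of "Suc l"] by (auto simp: h_def)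
  qed
  have "h (w l) + l = h (w 0)" for l
  proof (induction l)
    case (Suc l)
    then show ?case using dec[of l] by simp
  qed simp
  from this[of "Suc (h (w 0))"] show False by simp
qed

text \<open>Without interval \<open>n + 1\<close> the graph is bipartite, with \<open>n\<close>
  separating the sides, so an odd closed walk visits \<open>n + 1\<close>. If it ever leaves, the
  next \<open>2 * n - 1\<close> steps are forced through other intervals; \<open>r\<close> odd and
  below \<open>2 * n + 1\<close> would require a return within them.\<close>

lemma odd_primitive_walk:
  assumes n: "1 \<le> n" and w: "w \<in> walks n" and r: "minper shift r w" "odd r" "r < 2 * n + 1"
  shows "r = 1"
proof -
  note edge = stefan_edge[OF n walksD(1)[OF w] walksD(1)[OF w] walksD(2)[OF w]]
  have wr: "w l \<in> {1..2 * n}" for l by (rule walksD(1)[OF w])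
  have "(shift ^^ r) w = w" using minper_fix[OF r(1)] by simp
  then have per: "w (l + r) = w l" for l by (auto simp: shift_funpow dest: fun_cong)
  have "\<exists>l. w l = n + 1"
  proof (rule ccontr)
    assume no: "\<nexists>l. w l = n + 1"
    have alt: "w (Suc l) \<le> n \<longleftrightarrow> \<not> w l \<le> n" for l
    proof -
      have "w l \<noteq> n + 1" using no by blast
      then show ?thesis using edge[of l] wr[of l] wr[of "Suc l"] n by auto
    qed
    have "w l \<le> n \<longleftrightarrow> (even l \<longleftrightarrow> w 0 \<le> n)" for l
      by (induction l) (use alt in auto)
    from this[of r] show False using per[of 0] r(2) by simp
  qed
  then obtain l1 where l1: "w l1 = n + 1" by blast
  have stay: "w (Suc l) = n + 1" if l: "w l = n + 1" for l
  proof (rule ccontr)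
    assume "w (Suc l) \<noteq> n + 1"
    then have s: "w (Suc l) = n" using edge[of l] l n by auto
    have down: "w (Suc l + 2 * i) = n - i" if "i < n" for i
      using that
    proof (induction i)
      case (Suc i)
      then have IH: "w (Suc l + 2 * i) = n - i" by simp
      have a: "w (Suc (Suc l + 2 * i)) = n + 2 + i"
        using edge[of "Suc l + 2 * i"] IH Suc.prems by auto
      have "w (Suc (Suc (Suc l + 2 * i))) = n - Suc i"
        using edge[of "Suc (Suc l + 2 * i)"] a Suc.prems by auto
      then show ?case by simp
    qed (simp add: s)
    obtain i where i: "r = 2 * i + 1" using r(2) by (elim oddE)
    have "w (Suc l + 2 * i) = n - i" using down[of i] i r(3) by simp
    moreover have "w (Suc l + 2 * i) = n + 1" using per[of l] l i by simp
    ultimately show False by simp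
  qed
  have const: "w (l1 + d) = n + 1" for d
    by (induction d) (use l1 stay in auto)
  have per': "w (l + r * q) = w l" for l q
  proof (induction q)
    case (Suc q)
    then show ?case using per[of "l + r * q"] by (simp add: algebra_simps)
  qed simp
  have "w l = n + 1" for l
  proof -
    have "w l = w (l + r * l1)" using per' by simp
    also have "l + r * l1 = l1 + (l + r * l1 - l1)" using minper_pos[OF r(1)] by (cases r) auto
    finally show ?thesis using const by simp
  qed
  then have "(shift ^^ 1) w = w" unfolding shift_funpow by (simp add: fun_eq_iff)
  then show ?thesis using minper_fix[OF r(1), of 1] by simp
qed

text \<open>Linear interpolation of \<open>stefan\<close> at the integers 1 to
  \<open>2 * n + 1\<close>, with pieces of equal slope merged.\<close>

definition stefan_map :: "nat \<Rightarrow> real \<Rightarrow> real" where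
  "stefan_map n y = (if y \<le> 2 then real n + 1 + real n * (y - 1)
     else if y \<le> real n + 1 then 2 * real n + 3 - y
     else if y \<le> real n + 2 then real n + 2 - 2 * (y - (real n + 1))
     else 2 * real n + 2 - y)"

definition stefan_slope :: "nat \<Rightarrow> nat \<Rightarrow> real" where
  "stefan_slope n i = (if i = 1 then real n else if i = n + 1 then - 2 else - 1)"

lemma continuous_on_stefan_map:
  assumes "1 \<le> n"
  shows "continuous_on S (stefan_map n)"
  unfolding stefan_map_def
  by (intro continuous_on_cases_le continuous_intros) (use assms in auto)

lemma stefan_map_nat:
  assumes "1 \<le> n" "i \<in> {1..2 * n + 1}"
  shows "stefan_map n (real i) = real (stefan n i)"
proof -
  consider "i = 1" | "i = 2" | "3 \<le> i" "i \<le> n + 1" | "i = n + 2" "3 \<le> i" | "n + 3 \<le> i" "3 \<le> i"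
    using assms by fastforce
  then show ?thesis
    using assms by cases (auto simp: stefan_map_def stefan_def of_nat_diff)
qed

lemma stefan_map_affine:
  assumes n: "1 \<le> n" and i: "i \<in> {1..2 * n}" and y: "real i \<le> y" "y \<le> real i + 1"
  shows "stefan_map n y = real (stefan n i) + (y - real i) * stefan_slope n i"
    and "real (stefan n (Suc i)) = real (stefan n i) + stefan_slope n i"
proof -
  consider "i = 1" | "2 \<le> i" "i \<le> n" | "i = n + 1" "2 \<le> i" | "n + 2 \<le> i" using i by fastforce
  then have "stefan_map n y = real (stefan n i) + (y - real i) * stefan_slope n i \<and>
    real (stefan n (Suc i)) = real (stefan n i) + stefan_slope n i"
  proof cases
    case 1
    then show ?thesis using n y
      by (auto simp: stefan_map_def stefan_def stefan_slope_def algebra_simps)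
  next
    case 2
    then have "real i \<le> real n" "2 \<le> real i" by auto
    then have "stefan_map n y = 2 * real n + 3 - y"
      using 2 y n by (cases "y = 2") (auto simp: stefan_map_def)
    then show ?thesis using 2 i by (auto simp: stefan_def stefan_slope_def of_nat_diff)
  next
    case 3
    then have "2 \<le> y" using y by simp
    moreover have "n = 1" if "y = 2" using 3 y that by simp
    ultimately have "stefan_map n y = real n + 2 - 2 * (y - (real n + 1))"
      using 3 y n by (cases "y = 2") (auto simp: stefan_map_def)
    then show ?thesis using 3 n by (auto simp: stefan_def stefan_slope_def)
  next
    case 4
    then have "real n + 2 \<le> real i" by simp
    then have "stefan_map n y = 2 * real n + 2 - y"
      using y n by (auto simp: stefan_map_def)
    then show ?thesis using 4 i n by (auto simp: stefan_def stefan_slope_def of_nat_diff)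
  qed
  then show "stefan_map n y = real (stefan n i) + (y - real i) * stefan_slope n i"
    "real (stefan n (Suc i)) = real (stefan n i) + stefan_slope n i" by auto
qed

lemma stefan_range: "1 \<le> n \<Longrightarrow> i \<in> {1..2 * n + 1} \<Longrightarrow> stefan n i \<in> {1..2 * n + 1}"
  by (auto simp: stefan_def)

lemma stefan_iter:
  assumes "1 \<le> n"
  shows "i \<le> n \<Longrightarrow> (stefan n ^^ (2 * i + 1)) 1 = n + 1 - i"
    and "i < n \<Longrightarrow> (stefan n ^^ (2 * i + 2)) 1 = n + 2 + i"
proof -
  have left: "stefan n (n + 1 - i) = n + 2 + i" if "i < n" for i
    using that by (auto simp: stefan_def)
  have right: "stefan n (n + 2 + i) = n - i" if "i < n" for i
    using that by (auto simp: stefan_def)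
  have *: "(stefan n ^^ (2 * i + 1)) 1 = n + 1 - i" if "i \<le> n" for i
    using that
  proof (induction i)
    case 0
    then show ?case by (simp add: stefan_def)
  next
    case (Suc i)
    have "(stefan n ^^ (2 * Suc i + 1)) 1 = stefan n (stefan n ((stefan n ^^ (2 * i + 1)) 1))" by simp
    also have "\<dots> = n - i" using Suc left[of i] right[of i] by simp
    finally show ?case by simp
  qed
  show "i \<le> n \<Longrightarrow> (stefan n ^^ (2 * i + 1)) 1 = n + 1 - i" by (rule *)
  assume "i < n"
  then show "(stefan n ^^ (2 * i + 2)) 1 = n + 2 + i"
    using *[of i] left[of i] by simp
qed

lemma minper_stefan:
  assumes n: "1 \<le> n" and i: "i \<in> {1..2 * n + 1}"
  shows "minper (stefan n) (2 * n + 1) i"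
proof -
  have "minper (stefan n) (2 * n + 1) 1"
    unfolding minper_iff
  proof (intro conjI allI impI)
    show "(stefan n ^^ (2 * n + 1)) 1 = 1" using stefan_iter(1)[OF n, of n] by simp
    fix j assume j: "0 < j \<and> j < 2 * n + 1"
    show "(stefan n ^^ j) 1 \<noteq> 1"
    proof (cases "even j")
      case True
      then obtain i where "j = 2 * i" by (elim evenE)
      then have "j = 2 * (i - 1) + 2" "i - 1 < n" using j by auto
      then show ?thesis using stefan_iter(2)[OF n, of "i - 1"] by simp
    next
      case False
      then obtain i where "j = 2 * i + 1" by (elim oddE)
      then show ?thesis using stefan_iter(1)[OF n, of i] j by simp
    qed
  qed simp
  note one = this
  have "\<exists>j. (stefan n ^^ j) 1 = i"
  proof (cases "i \<le> n + 1")
    case True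
    then have "n + 1 - (n + 1 - i) = i" "n + 1 - i \<le> n" using i by auto
    then show ?thesis using stefan_iter(1)[OF n, of "n + 1 - i"] by metis
  next
    case False
    then have "n + 2 + (i - n - 2) = i" "i - n - 2 < n" using i by auto
    then show ?thesis using stefan_iter(2)[OF n, of "i - n - 2"] by metis
  qed
  then obtain j where "(stefan n ^^ j) 1 = i" by blast
  then show ?thesis using minper_funpow[OF one, of j] by simp
qed

lemma minper_stefan_map_nat:
  assumes n: "1 \<le> n" and i: "i \<in> {1..2 * n + 1}"
  shows "minper (stefan_map n) (2 * n + 1) (real i)"
proof -
  have "(stefan n ^^ l) i \<in> {1..2 * n + 1} \<and> (stefan_map n ^^ l) (real i) = real ((stefan n ^^ l) i)" for l
  proof (induction l)
    case (Suc l)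
    then show ?case using stefan_range[OF n, of "(stefan n ^^ l) i"]
        stefan_map_nat[OF n, of "(stefan n ^^ l) i"] by simp
  qed (use i in simp)
  then have "(stefan_map n ^^ l) (real i) = real ((stefan n ^^ l) i)" for l by blast
  then show ?thesis using minper_stefan[OF n i] by (simp add: minper_def)
qed

lemma nat_floor_bounds:
  assumes "1 \<le> y" "y < 2 * real n + 1"
  shows "nat \<lfloor>y\<rfloor> \<in> {1..2 * n}" "real (nat \<lfloor>y\<rfloor>) \<le> y" "y < real (nat \<lfloor>y\<rfloor>) + 1"
proof -
  define j where "j = \<lfloor>y\<rfloor>"
  have j: "\<lfloor>y\<rfloor> = j" "of_int j \<le> y" "y < of_int j + 1"
    unfolding j_def using floor_correct[of y] by simp_all
  then have "1 \<le> j" "j \<le> 2 * int n" using assms by linarith+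
  then show "nat \<lfloor>y\<rfloor> \<in> {1..2 * n}" "real (nat \<lfloor>y\<rfloor>) \<le> y" "y < real (nat \<lfloor>y\<rfloor>) + 1"
    unfolding j(1) using j(2,3) by auto
qed

lemma interval_index:
  assumes "1 \<le> n" "y \<in> {1..2 * real n + 1}"
  obtains i where "i \<in> {1..2 * n}" "real i \<le> y" "y \<le> real i + 1"
proof (cases "y = 2 * real n + 1")
  case True
  then show ?thesis using that[of "2 * n"] assms by auto
next
  case False
  then have "1 \<le> y" "y < 2 * real n + 1" using assms by auto
  from nat_floor_bounds[OF this] show ?thesis using that[of "nat \<lfloor>y\<rfloor>"] by auto
qed

lemma stefan_map_self:
  assumes n: "1 \<le> n"
  shows "stefan_map n ` {1..2 * real n + 1} \<subseteq> {1..2 * real n + 1}"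
proof
  fix v assume "v \<in> stefan_map n ` {1..2 * real n + 1}"
  then obtain y where y: "y \<in> {1..2 * real n + 1}" "v = stefan_map n y" by blast
  obtain i where i: "i \<in> {1..2 * n}" "real i \<le> y" "y \<le> real i + 1" using interval_index[OF n y(1)] .
  let ?A = "real (stefan n i)" and ?B = "real (stefan n (Suc i))"
  have "?A \<in> {1..2 * real n + 1}" "?B \<in> {1..2 * real n + 1}"
    using stefan_range[OF n, of i] stefan_range[OF n, of "Suc i"] i(1) by auto
  moreover have "v = (1 - (y - real i)) * ?A + (y - real i) * ?B"
    using stefan_map_affine[OF n i] y(2) by (simp add: algebra_simps)
  moreover have "convex {1..2 * real n + 1}" by (rule convex_real_interval)
  ultimately show "v \<in> {1..2 * real n + 1}"
    using convexD_alt[of "{1..2 * real n + 1}" ?A ?B "y - real i"] i by auto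
qed

text \<open>While two points follow the same walk their distance is multiplied by slopes of absolute
  value at least 1, and at least 2 somewhere. Both points return after \<open>m\<close> steps, so
  the distance returns too and must vanish.\<close>

lemma same_itinerary_eq:
  assumes n: "1 \<le> n" and w: "w \<in> walks n"
    and y: "\<And>l. (stefan_map n ^^ l) y \<in> {real (w l)..real (w l) + 1}" "(stefan_map n ^^ m) y = y"
    and z: "\<And>l. (stefan_map n ^^ l) z \<in> {real (w l)..real (w l) + 1}" "(stefan_map n ^^ m) z = z"
    and m: "0 < m"
  shows "y = z"
proof -
  let ?f = "stefan_map n"
  define D where "D l = \<bar>(?f ^^ l) y - (?f ^^ l) z\<bar>" for l
  have step: "D (Suc l) = \<bar>stefan_slope n (w l)\<bar> * D l" for l
  proof -
    have "(?f ^^ Suc l) y - (?f ^^ Suc l) z = stefan_slope n (w l) * ((?f ^^ l) y - (?f ^^ l) z)"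
      using stefan_map_affine(1)[OF n walksD(1)[OF w, of l], of "(?f ^^ l) y"] y(1)[of l]
        stefan_map_affine(1)[OF n walksD(1)[OF w, of l], of "(?f ^^ l) z"] z(1)[of l]
      by (simp add: algebra_simps)
    then show ?thesis by (simp add: D_def abs_mult)
  qed
  have D0: "0 \<le> D l" for l by (simp add: D_def)
  have "D l \<le> D (Suc l)" for l
  proof -
    have "1 \<le> \<bar>stefan_slope n (w l)\<bar>" using n by (auto simp: stefan_slope_def)
    then show ?thesis unfolding step using mult_right_mono[OF _ D0, of 1] by fastforce
  qed
  then have mono: "i \<le> j \<Longrightarrow> D i \<le> D j" for i j by (rule lift_Suc_mono_le)
  obtain l where "w l = n + 1 \<or> w l = 1 \<and> 2 \<le> n" using walk_expands[OF n w] by blast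
  then have "2 \<le> \<bar>stefan_slope n (w l)\<bar>" using n by (auto simp: stefan_slope_def)
  then have "2 * D l \<le> D (Suc l)" unfolding step by (rule mult_right_mono[OF _ D0])
  also have "\<dots> \<le> D (m * Suc l)" using m by (intro mono) (cases m; simp)
  also have "\<dots> = D 0" using funpow_mult_fix[OF y(2)] funpow_mult_fix[OF z(2)] by (simp add: D_def del: mult_Suc_right)
  also have "\<dots> \<le> D l" by (rule mono) simp
  finally have "D 0 \<le> 0" using D0[of l] mono[of 0 l] by linarith
  then show ?thesis by (simp add: D_def)
qed

text \<open>As \<open>m \<noteq> 2 * n + 1\<close>, the orbit meets none of the integers of the
  cycle, so rounding down names the only interval containing each iterate. If the itinerary repeats
  after \<open>d\<close> steps, \<open>y\<close> and its \<open>d\<close>-th iterate share an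
  itinerary and are equal.\<close>

lemma itinerary:
  assumes n: "1 \<le> n" and y: "y \<in> {1..2 * real n + 1}" "minper (stefan_map n) m y" and m: "m \<noteq> 2 * n + 1"
  defines "w \<equiv> \<lambda>l. nat \<lfloor>(stefan_map n ^^ l) y\<rfloor>"
  shows "w \<in> walks n" "\<And>l. (stefan_map n ^^ l) y \<in> {real (w l)..real (w l) + 1}" "minper shift m w"
proof -
  let ?f = "stefan_map n"
  have fin: "(?f ^^ l) y \<in> {1..2 * real n + 1}" for l by (rule self_funpow[OF stefan_map_self[OF n] y(1)])
  have nint: "(?f ^^ l) y \<noteq> real i" if "i \<in> {1..2 * n + 1}" for l i
  proof
    assume "(?f ^^ l) y = real i"
    then have "minper ?f m (real i)" using minper_funpow[OF y(2), of l] by simp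
    from minper_unique[OF this minper_stefan_map_nat[OF n that]] show False using m by simp
  qed
  have strict: "w l \<in> {1..2 * n} \<and> real (w l) < (?f ^^ l) y \<and> (?f ^^ l) y < real (w l) + 1" for l
  proof -
    let ?v = "(?f ^^ l) y"
    have v: "1 \<le> ?v" "?v \<le> 2 * real n + 1" using fin[of l] by auto
    have "?v \<noteq> 2 * real n + 1" using nint[of "2 * n + 1" l] by auto
    then have "?v < 2 * real n + 1" using v by simp
    note fl = nat_floor_bounds[OF v(1) this]
    have wl: "w l \<in> {1..2 * n}" "real (w l) \<le> ?v" "?v < real (w l) + 1" using fl by (auto simp: w_def)
    moreover have "?v \<noteq> real (w l)" using nint[of "w l" l] wl(1) by auto
    ultimately show ?thesis using wl by auto
  qed
  show it: "\<And>l. (?f ^^ l) y \<in> {real (w l)..real (w l) + 1}" using strict by (auto intro: less_imp_le)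
  have "covers (stefan n) (w l) (w (Suc l))" for l
  proof -
    let ?v = "(?f ^^ l) y" and ?u = "(?f ^^ Suc l) y" and ?i = "w l"
    let ?A = "real (stefan n ?i)" and ?B = "real (stefan n (Suc ?i))" and ?s = "stefan_slope n ?i"
    have i: "?i \<in> {1..2 * n}" "real ?i < ?v" "?v < real ?i + 1" using strict[of l] by auto
    have u: "?u = ?A + (?v - real ?i) * ?s" and B: "?B = ?A + ?s"
      using stefan_map_affine[OF n i(1), of ?v] i by auto
    have j: "real (w (Suc l)) < ?u" "?u < real (w (Suc l)) + 1" using strict[of "Suc l"] by auto
    have "?s \<noteq> 0" using n by (simp add: stefan_slope_def)
    then consider "0 < ?s" | "?s < 0" by linarith
    then have "(?A < ?u \<and> ?u < ?B) \<or> (?B < ?u \<and> ?u < ?A)"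
    proof cases
      case 1
      then have "0 < (?v - real ?i) * ?s" using i by simp
      moreover have "(?v - real ?i) * ?s < 1 * ?s" using 1 i by (intro mult_strict_right_mono) auto
      ultimately show ?thesis unfolding u B by simp
    next
      case 2
      then have "(?v - real ?i) * ?s < 0" using i by (simp add: mult_pos_neg)
      moreover have "1 * ?s < (?v - real ?i) * ?s" using 2 i by (intro mult_strict_right_mono_neg) auto
      ultimately show ?thesis unfolding u B by simp
    qed
    \<comment> \<open>The next interval meets the open segment between the images of the endpoints;
      these being integers, it lies inside.\<close>
    then have "(?A < real (w (Suc l)) + 1 \<and> real (w (Suc l)) < ?B) \<or>
        (?B < real (w (Suc l)) + 1 \<and> real (w (Suc l)) < ?A)" using j by linarith
    then show ?thesis unfolding covers_def by linarith
  qed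
  then show w: "w \<in> walks n" using strict unfolding walks_def by blast
  have fm: "(?f ^^ m) y = y" using minper_fix[OF y(2)] by simp
  have "(shift ^^ d) w = w \<longleftrightarrow> m dvd d" for d
  proof
    assume "m dvd d"
    then have "(?f ^^ d) y = y" using minper_fix[OF y(2)] by simp
    then have "w (l + d) = w l" for l by (simp add: w_def funpow_add)
    then show "(shift ^^ d) w = w" by (simp add: shift_funpow)
  next
    assume "(shift ^^ d) w = w"
    then have wd: "w (l + d) = w l" for l by (auto simp: shift_funpow dest: fun_cong)
    have "(?f ^^ l) ((?f ^^ d) y) \<in> {real (w l)..real (w l) + 1}" for l
      using it[of "l + d"] unfolding wd by (simp add: funpow_add)
    moreover have "(?f ^^ m) ((?f ^^ d) y) = (?f ^^ d) y"
      using minper_fix[OF minper_funpow[OF y(2), of d], of m] by simp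
    ultimately have "y = (?f ^^ d) y"
      using same_itinerary_eq[OF n w it fm _ _ minper_pos[OF y(2)]] by blast
    then show "m dvd d" using minper_fix[OF y(2), of d] by simp
  qed
  then show "minper shift m w" using minper_pos[OF y(2)] by (simp add: minper_def)
qed

text \<open>Itineraries inject the points into the primitive walks.\<close>

lemma stefan_map_points:
  assumes n: "1 \<le> n" and m: "0 < m" "m \<noteq> 2 * n + 1"
  defines "S \<equiv> {y. min_period_pt (stefan_map n) {1..2 * real n + 1} m y}"
  shows "finite S" "int (card S) \<le> PhiN n m"
proof -
  let ?P = "{w \<in> walks n. minper shift m w}"
  let ?w = "\<lambda>y l. nat \<lfloor>(stefan_map n ^^ l) y\<rfloor>"
  have S: "y \<in> {1..2 * real n + 1}" "minper (stefan_map n) m y" if "y \<in> S" for y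
    using that by (auto simp: S_def min_period_pt_iff)
  note it = itinerary[OF n S m(2)]
  have sub: "?w ` S \<subseteq> ?P" using it(1,3) by blast
  have inj: "inj_on ?w S"
  proof (rule inj_onI)
    fix y z assume y: "y \<in> S" and z: "z \<in> S" and eq: "?w y = ?w z"
    have "(stefan_map n ^^ l) z \<in> {real (?w y l)..real (?w y l) + 1}" for l
      using it(2)[OF z z, of l] fun_cong[OF eq, of l] by simp
    moreover have "(stefan_map n ^^ m) y = y" "(stefan_map n ^^ m) z = z"
      using minper_fix[OF S(2)] y z by auto
    ultimately show "y = z" using same_itinerary_eq[OF n it(1)[OF y y] it(2)[OF y y]] m(1) by blast
  qed
  have fin: "finite ?P" by (rule card_primitive_walks(1)[OF n m(1)])
  show "finite S" by (rule inj_on_finite[OF inj sub fin])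
  have "card S \<le> card ?P" by (rule card_inj_on_le[OF inj sub fin])
  then show "int (card S) \<le> PhiN n m" using card_primitive_walks(2)[OF n m(1)] by simp
qed

lemma stefan_map_no_earlier_period:
  assumes n: "1 \<le> n"
  shows "no_earlier_period (stefan_map n) {1..2 * real n + 1} n 0"
  unfolding no_earlier_period_def
proof (intro allI impI notI)
  fix j q y
  assume q: "odd q \<and> 1 < q \<and> (j < 0 \<or> j = 0 \<and> q < 2 * n + 1)"
    and "min_period_pt (stefan_map n) {1..2 * real n + 1} (2 ^ j * q) y"
  then have y: "y \<in> {1..2 * real n + 1}" "minper (stefan_map n) q y" by (auto simp: min_period_pt_iff)
  have "q \<noteq> 2 * n + 1" using q by simp
  from odd_primitive_walk[OF n itinerary(1,3)[OF n y this]] q show False by auto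
qed

section \<open>Period doubling\<close>

text \<open>The square of the doubled map is \<open>f\<close> on \<open>{a..b}\<close> and conjugate to \<open>f\<close> on the copy of
  \<open>{a..b}\<close> translated by \<open>2 (b - a)\<close>; in the gap between the two it is expanding.\<close>

definition doubled :: "(real \<Rightarrow> real) \<Rightarrow> real \<Rightarrow> real \<Rightarrow> real \<Rightarrow> real" where
  "doubled f a b y = (if y \<le> b then f y + 2 * (b - a)
     else if y \<le> b + (b - a) then a + (b + (b - a) - y) * ((f b + 2 * (b - a) - a) / (b - a))
     else y - 2 * (b - a))"

locale doubling =
  fixes f :: "real \<Rightarrow> real" and a b :: real
  assumes ab: "a < b" and cont: "continuous_on {a..b} f" and self: "f ` {a..b} \<subseteq> {a..b}"
begin

abbreviation "d \<equiv> b - a"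
abbreviation "F \<equiv> doubled f a b"
abbreviation "I \<equiv> {a..b + 2 * d}"

lemma f_in: "y \<in> {a..b} \<Longrightarrow> f y \<in> {a..b}"
  using self by blast

lemma F_left: "y \<in> {a..b} \<Longrightarrow> F y = f y + 2 * d"
  by (simp add: doubled_def)

lemma F_left_in: "y \<in> {a..b} \<Longrightarrow> F y \<in> {b + d..b + 2 * d}"
  using f_in[of y] by (simp add: F_left)

lemma F_right: "y \<in> {b + d..b + 2 * d} \<Longrightarrow> F y = y - 2 * d"
  using ab by (cases "y = b + d") (auto simp: doubled_def)

lemma F_right_in: "y \<in> {b + d..b + 2 * d} \<Longrightarrow> F y \<in> {a..b}"
  by (simp add: F_right)

text \<open>Across the gap, of length \<open>d\<close>, the map falls from
  \<open>f b + 2 * d\<close> to \<open>a\<close>, a drop of at least \<open>2 * d\<close>.\<close>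

lemma slope_ge: "2 \<le> (f b + 2 * d - a) / d"
proof -
  have "2 * d \<le> f b + 2 * d - a" using f_in[of b] ab by auto
  then show ?thesis using ab by (simp add: pos_le_divide_eq)
qed

lemma F_mid: "y \<in> {b<..<b + d} \<Longrightarrow> F y = a + (b + d - y) * ((f b + 2 * d - a) / d)"
  by (simp add: doubled_def)

lemma F_self: "F ` I \<subseteq> I"
proof
  fix v assume "v \<in> F ` I"
  then obtain y where y: "y \<in> I" "v = F y" by blast
  then consider "y \<in> {a..b}" | "y \<in> {b + d..b + 2 * d}" | "y \<in> {b<..<b + d}" by fastforce
  then show "v \<in> I"
  proof cases
    case 1
    then show ?thesis using F_left_in[OF 1] y ab by auto
  next
    case 2
    then show ?thesis using F_right_in[OF 2] y ab by auto
  next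
    case 3
    let ?s = "(f b + 2 * d - a) / d"
    have "0 \<le> (b + d - y) * ?s" using 3 slope_ge by (intro mult_nonneg_nonneg) auto
    moreover have "(b + d - y) * ?s \<le> d * ?s" using 3 slope_ge by (intro mult_right_mono) auto
    moreover have "d * ?s = f b + 2 * d - a" using ab by simp
    moreover have "f b \<le> b" using f_in[of b] ab by auto
    ultimately show ?thesis using F_mid[OF 3] y by auto
  qed
qed

lemma F_cont: "continuous_on I F"
  unfolding doubled_def
proof (intro continuous_on_cases_le)
  show "continuous_on {t \<in> I. t \<le> b} (\<lambda>y. f y + 2 * d)"
    by (intro continuous_intros continuous_on_subset[OF cont]) auto
qed (use ab in \<open>auto intro!: continuous_intros\<close>)

lemma F_iter:
  assumes "y \<in> {a..b}"
  shows "(F ^^ (2 * l)) y = (f ^^ l) y" "(F ^^ Suc (2 * l)) y = (f ^^ Suc l) y + 2 * d"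
proof -
  have fl: "(f ^^ l) y \<in> {a..b}" for l by (rule self_funpow[OF self assms])
  have sq: "F (F v) = f v" if "v \<in> {a..b}" for v
    using F_right[OF F_left_in[OF that]] F_left[OF that] by simp
  show *: "(F ^^ (2 * l)) y = (f ^^ l) y"
  proof (induction l)
    case (Suc l)
    have "(F ^^ (2 * Suc l)) y = F (F ((F ^^ (2 * l)) y))" by simp
    then show ?case using Suc sq[OF fl[of l]] by simp
  qed simp
  show "(F ^^ Suc (2 * l)) y = (f ^^ Suc l) y + 2 * d"
    using * F_left[OF fl[of l]] by simp
qed

lemma minper_F_even:
  assumes y: "y \<in> {a..b}" and t: "minper F t y"
  shows "even t"
proof (rule ccontr)
  assume "odd t"
  then obtain l where "t = 2 * l + 1" by (elim oddE)
  then have "(f ^^ Suc l) y + 2 * d = y" using minper_fix[OF t, of t] F_iter(2)[OF y, of l] by simp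
  moreover have "(f ^^ Suc l) y \<in> {a..b}" by (rule self_funpow[OF self y])
  ultimately show False using y ab by auto
qed

text \<open>On the left copy even iterates of \<open>F\<close> are iterates of \<open>f\<close>,
  while odd iterates land in the right copy and miss \<open>y\<close>.\<close>

lemma minper_F_iff:
  assumes y: "y \<in> {a..b}"
  shows "minper F (2 * r) y \<longleftrightarrow> minper f r y"
proof -
  have ev: "(F ^^ (2 * l)) y = y \<longleftrightarrow> (f ^^ l) y = y" for l using F_iter(1)[OF y, of l] by simp
  have od: "(F ^^ (2 * l + 1)) y \<noteq> y" for l
  proof
    assume "(F ^^ (2 * l + 1)) y = y"
    then have "(f ^^ Suc l) y + 2 * d = y" using F_iter(2)[OF y, of l] by simp
    moreover have "(f ^^ Suc l) y \<in> {a..b}" by (rule self_funpow[OF self y])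
    ultimately show False using y ab by auto
  qed
  show ?thesis
  proof
    assume F: "minper F (2 * r) y"
    have "(f ^^ l) y = y \<longleftrightarrow> r dvd l" for l
      using ev[of l] minper_fix[OF F, of "2 * l"] by simp
    then show "minper f r y" using minper_pos[OF F] by (simp add: minper_def)
  next
    assume f: "minper f r y"
    have "(F ^^ t) y = y \<longleftrightarrow> 2 * r dvd t" for t
    proof (cases "even t")
      case True
      then obtain l where t: "t = 2 * l" by (elim evenE)
      show ?thesis unfolding t using ev[of l] minper_fix[OF f, of l] by simp
    next
      case False
      then obtain l where t: "t = 2 * l + 1" by (elim oddE)
      have "\<not> 2 * r dvd t" using False by (meson dvd_mult_left)
      then show ?thesis using od[of l] t by simp
    qed
    then show "minper F (2 * r) y" using minper_pos[OF f] by (simp add: minper_def)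
  qed
qed

text \<open>The two copies together are invariant, so a periodic orbit starting in the gap stays
  there. In the gap \<open>F\<close> is affine with slope at most -2, so the distance between
  consecutive iterates at least doubles; being periodic, it is zero.\<close>

lemma minper_F_mid:
  assumes y: "y \<in> {b<..<b + d}" and t: "minper F t y"
  shows "t = 1"
proof -
  let ?A = "{a..b} \<union> {b + d..b + 2 * d}"
  have inv: "F ` ?A \<subseteq> ?A" using F_left_in F_right_in by blast
  have yA: "y \<notin> ?A" using y by auto
  have t0: "0 < t" by (rule minper_pos[OF t])
  have ft: "(F ^^ t) y = y" using minper_fix[OF t] by simp
  have yI: "y \<in> I" using y ab by auto
  have mid: "(F ^^ l) y \<in> {b<..<b + d}" for l
  proof (rule ccontr)
    assume "(F ^^ l) y \<notin> {b<..<b + d}"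
    moreover have "(F ^^ l) y \<in> I" by (rule self_funpow[OF F_self yI])
    ultimately have A: "(F ^^ l) y \<in> ?A" by auto
    have "t * l - l + l = t * l" using t0 by (cases t) auto
    then have "(F ^^ (t * l - l)) ((F ^^ l) y) = (F ^^ (t * l)) y"
      using fun_cong[OF funpow_add[of "t * l - l" l F], of y] by simp
    also have "\<dots> = y" by (rule funpow_mult_fix[OF ft])
    finally show False using self_funpow[OF inv A, of "t * l - l"] yA by simp
  qed
  define D where "D l = \<bar>(F ^^ Suc l) y - (F ^^ l) y\<bar>" for l
  define s where "s = (f b + 2 * d - a) / d"
  have D2: "2 * D l \<le> D (Suc l)" for l
  proof -
    have "F ((F ^^ Suc l) y) - F ((F ^^ l) y) = - s * ((F ^^ Suc l) y - (F ^^ l) y)"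
      unfolding F_mid[OF mid[of "Suc l"]] F_mid[OF mid[of l]] s_def[symmetric]
      by (simp only: left_diff_distrib right_diff_distrib mult_minus_left) (simp only: algebra_simps)
    then have "D (Suc l) = \<bar>s\<bar> * D l" by (simp add: D_def abs_mult)
    moreover have "2 \<le> \<bar>s\<bar>" using slope_ge unfolding s_def by linarith
    ultimately show ?thesis using mult_right_mono[of 2 "\<bar>s\<bar>" "D l"] by (simp add: D_def)
  qed
  have D0: "D 0 \<le> D l" for l
  proof (induction l)
    case (Suc l)
    have "0 \<le> D l" by (simp add: D_def)
    then show ?case using Suc D2[of l] by linarith
  qed simp
  obtain u where u: "t = Suc u" using t0 by (cases t) auto
  have "F ((F ^^ t) y) = F y" using ft by simp
  then have "D t = D 0" using ft by (simp add: D_def)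
  then have "D (Suc u) = D 0" using u by simp
  then have "D 0 \<le> 0" using D2[of u] D0[of u] by linarith
  then have "F y = y" by (simp add: D_def)
  then show ?thesis using minper_fix[OF t, of 1] by simp
qed

lemma minper_F_points:
  assumes r: "0 < r"
  shows "{y. min_period_pt F I (2 * r) y} =
    {y. min_period_pt f {a..b} r y} \<union> (\<lambda>y. y + 2 * d) ` {y. min_period_pt f {a..b} r y}"
proof (intro equalityI subsetI)
  fix y assume "y \<in> {y. min_period_pt F I (2 * r) y}"
  then have y: "y \<in> I" "minper F (2 * r) y" by (auto simp: min_period_pt_iff)
  have "y \<notin> {b<..<b + d}" using minper_F_mid[OF _ y(2)] r by auto
  then consider "y \<in> {a..b}" | "y \<in> {b + d..b + 2 * d}" using y(1) by fastforce
  then show "y \<in> {y. min_period_pt f {a..b} r y} \<union> (\<lambda>y. y + 2 * d) ` {y. min_period_pt f {a..b} r y}"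
  proof cases
    case 1
    then show ?thesis using minper_F_iff[OF 1] y(2) by (simp add: min_period_pt_iff)
  next
    case 2
    have "minper F (2 * r) (F y)" using minper_funpow[OF y(2), of 1] by simp
    then have "minper f r (F y)" using minper_F_iff[OF F_right_in[OF 2]] by simp
    then have "y - 2 * d \<in> {y. min_period_pt f {a..b} r y}"
      using F_right[OF 2] F_right_in[OF 2] by (simp add: min_period_pt_iff)
    then have "y - 2 * d + 2 * d \<in> (\<lambda>y. y + 2 * d) ` {y. min_period_pt f {a..b} r y}" by (rule imageI)
    then show ?thesis by simp
  qed
next
  fix v assume v: "v \<in> {y. min_period_pt f {a..b} r y} \<union> (\<lambda>y. y + 2 * d) ` {y. min_period_pt f {a..b} r y}"
  have left: "y \<in> {a..b} \<and> minper F (2 * r) y" if "y \<in> {y. min_period_pt f {a..b} r y}" for y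
    using that minper_F_iff[of y r] by (auto simp: min_period_pt_iff)
  have "minper F (2 * r) (y + 2 * d)" if y: "y \<in> {y. min_period_pt f {a..b} r y}" for y
  proof -
    obtain u where u: "r = Suc u" using r by (cases r) auto
    have "minper f r y" using y by (simp add: min_period_pt_iff)
    then have "(f ^^ Suc u) y = y" using minper_fix[of f r y r] u by simp
    \<comment> \<open>\<open>2 * u + 1\<close> is one less than the period \<open>2 * r\<close>: the
      translate precedes \<open>y\<close> on its orbit under \<open>F\<close>.\<close>
    then have "(F ^^ Suc (2 * u)) y = y + 2 * d" using F_iter(2)[of y u] left[OF y] by simp
    then show ?thesis using minper_funpow[of F "2 * r" y "Suc (2 * u)"] left[OF y] by simp
  qed
  then show "v \<in> {y. min_period_pt F I (2 * r) y}"
    using v left ab by (auto simp: min_period_pt_iff)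
qed

lemma card_minper_F_points:
  assumes r: "0 < r" and fin: "finite {y. min_period_pt f {a..b} r y}"
  shows "finite {y. min_period_pt F I (2 * r) y}"
    "card {y. min_period_pt F I (2 * r) y} = 2 * card {y. min_period_pt f {a..b} r y}"
proof -
  let ?S = "{y. min_period_pt f {a..b} r y}"
  have "?S \<inter> (\<lambda>y. y + 2 * d) ` ?S = {}"
    using ab by (auto simp: min_period_pt_iff)
  moreover have "card ((\<lambda>y. y + 2 * d) ` ?S) = card ?S" by (simp add: card_image)
  ultimately show "card {y. min_period_pt F I (2 * r) y} = 2 * card ?S"
    unfolding minper_F_points[OF r] using fin by (simp add: card_Un_disjoint)
  show "finite {y. min_period_pt F I (2 * r) y}"
    unfolding minper_F_points[OF r] using fin by simp
qed

text \<open>An orbit of period above 1 avoids the gap and so meets the left copy. Its period is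
  even, and half of it is a period of \<open>f\<close> with \<open>j\<close> lowered by one.\<close>

lemma F_no_earlier_period:
  assumes "no_earlier_period f {a..b} n k"
  shows "no_earlier_period F I n (Suc k)"
  unfolding no_earlier_period_def
proof (intro allI impI notI)
  fix j q y
  assume q: "odd q \<and> 1 < q \<and> (j < Suc k \<or> j = Suc k \<and> q < 2 * n + 1)"
    and "min_period_pt F I (2 ^ j * q) y"
  then have y: "y \<in> I" "minper F (2 ^ j * q) y" by (auto simp: min_period_pt_iff)
  have "2 ^ j * q \<noteq> 1" using q by simp
  then have "y \<notin> {b<..<b + d}" using minper_F_mid[OF _ y(2)] by blast
  then have "y \<in> {a..b} \<or> y \<in> {b + d..b + 2 * d}" using y(1) by auto
  then have "\<exists>v\<in>{a..b}. minper F (2 ^ j * q) v"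
    using y(2) minper_funpow[OF y(2), of 1] F_right_in[of y] by auto
  then obtain v where v: "v \<in> {a..b}" "minper F (2 ^ j * q) v" by blast
  have "even (2 ^ j * q)" by (rule minper_F_even[OF v])
  then have "j \<noteq> 0" using q by (cases "j = 0") auto
  then obtain i where j: "j = Suc i" by (cases j) auto
  have "minper F (2 * (2 ^ i * q)) v" using v(2) j by (simp add: mult.assoc)
  then have "min_period_pt f {a..b} (2 ^ i * q) v" using minper_F_iff[OF v(1)] v(1) by (simp add: min_period_pt_iff)
  then show False using assms[unfolded no_earlier_period_def, rule_format, of q i v] q j by auto
qed

end

text \<open>The statement is an exact count of points, so that each doubling multiplies it by 2. At
  \<open>k = 0\<close> the upper bound from itineraries meets \<open>orbits_lower_bound\<close> for
  the Stefan map. The strict \<open>a < b\<close> is carried along because doubling needs a gap of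
  positive length.\<close>

lemma sharp_example:
  assumes n: "1 \<le> n"
  shows "\<exists>f a b. a < b \<and> continuous_on {a..b} f \<and> f ` {a..b} \<subseteq> {a..b} \<and>
    (\<exists>z. min_period_pt f {a..b} (2 ^ k * (2 * n + 1)) z) \<and> no_earlier_period f {a..b} n k \<and>
    (\<forall>m. 0 < m \<and> m \<noteq> 2 * n + 1 \<longrightarrow> finite {y. min_period_pt f {a..b} (2 ^ k * m) y} \<and>
      int (card {y. min_period_pt f {a..b} (2 ^ k * m) y}) = 2 ^ k * PhiN n m)"
proof (induction k)
  case 0
  let ?f = "stefan_map n" and ?b = "2 * real n + 1"
  have cont: "continuous_on {1..?b} ?f" by (rule continuous_on_stefan_map[OF n])
  note self = stefan_map_self[OF n] and nop = stefan_map_no_earlier_period[OF n]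
  have "minper ?f (2 * n + 1) 1" using minper_stefan_map_nat[OF n, of 1] by simp
  then have z: "min_period_pt ?f {1..?b} (2 ^ 0 * (2 * n + 1)) 1" by (simp add: min_period_pt_iff)
  have "int (card {y. min_period_pt ?f {1..?b} m y}) = PhiN n m \<and> finite {y. min_period_pt ?f {1..?b} m y}"
    if m: "0 < m" "m \<noteq> 2 * n + 1" for m
  proof -
    note up = stefan_map_points[OF n m]
    have fo: "finite (orbits_of_period ?f {1..?b} (2 ^ 0 * m))" using finite_orbits[OF up(1)] by simp
    have "PhiN n m \<le> int (m * card (orbits_of_period ?f {1..?b} m))"
      using orbits_lower_bound[OF n m cont self nop z fo] by simp
    also have "m * card (orbits_of_period ?f {1..?b} m) = card {y. min_period_pt ?f {1..?b} m y}"
      using card_points_eq_card_orbits(2)[OF self finite_orbits[OF up(1)]] by simp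
    finally show ?thesis using up by linarith
  qed
  then show ?case using cont self nop z n
    by (intro exI[of _ ?f] exI[of _ 1] exI[of _ ?b]) auto
next
  case (Suc k)
  then obtain f :: "real \<Rightarrow> real" and a b where f: "a < b" "continuous_on {a..b} f" "f ` {a..b} \<subseteq> {a..b}"
    and z: "\<exists>z. min_period_pt f {a..b} (2 ^ k * (2 * n + 1)) z"
    and nop: "no_earlier_period f {a..b} n k"
    and pts: "\<And>m. 0 < m \<Longrightarrow> m \<noteq> 2 * n + 1 \<Longrightarrow> finite {y. min_period_pt f {a..b} (2 ^ k * m) y} \<and>
      int (card {y. min_period_pt f {a..b} (2 ^ k * m) y}) = 2 ^ k * PhiN n m"
    by blast
  interpret doubling f a b by standard (rule f)+
  have e: "2 ^ Suc k * m = 2 * (2 ^ k * m)" for m :: nat by simp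
  obtain z where "min_period_pt f {a..b} (2 ^ k * (2 * n + 1)) z" using z by blast
  then have "z \<in> {y. min_period_pt F I (2 * (2 ^ k * (2 * n + 1))) y}"
    by (subst minper_F_points) auto
  then have z': "\<exists>z. min_period_pt F I (2 ^ Suc k * (2 * n + 1)) z" unfolding e by blast
  have "finite {y. min_period_pt F I (2 ^ Suc k * m) y} \<and>
      int (card {y. min_period_pt F I (2 ^ Suc k * m) y}) = 2 ^ Suc k * PhiN n m"
    if m: "0 < m" "m \<noteq> 2 * n + 1" for m
    using card_minper_F_points[of "2 ^ k * m"] pts[OF m] m unfolding e by simp
  then show ?case
    using ab F_cont F_self z' F_no_earlier_period[OF nop]
    by (intro exI[of _ F] exI[of _ a] exI[of _ "b + 2 * d"]) auto
qed

lemma sh_prec_irrefl: "\<not> sh_prec s s"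
  by (auto simp: sh_prec_def)

text \<open>Infinitely many orbits form a separate alternative because \<open>card\<close> of an
  infinite set is 0; for the sharp map finiteness is asserted, so the equality there is a genuine
  count.\<close>

theorem theorem3:
  fixes n k :: nat
  assumes "1 \<le> n"
  defines "s \<equiv> 2 ^ k * (2 * n + 1)"
  shows "(\<forall>(f :: real \<Rightarrow> real) a b. sh_hyp f a b s \<longrightarrow>
            (\<forall>t. 0 < t \<and> sh_prec s t \<and> 2 ^ k dvd t \<longrightarrow>
               infinite (orbits_of_period f {a..b} t) \<or>
               real_of_int (PhiN n (t div 2 ^ k)) / real (t div 2 ^ k)
                 \<le> real (card (orbits_of_period f {a..b} t))))
       \<and> (\<exists>(f :: real \<Rightarrow> real) a b. sh_hyp f a b s \<and>
            (\<forall>t. 0 < t \<and> sh_prec s t \<and> 2 ^ k dvd t \<longrightarrow>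
               finite (orbits_of_period f {a..b} t) \<and>
               real (card (orbits_of_period f {a..b} t))
                 = real_of_int (PhiN n (t div 2 ^ k)) / real (t div 2 ^ k)))"
proof -
  \<comment> \<open>Irreflexivity of \<open>sh_prec\<close> gives \<open>t \<noteq> s\<close>, so
    the quotient is not \<open>2 * n + 1\<close>, the one length at which the cycle itself may
    follow a primitive walk.\<close>
  have t_form: "\<exists>m. t = 2 ^ k * m \<and> 0 < m \<and> m \<noteq> 2 * n + 1 \<and> t div 2 ^ k = m"
    if t: "0 < t \<and> sh_prec s t \<and> 2 ^ k dvd t" for t
  proof -
    obtain m where m: "t = 2 ^ k * m" using t by blast
    then have "m \<noteq> 2 * n + 1" using t sh_prec_irrefl[of s] by (auto simp: s_def)
    then show ?thesis using t m by auto
  qed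
  have "infinite (orbits_of_period f {a..b} t) \<or>
      real_of_int (PhiN n (t div 2 ^ k)) / real (t div 2 ^ k) \<le> real (card (orbits_of_period f {a..b} t))"
    if hyp: "sh_hyp f a b s" and t: "0 < t \<and> sh_prec s t \<and> 2 ^ k dvd t" for f a b t
  proof (rule disjCI)
    assume fin: "\<not> real_of_int (PhiN n (t div 2 ^ k)) / real (t div 2 ^ k) \<le> real (card (orbits_of_period f {a..b} t))"
    obtain m where m: "t = 2 ^ k * m" "0 < m" "m \<noteq> 2 * n + 1" "t div 2 ^ k = m" using t_form[OF t] by blast
    obtain z where h: "continuous_on {a..b} f" "f ` {a..b} \<subseteq> {a..b}" "no_earlier_period f {a..b} n k"
      "min_period_pt f {a..b} (2 ^ k * (2 * n + 1)) z"
      using hyp sh_hyp_iff[OF assms(1)] unfolding s_def by blast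
    show "infinite (orbits_of_period f {a..b} t)"
    proof
      assume "finite (orbits_of_period f {a..b} t)"
      then have "PhiN n m \<le> int (m * card (orbits_of_period f {a..b} t))"
        using orbits_lower_bound[OF assms(1) m(2,3) h] m(1) by simp
      then have "real_of_int (PhiN n m) \<le> real_of_int (int (m * card (orbits_of_period f {a..b} t)))"
        by (simp only: of_int_le_iff)
      then have "real_of_int (PhiN n m) / real m \<le> real (card (orbits_of_period f {a..b} t))"
        using m(2) by (simp add: field_simps)
      then show False using fin m(4) by simp
    qed
  qed
  moreover have "\<exists>(f :: real \<Rightarrow> real) a b. sh_hyp f a b s \<and>
            (\<forall>t. 0 < t \<and> sh_prec s t \<and> 2 ^ k dvd t \<longrightarrow>
               finite (orbits_of_period f {a..b} t) \<and>
               real (card (orbits_of_period f {a..b} t))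
                 = real_of_int (PhiN n (t div 2 ^ k)) / real (t div 2 ^ k))"
  proof -
    obtain f :: "real \<Rightarrow> real" and a b where f: "a < b" "continuous_on {a..b} f" "f ` {a..b} \<subseteq> {a..b}"
      "\<exists>z. min_period_pt f {a..b} (2 ^ k * (2 * n + 1)) z" "no_earlier_period f {a..b} n k"
      and pts: "\<And>m. 0 < m \<Longrightarrow> m \<noteq> 2 * n + 1 \<Longrightarrow> finite {y. min_period_pt f {a..b} (2 ^ k * m) y} \<and>
        int (card {y. min_period_pt f {a..b} (2 ^ k * m) y}) = 2 ^ k * PhiN n m"
      using sharp_example[OF assms(1), of k] by blast
    have "sh_hyp f a b s" unfolding s_def sh_hyp_iff[OF assms(1)] using f by auto
    moreover have "finite (orbits_of_period f {a..b} t) \<and> real (card (orbits_of_period f {a..b} t))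
        = real_of_int (PhiN n (t div 2 ^ k)) / real (t div 2 ^ k)"
      if t: "0 < t \<and> sh_prec s t \<and> 2 ^ k dvd t" for t
    proof -
      obtain m where m: "t = 2 ^ k * m" "0 < m" "m \<noteq> 2 * n + 1" "t div 2 ^ k = m" using t_form[OF t] by blast
      let ?c = "card (orbits_of_period f {a..b} t)"
      have fin: "finite (orbits_of_period f {a..b} t)"
        using finite_orbits pts[OF m(2,3)] m(1) by blast
      have "int (t * ?c) = 2 ^ k * PhiN n m"
        using card_points_eq_card_orbits(2)[OF f(3) fin] pts[OF m(2,3)] m(1) by simp
      \<comment> \<open>Each orbit has \<open>2 ^ k * m\<close> points, so the factor
        \<open>2 ^ k\<close> from the doublings cancels.\<close>
      then have "2 ^ k * (int m * int ?c) = 2 ^ k * PhiN n m" unfolding m(1) by (simp add: mult.assoc)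
      then have "PhiN n m = int m * int ?c" by simp
      then show ?thesis using fin m(2,4) by simp
    qed
    ultimately show ?thesis by blast
  qed
  ultimately show ?thesis by blast
qed

end
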